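(* Let $G=\mathbb{Z}_+^k$ ($k\ge1$) or let $G$ be a countable infinite discrete amenable group, and let $(X,G)$ be a $G$-system, where $X$ is a compact metric space with metric $d$. (1) If $\mathrm{mdim}(X,G)<\infty$, then for every Følner sequence $\{F_n\}$ of $G$, $$\mathrm{mdim}(X,G)=\max_{\mu\in\mathcal{M}(X,G)}\mathrm{mdim}_\mu(X,G;\{F_n\}).$$ (2) If $\overline{\mathrm{mdim}}_M(G,X,d)<\infty$, then $$\overline{\mathrm{mdim}}_M(G,X,d)=\max_{\mu\in\mathcal{M}(X,G)}\overline{\mathrm{mdim}}_M(G,\mu,X,d).$$
   Context: $\mathbb{Z}_+^k=\{(x_1,\dots,x_k)\in\mathbb{Z}^k:x_j\ge0\}$ is an additive semigroup. A $G$-system $(X,G)$ is a continuous action of $G$ on $X$, written $x\mapsto gx$, with $(g_1g_2)x=g_1(g_2x)$. $\mathcal{M}(X,G)$ is the set of $G$-invariant Borel probability measures on $X$. A Følner sequence is a sequence $\{F_n\}$ of non-empty finite subsets of $G$ with $\lim_n|gF_n\triangle F_n|/|F_n|=0$ for every $g\in G$. $C(X)$ is the space of real-valued continuous functions. For a non-empty finite $F\subset G$ and $f\in C(X)$, $S_Ff(x)=\sum_{g\in F}f(gx)$. Metric mean dimension with potential. Let $d_F(x,y)=\max_{g\in F}d(gx,gy)$; a set $E$ is $(d_F,\epsilon)$-separated if $d_F(x,y)>\epsilon$ for distinct $x,y\in E$. Put $P_F(X,f,d,\epsilon)=\sup\{\sum_{x\in E}e^{S_Ff(x)}:E\text{ is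 a }(d_F,\epsilon)\text{-separated set of }X\}$ and $$\overline{\mathrm{mdim}}_M(G,X,f,d)=\limsup_{\epsilon\to0}\frac1{\log\frac1\epsilon}\limsup_{n\to\infty}\frac1{|F_n|}\log P_{F_n}\big(X,f\cdot\log\tfrac1\epsilon,d,\epsilon\big),$$ where $\{F_n\}$ is a Følner sequence of $G$ (the value is independent of the choice of $\{F_n\}$). Put $\overline{\mathrm{mdim}}_M(G,X,d)=\overline{\mathrm{mdim}}_M(G,X,0,d)$ and, for $\mu\in\mathcal{M}(X,G)$, $\overline{\mathrm{mdim}}_M(G,\mu,X,d)=\inf_{f\in C(X)}\{\overline{\mathrm{mdim}}_M(G,X,f,d)-\int f\,d\mu\}$. Mean dimension with potential. Let $\mathcal{C}_X^o$ be the set of finite open covers of $X$. For a finite open cover $\mathcal{V}$, let $\mathrm{ord}_x(\mathcal{V})=\sum_{V\in\mathcal{V}}\chi_V(x)-1$ and $\mathrm{ord}(\mathcal{V})=\max_{x\in X}\mathrm{ord}_x(\mathcal{V})$. For $\mathcal{U}\in\mathcal{C}_X^o$ let $\mathcal{D}(\mathcal{U})=\min_{\mathcal{V}}\mathrm{ord}(\mathcal{V})$, the minimum over finite open covers $\mathcal{V}$ of $X$ refining $\mathcal{U}$. For non-empty finite $F\subset G$ let $\mathcal{U}_F=\bigvee_{g\in F}g^{-1}\mathcal{U}$. The limit $\mathrm{mdim}(G,\mathcal{U})=\lim_n\mathcal{D}(\mathcal{U}_{F_n})/|F_n|$ exists and is independent of the Følner sequence, and $\mathrm{mdim}(X,G)=\sup_{\mathcal{U}\in\mathcal{C}_X^o}\mathrm{mdim}(G,\mathcal{U})$.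 For a Følner sequence $\{F_n\}$ and $f\in C(X)$, let $\mathcal{P}_n(\mathcal{U})$ be the set of finite open covers $\mathcal{V}$ refining $\mathcal{U}_{F_n}$ that realize the minimum, i.e. $\mathrm{ord}(\mathcal{V})=\mathcal{D}(\mathcal{U}_{F_n})$; let $\mathcal{D}(S_{F_n}f,\mathcal{V})=\max_{x\in X}\{\mathrm{ord}_x(\mathcal{V})+S_{F_n}f(x)\}$, and $$\mathrm{mdim}(G,f,\mathcal{U};\{F_n\})=\limsup_{n\to\infty}\frac1{|F_n|}\sup_{\mathcal{V}\in\mathcal{P}_n(\mathcal{U})}\mathcal{D}(S_{F_n}f,\mathcal{V}),\qquad \mathrm{mdim}(X,G,f;\{F_n\})=\sup_{\mathcal{U}\in\mathcal{C}_X^o}\mathrm{mdim}(G,f,\mathcal{U};\{F_n\}).$$ For $\mu\in\mathcal{M}(X,G)$, $\mathrm{mdim}_\mu(X,G;\{F_n\})=\inf_{f\in C(X)}\{\mathrm{mdim}(X,G,f;\{F_n\})-\int f\,d\mu\}$. *)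

theory Defs
  imports "HOL-Probability.Probability" "HOL-Algebra.Coset"
begin

text \<open>The additive monoid of \<open>k\<close>-tuples of non-negative integers. A tuple is a function
  on \<open>{..<k}\<close>, extended by \<open>0\<close>.\<close>

definition Zplus :: "nat \<Rightarrow> (nat \<Rightarrow> int) monoid" where
  "Zplus k = \<lparr>carrier = {x. (\<forall>i<k. 0 \<le> x i) \<and> (\<forall>i\<ge>k. x i = 0)},
              mult = (\<lambda>x y i. x i + y i),
              one = (\<lambda>_. 0)\<rparr>"

definition folner_seq :: "('g, 'm) monoid_scheme \<Rightarrow> (nat \<Rightarrow> 'g set) \<Rightarrow> bool" where
  "folner_seq G F \<longleftrightarrow>
     (\<forall>n. finite (F n) \<and> F n \<noteq> {} \<and> F n \<subseteq> carrier G) \<and>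
     (\<forall>g\<in>carrier G.
        (\<lambda>n. real (card (sym_diff (g <#\<^bsub>G\<^esub> F n) (F n))) / real (card (F n))) \<longlonglongrightarrow> 0)"

definition countable_amenable_group :: "('g, 'm) monoid_scheme \<Rightarrow> bool" where
  "countable_amenable_group G \<longleftrightarrow>
     group G \<and> countable (carrier G) \<and> (\<exists>F. folner_seq G F)"

text \<open>The phase space is the whole type \<open>'x\<close>. The acting semigroup is discrete, so continuity
  of the action is continuity of each of its maps. Only compatibility with the
  multiplication is demanded; nothing is required of the unit.\<close>

definition G_system :: "('g, 'm) monoid_scheme \<Rightarrow> ('g \<Rightarrow> 'x::metric_space \<Rightarrow> 'x) \<Rightarrow> bool" where
  "G_system G act \<longleftrightarrow>
     (\<forall>g\<in>carrier G. continuous_on UNIV (act g)) \<and>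
     (\<forall>g\<in>carrier G. \<forall>h\<in>carrier G. \<forall>x. act (g \<otimes>\<^bsub>G\<^esub> h) x = act g (act h x))"

definition invariant_measures ::
  "('g, 'm) monoid_scheme \<Rightarrow> ('g \<Rightarrow> 'x::metric_space \<Rightarrow> 'x) \<Rightarrow> 'x measure set" where
  "invariant_measures G act =
     {\<mu>. prob_space \<mu> \<and> sets \<mu> = sets borel \<and>
         (\<forall>g\<in>carrier G. distr \<mu> borel (act g) = \<mu>)}"

definition C_space :: "('x::metric_space \<Rightarrow> real) set" where
  "C_space = {f. continuous_on UNIV f}"

definition birkhoff_sum :: "('g \<Rightarrow> 'x \<Rightarrow> 'x) \<Rightarrow> 'g set \<Rightarrow> ('x \<Rightarrow> real) \<Rightarrow> 'x \<Rightarrow> real" where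
  "birkhoff_sum act F f x = (\<Sum>g\<in>F. f (act g x))"

definition dyn_dist :: "('g \<Rightarrow> 'x::metric_space \<Rightarrow> 'x) \<Rightarrow> 'g set \<Rightarrow> 'x \<Rightarrow> 'x \<Rightarrow> real" where
  "dyn_dist act F x y = Max ((\<lambda>g. dist (act g x) (act g y)) ` F)"

definition separated_sets ::
  "('g \<Rightarrow> 'x::metric_space \<Rightarrow> 'x) \<Rightarrow> 'g set \<Rightarrow> real \<Rightarrow> 'x set set" where
  "separated_sets act F \<epsilon> = {E. \<forall>x\<in>E. \<forall>y\<in>E. x \<noteq> y \<longrightarrow> \<epsilon> < dyn_dist act F x y}"

text \<open>On a compact space, for continuous maps and \<open>\<epsilon> > 0\<close>, separated sets are finite with a
  uniform bound on their cardinality, so neither the sum over \<open>E\<close> nor the supremum takes a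
  default value.\<close>

definition sep_pressure ::
  "('g \<Rightarrow> 'x::metric_space \<Rightarrow> 'x) \<Rightarrow> 'g set \<Rightarrow> ('x \<Rightarrow> real) \<Rightarrow> real \<Rightarrow> real" where
  "sep_pressure act F f \<epsilon> =
     (SUP E\<in>separated_sets act F \<epsilon>. \<Sum>x\<in>E. exp (birkhoff_sum act F f x))"

definition mmdim_pot ::
  "('g \<Rightarrow> 'x::metric_space \<Rightarrow> 'x) \<Rightarrow> (nat \<Rightarrow> 'g set) \<Rightarrow> ('x \<Rightarrow> real) \<Rightarrow> ereal" where
  "mmdim_pot act F f =
     Limsup (at_right 0) (\<lambda>\<epsilon>. ereal (1 / ln (1 / \<epsilon>)) *
       limsup (\<lambda>n. ereal (1 / real (card (F n)) *
         ln (sep_pressure act (F n) (\<lambda>x. f x * ln (1 / \<epsilon>)) \<epsilon>))))"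

definition mmdim :: "('g \<Rightarrow> 'x::metric_space \<Rightarrow> 'x) \<Rightarrow> (nat \<Rightarrow> 'g set) \<Rightarrow> ereal" where
  "mmdim act F = mmdim_pot act F (\<lambda>_. 0)"

definition mmdim_meas ::
  "('g \<Rightarrow> 'x::metric_space \<Rightarrow> 'x) \<Rightarrow> (nat \<Rightarrow> 'g set) \<Rightarrow> 'x measure \<Rightarrow> ereal" where
  "mmdim_meas act F \<mu> =
     (INF f\<in>C_space. mmdim_pot act F f - ereal (integral\<^sup>L \<mu> f))"

definition open_covers :: "'x::metric_space set set set" where
  "open_covers = {\<U>. finite \<U> \<and> (\<forall>U\<in>\<U>. open U) \<and> \<Union>\<U> = UNIV}"

definition refines :: "'x set set \<Rightarrow> 'x set set \<Rightarrow> bool" where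
  "refines \<V> \<U> \<longleftrightarrow> (\<forall>V\<in>\<V>. \<exists>U\<in>\<U>. V \<subseteq> U)"

definition ord_at :: "'x set set \<Rightarrow> 'x \<Rightarrow> int" where
  "ord_at \<V> x = (\<Sum>V\<in>\<V>. indicator V x) - 1"

definition cover_ord :: "'x set set \<Rightarrow> int" where
  "cover_ord \<V> = Max (range (ord_at \<V>))"

definition cover_D :: "'x::metric_space set set \<Rightarrow> int" where
  "cover_D \<U> = (LEAST m. \<exists>\<V>\<in>open_covers. refines \<V> \<U> \<and> m = cover_ord \<V>)"

definition join_cover :: "('g \<Rightarrow> 'x \<Rightarrow> 'x) \<Rightarrow> 'g set \<Rightarrow> 'x set set \<Rightarrow> 'x set set" where
  "join_cover act F \<U> = {\<Inter>g\<in>F. act g -` u g | u. u \<in> F \<rightarrow> \<U>}"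

text \<open>By the Ornstein--Weiss lemma, for the semigroups at hand the limit exists along every
  Folner sequence and does not depend on it.\<close>

definition mdim_cover ::
  "('g, 'm) monoid_scheme \<Rightarrow> ('g \<Rightarrow> 'x::metric_space \<Rightarrow> 'x) \<Rightarrow> 'x set set \<Rightarrow> real" where
  "mdim_cover G act \<U> = (THE l. \<forall>F. folner_seq G F \<longrightarrow>
     (\<lambda>n. real_of_int (cover_D (join_cover act (F n) \<U>)) / real (card (F n))) \<longlonglongrightarrow> l)"

definition mdim :: "('g, 'm) monoid_scheme \<Rightarrow> ('g \<Rightarrow> 'x::metric_space \<Rightarrow> 'x) \<Rightarrow> ereal" where
  "mdim G act = (SUP \<U>\<in>open_covers. ereal (mdim_cover G act \<U>))"

definition optimal_refinements ::
  "('g \<Rightarrow> 'x::metric_space \<Rightarrow> 'x) \<Rightarrow> 'g set \<Rightarrow> 'x set set \<Rightarrow> 'x set set set" where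
  "optimal_refinements act F \<U> =
     {\<V>\<in>open_covers. refines \<V> (join_cover act F \<U>) \<and>
                    cover_ord \<V> = cover_D (join_cover act F \<U>)}"

text \<open>The local order is only lower semicontinuous, so the maximum over \<open>x\<close> need not be
  attained and is taken as a supremum.\<close>

definition cover_D_pot :: "('x \<Rightarrow> real) \<Rightarrow> 'x set set \<Rightarrow> ereal" where
  "cover_D_pot \<phi> \<V> = (SUP x. ereal (real_of_int (ord_at \<V> x) + \<phi> x))"

definition mdim_pot_cover ::
  "('g \<Rightarrow> 'x::metric_space \<Rightarrow> 'x) \<Rightarrow> (nat \<Rightarrow> 'g set) \<Rightarrow> ('x \<Rightarrow> real) \<Rightarrow> 'x set set \<Rightarrow> ereal" where
  "mdim_pot_cover act F f \<U> =
     limsup (\<lambda>n. ereal (1 / real (card (F n))) *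
       (SUP \<V>\<in>optimal_refinements act (F n) \<U>. cover_D_pot (birkhoff_sum act (F n) f) \<V>))"

definition mdim_pot ::
  "('g \<Rightarrow> 'x::metric_space \<Rightarrow> 'x) \<Rightarrow> (nat \<Rightarrow> 'g set) \<Rightarrow> ('x \<Rightarrow> real) \<Rightarrow> ereal" where
  "mdim_pot act F f = (SUP \<U>\<in>open_covers. mdim_pot_cover act F f \<U>)"

definition mdim_meas ::
  "('g \<Rightarrow> 'x::metric_space \<Rightarrow> 'x) \<Rightarrow> (nat \<Rightarrow> 'g set) \<Rightarrow> 'x measure \<Rightarrow> ereal" where
  "mdim_meas act F \<mu> =
     (INF f\<in>C_space. mdim_pot act F f - ereal (integral\<^sup>L \<mu> f))"

end

theory Submission
  imports Defs "HOL-Algebra.Divisibility"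
begin

text \<open>Both mean dimensions with potential have the form \<open>\<Gamma> f\<close> = iterated upper limit of normalised
  quantities that are monotone and convex in the Birkhoff sum of \<open>f\<close> over \<open>F\<^sub>n\<close>. So \<open>\<Gamma>\<close> is convex, monotone,
  compatible with adding constants, and \<open>\<Gamma> (f \<circ> g - f) \<le> \<Gamma> 0\<close>, because the Birkhoff sum of a coboundary is
  of size \<open>|gF\<^sub>n \<triangle> F\<^sub>n| = o(|F\<^sub>n|)\<close>. By Hahn--Banach there is a linear functional
  \<open>L \<le> \<Gamma> - \<Gamma> 0\<close>; it is positive, normalised and invariant, so by Riesz it is integration against an
  invariant probability measure, and this measure attains the maximum.

  For mean dimension one also needs \<open>\<Gamma> 0 = mdim\<close>, that is, convergence along every Folner
  sequence: the Ornstein--Weiss lemma applied to \<open>F \<mapsto> \<D>(\<U>\<^sub>F)\<close>, whose subadditivity is the inequality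
  \<open>\<D>(\<U> \<or> \<V>) \<le> \<D>(\<U>) + \<D>(\<V>)\<close>.\<close>

section \<open>Linear functionals dominated by convex functions\<close>

text \<open>The upper bound is free, because the potential 0 competes in the infimum. What has to be
  found is a measure for which no potential does better, that is, one whose integral of
  \<open>f\<close> is at most \<open>\<Gamma> f - \<Gamma> 0\<close> for every continuous
  \<open>f\<close>. This is exactly domination of a linear functional, so maximising measures are
  the supporting functionals of the convex function \<Gamma> at 0. Finiteness of
  \<open>\<Gamma> 0\<close> enters here: together with boundedness of potentials it makes \<Gamma>
  real valued.

  The obstacle in the mean dimension part is that elements of \<int>_+^k have no inverses. The
  Ornstein-Weiss argument therefore runs in a cancellative monoid, where a set can be translated but
  not translated back. Counts that a group argument makes by applying an inverse are made by
  injectivity of multiplication instead. Left multiplication measures invariance and right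
  multiplication makes the tiles; associativity lets the two pass through each other.\<close>

definition sublinear :: "('v::real_vector \<Rightarrow> real) \<Rightarrow> bool" where
  "sublinear p \<longleftrightarrow> (\<forall>u v. p (u + v) \<le> p u + p v) \<and> (\<forall>c v. 0 \<le> c \<longrightarrow> p (c *\<^sub>R v) = c * p v)"

lemma sublinearD:
  assumes "sublinear p"
  shows "p (u + v) \<le> p u + p v" "0 \<le> c \<Longrightarrow> p (c *\<^sub>R v) = c * p v" "p 0 = 0" "- p (- v) \<le> p v"
proof -
  show 1: "p (u + v) \<le> p u + p v" and "0 \<le> c \<Longrightarrow> p (c *\<^sub>R v) = c * p v" for u v c
    using assms by (auto simp: sublinear_def)
  from this(2)[of 0 0] show 0: "p 0 = 0" by simp
  show "- p (- v) \<le> p v" using 1[of v "- v"] 0 by simp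
qed

text \<open>Near-minimisers for \<open>u\<close> and for \<open>v\<close> can be replaced by the
  smaller of the two functionals, which is near-minimal for both; this is where the chain is used.
  The common bound \<open>p\<close> keeps every infimum finite, since
  \<open>- p (- v) \<le> q v\<close>.\<close>

lemma sublinear_INF_chain:
  fixes C :: "('v::real_vector \<Rightarrow> real) set"
  assumes "C \<noteq> {}" and sub: "\<And>q. q \<in> C \<Longrightarrow> sublinear q" and le: "\<And>q v. q \<in> C \<Longrightarrow> q v \<le> p v"
    and chain: "\<And>q r. q \<in> C \<Longrightarrow> r \<in> C \<Longrightarrow> q \<le> r \<or> r \<le> q"
  shows "sublinear (\<lambda>v. INF q\<in>C. q v)" and "\<And>q v. q \<in> C \<Longrightarrow> (INF q\<in>C. q v) \<le> q v"
proof -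
  have "- p (- v) \<le> q v" if "q \<in> C" for q v
    using sublinearD(4)[OF sub[OF that], of v] le[OF that, of "- v"] by linarith
  then have bdd: "bdd_below ((\<lambda>q. q v) ` C)" for v by (intro bdd_belowI2)
  show low: "\<And>q v. q \<in> C \<Longrightarrow> (INF q\<in>C. q v) \<le> q v"
    by (rule cINF_lower[OF bdd])
  show "sublinear (\<lambda>v. INF q\<in>C. q v)"
    unfolding sublinear_def
  proof (intro conjI allI impI)
    fix u v :: 'v
    show "(INF q\<in>C. q (u + v)) \<le> (INF q\<in>C. q u) + (INF q\<in>C. q v)"
    proof (rule field_le_epsilon)
      fix e :: real assume "e > 0"
      then have "(INF q\<in>C. q u) < (INF q\<in>C. q u) + e/2" "(INF q\<in>C. q v) < (INF q\<in>C. q v) + e/2"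
        by auto
      then obtain q r where qr: "q \<in> C" "q u < (INF q\<in>C. q u) + e/2" "r \<in> C" "r v < (INF q\<in>C. q v) + e/2"
        using cINF_less_iff[OF \<open>C \<noteq> {}\<close> bdd] by meson
      define s where "s = (if q \<le> r then q else r)"
      have s: "s \<in> C" "s u \<le> q u" "s v \<le> r v"
        using chain[OF qr(1) qr(3)] qr by (auto simp: s_def le_fun_def)
      have "(INF q\<in>C. q (u + v)) \<le> s (u + v)" using low s by blast
      also have "\<dots> \<le> s u + s v" using sublinearD(1)[OF sub[OF s(1)]] .
      finally show "(INF q\<in>C. q (u + v)) \<le> (INF q\<in>C. q u) + (INF q\<in>C. q v) + e"
        using s qr by linarith
    qed
  next
    fix c :: real and v :: 'v assume c: "0 \<le> c"
    have "(INF q\<in>C. q (c *\<^sub>R v)) = (INF q\<in>C. c * q v)"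
      by (rule INF_cong) (use sublinearD(2)[OF sub c] in auto)
    also have "\<dots> = c * (INF q\<in>C. q v)"
    proof (cases "c = 0")
      case True then show ?thesis using \<open>C \<noteq> {}\<close> by simp
    next
      case False
      then have "c > 0" using c by simp
      have "mono (\<lambda>x. c * x)" using c by (auto intro!: monoI mult_left_mono)
      then have "c * Inf ((\<lambda>q. q v) ` C) = (INF x\<in>(\<lambda>q. q v) ` C. c * x)"
        by (rule continuous_at_Inf_mono) (use bdd \<open>C \<noteq> {}\<close> in \<open>auto intro!: continuous_intros\<close>)
      then show ?thesis by (simp add: image_comp o_def)
    qed
    finally show "(INF q\<in>C. q (c *\<^sub>R v)) = c * (INF q\<in>C. q v)" .
  qed
qed

text \<open>A minimal sublinear functional is unchanged by shearing, hence odd, hence linear.\<close>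

lemma sublinear_shear:
  fixes q :: "'v::real_vector \<Rightarrow> real" and u :: 'v
  defines "r \<equiv> \<lambda>v. INF t\<in>{0..}. q (v + t *\<^sub>R u) - t * q u"
  assumes q: "sublinear q"
  shows "sublinear r" and "r v \<le> q v" and "r (- u) \<le> - q u"
proof -
  note [simp] = sublinearD(3)[OF q]
  have bdd: "bdd_below ((\<lambda>t. q (v + t *\<^sub>R u) - t * q u) ` {0..})" for v
  proof (rule bdd_belowI2)
    fix t :: real assume t: "t \<in> {0..}"
    have "q (t *\<^sub>R u) \<le> q (v + t *\<^sub>R u) + q (- v)"
      using sublinearD(1)[OF q, of "v + t *\<^sub>R u" "- v"] by simp
    then show "- q (- v) \<le> q (v + t *\<^sub>R u) - t * q u"
      using sublinearD(2)[OF q, of t u] t by simp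
  qed
  have low: "r v \<le> q (v + t *\<^sub>R u) - t * q u" if "0 \<le> t" for v t
    unfolding r_def by (rule cINF_lower[OF bdd]) (use that in auto)
  show "r v \<le> q v" using low[of 0 v] by simp
  \<comment> \<open>At \<open>t = 1\<close> the shear cancels \<open>- u\<close> and leaves
    \<open>q 0 - q u\<close>.\<close>
  show "r (- u) \<le> - q u" using low[of 1 "- u"] by simp
  show "sublinear r"
    unfolding sublinear_def
  proof (intro conjI allI impI)
    fix v w
    show "r (v + w) \<le> r v + r w"
    proof (rule field_le_epsilon)
      fix e :: real assume "e > 0"
      then have ex: "\<exists>t\<ge>0. q (v + t *\<^sub>R u) - t * q u < r v + e/2" for v
        using cINF_less_iff[OF _ bdd[of v], where a = "r v + e/2"] by (auto simp: r_def)
      obtain s t where st: "0 \<le> s" "0 \<le> t" "q (v + s *\<^sub>R u) - s * q u < r v + e/2"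
          "q (w + t *\<^sub>R u) - t * q u < r w + e/2"
        using ex by meson
      have "r (v + w) \<le> q ((v + w) + (s + t) *\<^sub>R u) - (s + t) * q u" using low st by simp
      moreover have "q ((v + w) + (s + t) *\<^sub>R u) \<le> q (v + s *\<^sub>R u) + q (w + t *\<^sub>R u)"
        using sublinearD(1)[OF q, of "v + s *\<^sub>R u" "w + t *\<^sub>R u"] by (simp add: algebra_simps)
      ultimately show "r (v + w) \<le> r v + r w + e"
        using st by (simp add: algebra_simps)
    qed
  next
    fix c :: real and v assume c: "0 \<le> c"
    have le: "r (c *\<^sub>R v) \<le> c * r v" if "0 < c" for c v
    proof -
      have "r (c *\<^sub>R v) / c \<le> r v"
      proof (subst (2) r_def, rule cINF_greatest)
        fix t :: real assume "t \<in> {0..}"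
        then have t: "0 \<le> t" by simp
        have "r (c *\<^sub>R v) \<le> q (c *\<^sub>R v + (c * t) *\<^sub>R u) - (c * t) * q u" using low[of "c * t"] t that by simp
        also have "\<dots> = c * (q (v + t *\<^sub>R u) - t * q u)"
          using sublinearD(2)[OF q, of c "v + t *\<^sub>R u"] that by (simp add: algebra_simps)
        finally show "r (c *\<^sub>R v) / c \<le> q (v + t *\<^sub>R u) - t * q u"
          using that by (simp add: field_simps)
      qed auto
      then show ?thesis using that by (simp add: field_simps)
    qed
    show "r (c *\<^sub>R v) = c * r v"
    proof (cases "c = 0")
      case True
      have "r 0 = 0"
        unfolding r_def using sublinearD(2)[OF q, of _ u] by (simp cong: INF_cong_simp)
      then show ?thesis using True by simp
    next
      case False
      then have "c > 0" using c by simp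
      from le[of "1/c" "c *\<^sub>R v"] \<open>c > 0\<close> have "c * r v \<le> r (c *\<^sub>R v)" by (simp add: field_simps)
      with le[OF \<open>c > 0\<close>] show ?thesis by (meson antisym)
    qed
  qed
qed

text \<open>No functional is extended from a subspace: every minimal element among the sublinear
  functions below \<open>p\<close> is already linear, and Zorn's lemma for the reversed pointwise
  order provides one.\<close>

lemma ex_linear_le_sublinear:
  fixes p :: "'v::real_vector \<Rightarrow> real"
  assumes p: "sublinear p"
  shows "\<exists>L. linear L \<and> (\<forall>v. L v \<le> p v)"
proof -
  define A where "A = {q. sublinear q \<and> q \<le> p}"
  have "\<exists>m\<in>A. \<forall>a\<in>A. a \<le> m \<longrightarrow> a = m"
  proof (rule predicate_Zorn)
    show "partial_order_on A (relation_of (\<lambda>x y. y \<le> x) A)"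
      by (rule partial_order_on_relation_ofI) auto
  next
    fix C assume C: "C \<in> Chains (relation_of (\<lambda>x y. y \<le> x) A)"
    then have CA: "C \<subseteq> A" and ch: "\<And>q r. q \<in> C \<Longrightarrow> r \<in> C \<Longrightarrow> q \<le> r \<or> r \<le> q"
      by (auto simp: Chains_def relation_of_def)
    show "\<exists>u\<in>A. \<forall>a\<in>C. u \<le> a"
    proof (cases "C = {}")
      case True
      then show ?thesis using p by (auto simp: A_def)
    next
      case False
      have s: "\<And>q. q \<in> C \<Longrightarrow> sublinear q" "\<And>q v. q \<in> C \<Longrightarrow> q v \<le> p v"
        using CA by (auto simp: A_def le_fun_def)
      have I: "sublinear (\<lambda>v. INF q\<in>C. q v)" "\<And>q v. q \<in> C \<Longrightarrow> (INF q\<in>C. q v) \<le> q v"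
        by (rule sublinear_INF_chain[where p = p]; use False s ch in blast)+
      have "(\<lambda>v. INF q\<in>C. q v) \<in> A"
        using I False s(2) by (fastforce simp: A_def le_fun_def intro: order_trans)
      then show ?thesis using I(2) by (intro bexI[of _ "\<lambda>v. INF q\<in>C. q v"]) (auto simp: le_fun_def)
    qed
  qed
  then obtain m where m: "sublinear m" "m \<le> p" and min: "\<And>a. sublinear a \<Longrightarrow> a \<le> m \<Longrightarrow> a = m"
    by (auto simp: A_def intro: order_trans)
  have odd: "m (- u) = - m u" for u
  proof -
    note r = sublinear_shear[OF m(1), where u = u]
    \<comment> \<open>The sheared function is sublinear and lies below \<open>m\<close>, so
      minimality makes it equal to \<open>m\<close>; its value at \<open>- u\<close> then gives
      oddness.\<close>
    have "(\<lambda>v. INF t\<in>{0..}. m (v + t *\<^sub>R u) - t * m u) = m"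
      by (rule min) (simp_all only: le_fun_def r, simp)
    from fun_cong[OF this, of "- u"] have "m (- u) \<le> - m u" using r(3) by linarith
    with sublinearD(4)[OF m(1), of u] show ?thesis by linarith
  qed
  have "linear m"
  proof
    show "m (u + v) = m u + m v" for u v
      using sublinearD(1)[OF m(1), of u v] sublinearD(1)[OF m(1), of "- u" "- v"] odd[of u] odd[of v] odd[of "u + v"]
      by simp
    show "m (c *\<^sub>R v) = c *\<^sub>R m v" for c v
    proof (cases "0 \<le> c")
      case True then show ?thesis using sublinearD(2)[OF m(1)] by simp
    next
      case False then show ?thesis using sublinearD(2)[OF m(1), of "- c" v] odd[of "c *\<^sub>R v"] by simp
    qed
  qed
  then show ?thesis using m(2) by (auto simp: le_fun_def)
qed

text \<open>The one-sided directional derivative of \<open>P\<close> at 0 is sublinear. Convexity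
  and \<open>P 0 = 0\<close> make the difference quotient monotone in \<open>t\<close>, so the
  derivative is an infimum and no limit has to be taken; the quotient at \<open>t = 1\<close>
  compares it with \<open>P\<close>.\<close>

theorem ex_linear_le_convex:
  fixes P :: "'v::real_vector \<Rightarrow> real"
  assumes convex: "\<And>u v t. 0 \<le> t \<Longrightarrow> t \<le> 1 \<Longrightarrow> P (t *\<^sub>R u + (1 - t) *\<^sub>R v) \<le> t * P u + (1 - t) * P v"
    and P0: "P 0 = 0"
  shows "\<exists>L. linear L \<and> (\<forall>v. L v \<le> P v)"
proof -
  define p where "p v = (INF t\<in>{0<..}. P (t *\<^sub>R v) / t)" for v
  have bdd: "bdd_below ((\<lambda>t. P (t *\<^sub>R v) / t) ` {0<..})" for v
  proof (rule bdd_belowI2)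
    fix t :: real assume "t \<in> {0<..}"
    then have t: "t > 0" by simp
    \<comment> \<open>0 is the convex combination of \<open>t *\<^sub>R v\<close> and
      \<open>- v\<close> with these weights.\<close>
    have "P ((1 / (1 + t)) *\<^sub>R (t *\<^sub>R v) + (1 - 1 / (1 + t)) *\<^sub>R (- v))
        \<le> 1 / (1 + t) * P (t *\<^sub>R v) + (1 - 1 / (1 + t)) * P (- v)"
      by (rule convex) (use t in auto)
    moreover have "1 - 1 / (1 + t) = t / (1 + t)" using t by (simp add: field_simps)
    ultimately have "0 \<le> 1 / (1 + t) * P (t *\<^sub>R v) + t / (1 + t) * P (- v)"
      using P0 t by simp
    then have "0 \<le> (P (t *\<^sub>R v) + t * P (- v)) / (1 + t)" by (simp add: add_divide_distrib)
    then have "0 \<le> P (t *\<^sub>R v) + t * P (- v)" using t by (simp add: zero_le_divide_iff)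
    then show "- P (- v) \<le> P (t *\<^sub>R v) / t" using t by (simp add: field_simps)
  qed
  have low: "p v \<le> P (t *\<^sub>R v) / t" if "0 < t" for v t
    unfolding p_def by (rule cINF_lower[OF bdd]) (use that in auto)
  have "sublinear p"
    unfolding sublinear_def
  proof (intro conjI allI impI)
    fix v w
    show "p (v + w) \<le> p v + p w"
    proof (rule field_le_epsilon)
      fix e :: real assume "e > 0"
      have ex: "\<exists>t>0. P (t *\<^sub>R v) / t < p v + e/2" for v
      proof -
        have "p v < p v + e/2" using \<open>e > 0\<close> by simp
        then show ?thesis using cINF_less_iff[OF _ bdd[of v], where a = "p v + e/2"] by (auto simp: p_def)
      qed
      obtain s t where st: "0 < s" "0 < t" "P (s *\<^sub>R v) / s < p v + e/2" "P (t *\<^sub>R w) / t < p w + e/2"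
        using ex by meson
      \<comment> \<open>The weights below send \<open>s *\<^sub>R v\<close> and
        \<open>t *\<^sub>R w\<close> to multiples with the same factor \<open>r\<close>, where
        \<open>1 / r = 1 / s + 1 / t\<close>.\<close>
      define r where "r = s * t / (s + t)"
      have r: "r > 0" using st by (simp add: r_def)
      have a: "1 - t / (s + t) = s / (s + t)" using st by (simp add: field_simps)
      have "P ((t / (s + t)) *\<^sub>R (s *\<^sub>R v) + (1 - t / (s + t)) *\<^sub>R (t *\<^sub>R w))
          \<le> t / (s + t) * P (s *\<^sub>R v) + (1 - t / (s + t)) * P (t *\<^sub>R w)"
        by (rule convex) (use st in auto)
      moreover have "(t / (s + t)) *\<^sub>R (s *\<^sub>R v) + (1 - t / (s + t)) *\<^sub>R (t *\<^sub>R w) = r *\<^sub>R (v + w)"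
        by (simp add: a r_def algebra_simps)
      ultimately have "P (r *\<^sub>R (v + w)) \<le> t / (s + t) * P (s *\<^sub>R v) + s / (s + t) * P (t *\<^sub>R w)"
        by (simp add: a)
      also have "\<dots> = r * (P (s *\<^sub>R v) / s + P (t *\<^sub>R w) / t)"
        using st by (simp add: r_def distrib_left)
      finally have "P (r *\<^sub>R (v + w)) / r \<le> P (s *\<^sub>R v) / s + P (t *\<^sub>R w) / t"
        using r by (simp add: field_simps)
      with low[OF r, of "v + w"] st show "p (v + w) \<le> p v + p w + e" by linarith
    qed
  next
    have le: "p (c *\<^sub>R v) \<le> c * p v" if "0 < c" for c v
    proof -
      have "p (c *\<^sub>R v) / c \<le> p v"
        unfolding p_def[of v]
      proof (rule cINF_greatest)
        fix t :: real assume "t \<in> {0<..}"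
        then have t: "0 < t" by simp
        show "p (c *\<^sub>R v) / c \<le> P (t *\<^sub>R v) / t"
          using low[of "t / c" "c *\<^sub>R v"] t that by (simp add: field_simps)
      qed auto
      then show ?thesis using that by (simp add: field_simps)
    qed
    fix c :: real and v assume c: "0 \<le> c"
    show "p (c *\<^sub>R v) = c * p v"
    proof (cases "c = 0")
      case True
      then show ?thesis by (simp add: p_def P0 cong: INF_cong_simp)
    next
      case False
      then have "c > 0" using c by simp
      from le[of "1/c" "c *\<^sub>R v"] \<open>c > 0\<close> have "c * p v \<le> p (c *\<^sub>R v)" by (simp add: field_simps)
      with le[OF \<open>c > 0\<close>] show ?thesis by (meson antisym)
    qed
  qed
  then obtain L where "linear L" "\<And>v. L v \<le> p v" using ex_linear_le_sublinear by blast
  moreover have "p v \<le> P v" for v using low[of 1 v] by simp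
  ultimately show ?thesis by (meson order_trans)
qed

section \<open>Riesz representation on compact metric spaces\<close>

text \<open>By convention the distance to the empty set is 0, so the whole space needs its own value
  for the function to be positive exactly on \<open>U\<close>.\<close>

definition open_dist :: "'x::metric_space set \<Rightarrow> 'x \<Rightarrow> real" where
  "open_dist U x = (if U = UNIV then 1 else infdist x (- U))"

lemma continuous_on_open_dist [continuous_intros]: "continuous_on A (open_dist U)"
  by (cases "U = UNIV") (auto simp: open_dist_def[abs_def] intro!: continuous_intros)

lemma open_dist_nonneg [simp]: "0 \<le> open_dist U x"
  by (simp add: open_dist_def infdist_nonneg)

lemma open_dist_pos_iff: "open U \<Longrightarrow> 0 < open_dist U x \<longleftrightarrow> x \<in> U"
  using in_closed_iff_infdist_zero[of "- U" x] infdist_nonneg[of x "- U"]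
  by (cases "U = UNIV") (auto simp: open_dist_def less_le)

lemma open_dist_eq_0: "open U \<Longrightarrow> x \<notin> U \<Longrightarrow> open_dist U x = 0"
  using open_dist_pos_iff[of U x] open_dist_nonneg[of U x] by linarith

text \<open>The argument may be any function, but the laws concern the continuous ones only. The
  mass \<open>I (\<lambda>_. 1)\<close> is left free; it becomes the total mass of the representing
  measure.\<close>

locale positive_functional =
  fixes I :: "('x::metric_space \<Rightarrow> real) \<Rightarrow> real"
  assumes compact: "compact (UNIV :: 'x set)"
    and add: "\<And>f g. continuous_on UNIV f \<Longrightarrow> continuous_on UNIV g \<Longrightarrow> I (\<lambda>x. f x + g x) = I f + I g"
    and scale: "\<And>f c. continuous_on UNIV f \<Longrightarrow> I (\<lambda>x. c * f x) = c * I f"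
    and nonneg: "\<And>f. continuous_on UNIV f \<Longrightarrow> (\<And>x. 0 \<le> f x) \<Longrightarrow> 0 \<le> I f"
begin

lemma diff:
  assumes "continuous_on UNIV f" "continuous_on UNIV g"
  shows "I (\<lambda>x. f x - g x) = I f - I g"
  using add[of f "\<lambda>x. (-1) * g x"] scale[of g "-1"] assms by (simp add: continuous_intros)

lemma mono:
  assumes "continuous_on UNIV f" "continuous_on UNIV g" "\<And>x. f x \<le> g x"
  shows "I f \<le> I g"
  using nonneg[of "\<lambda>x. g x - f x"] diff[of g f] assms by (simp add: continuous_intros)

lemma sum:
  assumes "finite A" "\<And>i. i \<in> A \<Longrightarrow> continuous_on UNIV (f i)"
  shows "I (\<lambda>x. \<Sum>i\<in>A. f i x) = (\<Sum>i\<in>A. I (f i))"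
  using assms
proof (induction A rule: finite_induct)
  case empty
  then show ?case using scale[of "\<lambda>_. 1" 0] by simp
next
  case (insert a A)
  then show ?case using add[of "f a" "\<lambda>x. \<Sum>i\<in>A. f i x"] by (simp add: continuous_intros)
qed

section \<open>Outer measure induced by a positive functional\<close>

definition below :: "'x set \<Rightarrow> ('x \<Rightarrow> real) set" where
  "below U = {f. continuous_on UNIV f \<and> (\<forall>x. 0 \<le> f x \<and> f x \<le> indicator U x)}"

text \<open>The Riesz content of an open set. Competitors need not have their support inside the
  set; compactness is recovered from the superlevel sets \<open>{x. c \<le> f x}\<close>, which lie
  inside it for \<open>c > 0\<close>.\<close>

definition content :: "'x set \<Rightarrow> ennreal" where
  "content U = (SUP f\<in>below U. ennreal (I f))"

definition outer :: "'x set \<Rightarrow> ennreal" where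
  "outer A = (INF U\<in>{U. open U \<and> A \<subseteq> U}. content U)"

lemma content_upper: "f \<in> below U \<Longrightarrow> ennreal (I f) \<le> content U"
  by (auto simp: content_def intro: SUP_upper)

lemma content_mono:
  assumes "U \<subseteq> V"
  shows "content U \<le> content V"
proof -
  have "indicat_real U x \<le> indicator V x" for x
    using assms by (auto simp: indicator_def)
  then have "below U \<subseteq> below V"
    unfolding below_def by (blast intro: order_trans)
  then show ?thesis
    unfolding content_def by (rule SUP_subset_mono) simp
qed

lemma zero_below: "(\<lambda>_. 0) \<in> below U"
  by (auto simp: below_def)

lemma content_empty: "content {} = 0"
proof -
  have "f = (\<lambda>_. 0)" if "f \<in> below {}" for f using that by (auto simp: below_def fun_eq_iff intro: antisym)
  then show ?thesis using scale[of "\<lambda>_. 1" 0] by (auto simp: content_def bot_ennreal intro!: antisym SUP_least)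
qed

lemma content_le: "content U \<le> ennreal (I (\<lambda>_. 1))"
  unfolding content_def
proof (rule SUP_least)
  fix f assume f: "f \<in> below U"
  then have "f x \<le> 1" for x by (auto simp: below_def intro: order_trans[of _ "indicator U x"])
  then show "ennreal (I f) \<le> ennreal (I (\<lambda>_. 1))" using f by (auto simp: below_def intro!: ennreal_leI mono)
qed

lemma outer_open: "open U \<Longrightarrow> outer U = content U"
  unfolding outer_def by (rule antisym) (auto intro!: INF_lower INF_greatest content_mono)

lemma outer_mono: "A \<subseteq> B \<Longrightarrow> outer A \<le> outer B"
  unfolding outer_def by (rule INF_superset_mono) auto

lemma outer_le: "outer A \<le> ennreal (I (\<lambda>_. 1))"
  using outer_mono[of A UNIV] outer_open[of UNIV] content_le[of UNIV] by auto

text \<open>Up to the constant \<open>c\<close>, a competitor lives on the compact set where it is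
  at least \<open>c\<close>, and finitely many of the open sets cover that. Capped multiples of
  distance functions replace a partition of unity: they only have to sum to at least 1
  there.\<close>

lemma content_UN:
  assumes op: "\<And>n::nat. open (U n)"
  shows "content (\<Union>n. U n) \<le> (\<Sum>n. content (U n))"
  unfolding content_def[of "\<Union>n. U n"]
proof (rule SUP_least)
  fix f assume "f \<in> below (\<Union>n. U n)"
  then have f: "continuous_on UNIV f" "\<And>x. 0 \<le> f x" "\<And>x. f x \<le> indicator (\<Union>n. U n) x"
    by (auto simp: below_def)
  have f1: "f x \<le> 1" for x using f(3)[of x] by (rule order_trans) (simp add: indicator_def)
  show "ennreal (I f) \<le> (\<Sum>n. content (U n))"
  proof (rule ennreal_le_epsilon)
    fix e :: real assume "0 < e"
    \<comment> \<open>The added 1 avoids a division by zero when the total mass vanishes.\<close>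
    define c where "c = e / (I (\<lambda>_. 1) + 1)"
    have I1: "0 \<le> I (\<lambda>_. 1)" by (rule nonneg) auto
    have c: "0 < c" "c * I (\<lambda>_. 1) \<le> e" using \<open>0 < e\<close> I1 by (auto simp: c_def field_simps)
    define K where "K = {x. c \<le> f x}"
    have "closed K" unfolding K_def by (rule closed_Collect_le) (auto intro: continuous_intros f)
    then have "compact K" using compact_Int_closed[OF compact] by simp
    moreover have "K \<subseteq> (\<Union>n. U n)"
    proof
      fix x assume "x \<in> K"
      then have "0 < indicat_real (\<Union>n. U n) x" using f(3)[of x] c(1) by (simp add: K_def del: indicator_simps)
      then show "x \<in> (\<Union>n. U n)" by (rule contrapos_pp) simp
    qed
    ultimately obtain J where J: "finite J" "K \<subseteq> (\<Union>n\<in>J. U n)"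
      using op compactE_image[of K UNIV U] by (metis subset_UNIV)
    define s where "s x = (\<Sum>n\<in>J. open_dist (U n) x)" for x
    have s: "continuous_on UNIV s" unfolding s_def by (intro continuous_intros)
    have spos: "0 < s x" if "x \<in> K" for x
    proof -
      obtain n where n: "n \<in> J" "x \<in> U n" using J(2) \<open>x \<in> K\<close> by blast
      then have "0 < open_dist (U n) x" using op open_dist_pos_iff by blast
      then show ?thesis unfolding s_def using n J by (intro sum_pos2[of J n]) auto
    qed
    obtain M where M: "0 < M" "\<And>x. x \<in> K \<Longrightarrow> 1 \<le> M * s x"
    proof (cases "K = {}")
      case True then show ?thesis using that[of 1] by auto
    next
      case False
      obtain x0 where x0: "x0 \<in> K" "\<And>x. x \<in> K \<Longrightarrow> s x0 \<le> s x"
        using continuous_attains_inf[OF \<open>compact K\<close> False continuous_on_subset[OF s]] by auto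
      show ?thesis
      proof (rule that[of "1 / s x0"])
        show "0 < 1 / s x0" using spos x0 by auto
        show "1 \<le> 1 / s x0 * s x" if "x \<in> K" for x using x0(2)[OF that] spos[OF x0(1)] by (simp add: field_simps)
      qed
    qed
    define h where "h n x = min 1 (M * open_dist (U n) x)" for n x
    have hc: "continuous_on UNIV (h n)" for n unfolding h_def by (intro continuous_intros)
    have hb: "h n \<in> below (U n)" for n
      using hc[of n] M(1) op[of n] by (auto simp: below_def h_def indicator_def open_dist_eq_0)
    have hn: "0 \<le> h n x" for n x using M(1) by (auto simp: h_def)
    have le: "f x \<le> c + (\<Sum>n\<in>J. h n x)" for x
    proof (cases "x \<in> K")
      case False then show ?thesis using sum_nonneg[of J "\<lambda>n. h n x"] hn by (force simp: K_def)
    next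
      case True
      \<comment> \<open>Either one cap is reached and alone contributes 1, or no cap is active and
        the sum is \<open>M * s x\<close>.\<close>
      have "1 \<le> (\<Sum>n\<in>J. h n x)"
      proof (cases "\<exists>n\<in>J. 1 \<le> M * open_dist (U n) x")
        case True
        then obtain n where n: "n \<in> J" "h n x = 1" by (auto simp: h_def)
        then show ?thesis using member_le_sum[of n J "\<lambda>n. h n x"] hn J by auto
      next
        case False
        then have "(\<Sum>n\<in>J. h n x) = M * s x"
          by (auto simp: h_def s_def sum_distrib_left intro!: sum.cong)
        then show ?thesis using M(2)[OF True] by simp
      qed
      then show ?thesis using f1[of x] c by simp
    qed
    have "I f \<le> I (\<lambda>x. c + (\<Sum>n\<in>J. h n x))"
      by (rule mono) (auto intro!: continuous_intros f hc le)
    also have "\<dots> = c * I (\<lambda>_. 1) + (\<Sum>n\<in>J. I (h n))"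
      using add[of "\<lambda>_. c" "\<lambda>x. \<Sum>n\<in>J. h n x"] scale[of "\<lambda>_. 1" c] sum[OF J(1) hc] hc
      by (simp add: continuous_intros)
    finally have 1: "I f \<le> (\<Sum>n\<in>J. I (h n)) + e" using c by linarith
    have hI: "0 \<le> I (h n)" for n by (rule nonneg) (auto simp: hc hn)
    have "ennreal (I f) \<le> ennreal (\<Sum>n\<in>J. I (h n)) + ennreal e"
      using 1 \<open>0 < e\<close> hI by (subst ennreal_plus[symmetric]) (auto intro!: ennreal_leI sum_nonneg)
    also have "ennreal (\<Sum>n\<in>J. I (h n)) = (\<Sum>n\<in>J. ennreal (I (h n)))"
      using hI by (simp add: sum_ennreal)
    also have "\<dots> \<le> (\<Sum>n\<in>J. content (U n))" by (intro sum_mono content_upper hb)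
    also have "\<dots> \<le> (\<Sum>n. content (U n))" by (rule sum_le_suminf) (use J in auto)
    finally show "ennreal (I f) \<le> (\<Sum>n. content (U n)) + ennreal e" by (simp add: add_right_mono)
  qed
qed

lemma outer_UN: "outer (\<Union>n::nat. A n) \<le> (\<Sum>n. outer (A n))"
proof (rule ennreal_le_epsilon)
  fix e :: real assume e: "0 < e"
  have "\<exists>U. open U \<and> A n \<subseteq> U \<and> content U \<le> outer (A n) + ennreal (e * (1/2)^Suc n)" for n
  proof -
    \<comment> \<open>Finiteness makes the enlarged value strictly larger, so some open superset has
      content below it. The enlargements sum to \<open>e\<close>.\<close>
    have "outer (A n) < top_class.top" using outer_le[of "A n"] by (auto simp: less_top intro: le_less_trans)
    then have "outer (A n) < outer (A n) + ennreal (e * (1/2)^Suc n)"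
      using e by (simp add: ennreal_add_left_cancel_less zero_less_iff_neq_zero[symmetric] del: power_Suc)
    moreover have "\<exists>U\<in>{U. open U \<and> A n \<subseteq> U}. content U < c" if "outer (A n) < c" for c
      using that unfolding outer_def INF_less_iff .
    ultimately show ?thesis by (blast intro: less_imp_le)
  qed
  then obtain U where U: "\<And>n. open (U n)" "\<And>n. A n \<subseteq> U n"
      "\<And>n. content (U n) \<le> outer (A n) + ennreal (e * (1/2)^Suc n)" by metis
  have "outer (\<Union>n. A n) \<le> outer (\<Union>n. U n)" by (rule outer_mono) (use U in auto)
  also have "\<dots> = content (\<Union>n. U n)" by (rule outer_open) (use U in auto)
  also have "\<dots> \<le> (\<Sum>n. content (U n))" by (rule content_UN) (rule U)
  also have "\<dots> \<le> (\<Sum>n. outer (A n) + ennreal (e * (1/2)^Suc n))" by (intro suminf_le U) auto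
  also have "\<dots> = (\<Sum>n. outer (A n)) + (\<Sum>n. ennreal (e * (1/2)^Suc n))"
    by (rule suminf_add[symmetric]) auto
  also have "(\<Sum>n. ennreal (e * (1/2)^Suc n)) = ennreal e"
    using sums_mult[OF power_half_series, of e] e
    by (subst suminf_ennreal2) (auto simp: sums_iff)
  finally show "outer (\<Union>n. A n) \<le> (\<Sum>n. outer (A n)) + ennreal e" .
qed

text \<open>\<open>V - U\<close> need not be open. It is enlarged to the open set of points of
  \<open>V\<close> at which a nearly optimal competitor \<open>f\<close> for
  \<open>V \<inter> U\<close> is below \<open>c\<close>. There \<open>max 0 (f x - c)\<close>
  vanishes, so it can be added to a competitor for the enlarged set without exceeding 1, at the cost
  of \<open>c\<close> times the total mass.\<close>

lemma outer_split_open: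
  assumes U: "open U" and V: "open V"
  shows "outer (V \<inter> U) + outer (V - U) \<le> content V"
proof (rule ennreal_le_epsilon)
  fix e :: real assume e: "0 < e"
  have I1: "0 \<le> I (\<lambda>_. 1)" by (rule nonneg) auto
  have approx: "\<exists>f\<in>below W. content W \<le> ennreal (I f + d)" if "0 < d" for W and d :: real
  proof -
    have "content W \<noteq> top_class.top" using content_le[of W] by (metis ennreal_neq_top top.extremum_unique)
    then obtain r where r: "content W = ennreal r" "0 \<le> r" by (metis ennreal_cases)
    show ?thesis
    proof (cases "r < d")
      case True
      have "I (\<lambda>_. 0) = 0" using scale[of "\<lambda>_. 1" 0] by simp
      then have "content W \<le> ennreal (I (\<lambda>_. 0) + d)" using True r by (simp add: ennreal_leI)
      then show ?thesis using zero_below by blast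
    next
      case False
      then have "ennreal (r - d) < content W" using r \<open>0 < d\<close> by (auto simp: ennreal_less_iff)
      moreover have "\<exists>f\<in>below W. c < ennreal (I f)" if "c < content W" for c
        using that unfolding content_def less_SUP_iff .
      ultimately obtain f where f: "f \<in> below W" "ennreal (r - d) < ennreal (I f)" by blast
      then have "r - d < I f" using False by (simp add: ennreal_less_iff)
      then have "content W \<le> ennreal (I f + d)" using r by (simp add: ennreal_leI)
      then show ?thesis using f by blast
    qed
  qed
  \<comment> \<open>One third of \<open>e\<close> for this truncation, one third for each of the two
    nearly optimal competitors.\<close>
  define c where "c = e / (3 * (I (\<lambda>_. 1) + 1))"
  have c: "0 < c" "c * I (\<lambda>_. 1) \<le> e / 3" using e I1 by (auto simp: c_def field_simps)
  obtain f where f: "f \<in> below (V \<inter> U)" "content (V \<inter> U) \<le> ennreal (I f + e/3)"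
    using approx[of "e/3"] e by auto
  define W where "W = V \<inter> {x. f x < c}"
  have fc: "continuous_on UNIV f" and f0: "\<And>x. 0 \<le> f x" and f1: "\<And>x. f x \<le> indicator (V \<inter> U) x"
    using f by (auto simp: below_def)
  have "open W" unfolding W_def using fc by (intro open_Int V open_Collect_less) auto
  have "V - U \<subseteq> W"
  proof
    fix x assume x: "x \<in> V - U"
    then have "f x = 0" using f1[of x] f0[of x] by auto
    then show "x \<in> W" using x c by (simp add: W_def)
  qed
  obtain g where g: "g \<in> below W" "content W \<le> ennreal (I g + e/3)"
    using approx[of "e/3"] e by auto
  have gc: "continuous_on UNIV g" and g0: "\<And>x. 0 \<le> g x" and g1: "\<And>x. g x \<le> indicator W x"
    using g by (auto simp: below_def)
  define h where "h x = max 0 (f x - c) + g x" for x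
  have hb: "h \<in> below V"
  proof -
    have "continuous_on UNIV h" unfolding h_def by (intro continuous_intros fc gc)
    moreover have "0 \<le> h x" for x using g0[of x] by (simp add: h_def)
    moreover have "h x \<le> indicator V x" for x
      using g1[of x] f1[of x] g0[of x] f0[of x] c(1)
      by (cases "x \<in> U"; cases "f x < c"; cases "x \<in> V") (simp_all add: h_def W_def)
    ultimately show ?thesis by (auto simp: below_def)
  qed
  have "I f + I g \<le> I (\<lambda>x. h x + c)"
    by (subst add[symmetric]; (intro mono)?) (use fc gc in \<open>auto simp: h_def intro!: continuous_intros\<close>)
  also have "\<dots> = I h + c * I (\<lambda>_. 1)"
    using add[of h "\<lambda>_. c"] scale[of "\<lambda>_. 1" c] hb by (simp add: below_def)
  finally have *: "I f + e/3 + (I g + e/3) \<le> I h + e" using c by linarith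
  have nn: "0 \<le> I f" "0 \<le> I g" "0 \<le> I h" using nonneg fc f0 gc g0 hb by (auto simp: below_def)
  have "outer (V \<inter> U) + outer (V - U) \<le> content (V \<inter> U) + content W"
    using outer_open[OF open_Int[OF V U]] outer_mono[OF \<open>V - U \<subseteq> W\<close>] outer_open[OF \<open>open W\<close>]
    by (intro add_mono) auto
  also have "\<dots> \<le> ennreal (I f + e/3) + ennreal (I g + e/3)" by (intro add_mono f g)
  also have "\<dots> \<le> ennreal (I h + e)"
    by (subst ennreal_plus[of "I f + e/3" "I g + e/3", symmetric]) (use nn e * in \<open>auto simp del: ennreal_plus intro!: ennreal_leI\<close>)
  also have "\<dots> = ennreal (I h) + ennreal e" using nn e by simp
  also have "\<dots> \<le> content V + ennreal e" by (intro add_right_mono content_upper hb)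
  finally show "outer (V \<inter> U) + outer (V - U) \<le> content V + ennreal e" .
qed

text \<open>Every set has an outer measure, so Caratheodory's construction runs over the full power
  set. Since \<open>outer\<close> is defined through open supersets, an arbitrary test set reduces
  to an open one.\<close>

lemma borel_subset_lambda_system: "sets borel \<subseteq> lambda_system UNIV UNIV outer"
  and outer_measure_space: "outer_measure_space UNIV outer"
proof -
  have pos: "positive UNIV outer"
    using outer_open[of "{}"] content_empty by (simp add: positive_def)
  show oms: "outer_measure_space UNIV outer"
    using pos outer_mono outer_UN
    by (auto simp: outer_measure_space_def increasing_def countably_subadditive_def)
  interpret sigma_algebra UNIV "UNIV :: 'x set set" by (rule sigma_algebra_Pow[of UNIV, simplified])
  interpret L: sigma_algebra UNIV "lambda_system UNIV UNIV outer"
    using caratheodory_lemma[OF oms] by (simp add: measure_space_def)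
  have "U \<in> lambda_system UNIV UNIV outer" if U: "open U" for U
    unfolding lambda_system_eq
  proof (intro CollectI conjI ballI antisym UNIV_I)
    fix A
    show "outer (A \<inter> U) + outer (A - U) \<le> outer A"
      unfolding outer_def[of A]
    proof (rule INF_greatest, clarify)
      fix V assume V: "open V" "A \<subseteq> V"
      have "outer (A \<inter> U) + outer (A - U) \<le> outer (V \<inter> U) + outer (V - U)"
        using V by (intro add_mono outer_mono) auto
      also have "\<dots> \<le> content V" by (rule outer_split_open[OF U V(1)])
      finally show "outer (A \<inter> U) + outer (A - U) \<le> content V" .
    qed
    \<comment> \<open>Padding with empty sets derives the inequality for two sets from countable
      subadditivity.\<close>
    define B where "B = (\<lambda>n::nat. if n = 0 then A \<inter> U else if n = 1 then A - U else {})"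
    have "A \<subseteq> (\<Union>n. B n)"
    proof
      fix x assume "x \<in> A"
      then have "x \<in> B 0 \<or> x \<in> B 1" by (simp add: B_def)
      then show "x \<in> (\<Union>n. B n)" by blast
    qed
    then have "outer A \<le> (\<Sum>n. outer (B n))"
      using outer_mono outer_UN order_trans by blast
    also have "\<dots> = (\<Sum>n<2. outer (B n))"
      by (rule suminf_finite) (auto simp: B_def outer_open content_empty)
    also have "\<dots> = outer (A \<inter> U) + outer (A - U)" by (simp add: B_def numeral_2_eq_2)
    finally show "outer A \<le> outer (A \<inter> U) + outer (A - U)" .
  qed
  then have "sigma_sets UNIV {S. open S} \<subseteq> lambda_system UNIV UNIV outer"
    by (intro L.sigma_sets_subset) auto
  then show "sets borel \<subseteq> lambda_system UNIV UNIV outer" by (simp add: borel_def)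
qed

section \<open>The representing measure\<close>

definition repr_measure :: "'x measure" where
  "repr_measure = measure_of UNIV (sets borel) outer"

lemma sets_repr_measure [simp, measurable_cong]: "sets repr_measure = sets borel"
  unfolding repr_measure_def by (metis sets.sets_measure_of_eq space_borel)

lemma emeasure_repr_measure: "A \<in> sets borel \<Longrightarrow> emeasure repr_measure A = outer A"
  unfolding repr_measure_def
proof (rule emeasure_measure_of_sigma)
  interpret sigma_algebra UNIV "UNIV :: 'x set set" by (rule sigma_algebra_Pow[of UNIV, simplified])
  have m: "measure_space UNIV (lambda_system UNIV UNIV outer) outer"
    by (rule caratheodory_lemma[OF outer_measure_space])
  show "sigma_algebra UNIV (sets (borel :: 'x measure))" using sets.sigma_algebra_axioms[of borel] by simp
  show "positive (sets borel) outer" using m by (simp add: measure_space_def positive_def)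
  show "countably_additive (sets borel) outer"
    using m borel_subset_lambda_system unfolding measure_space_def countably_additive_def by blast
qed

lemma space_repr_measure [simp]: "space repr_measure = UNIV"
  using sets_eq_imp_space_eq[OF sets_repr_measure] by simp

lemma finite_repr_measure: "finite_measure repr_measure"
  by (rule finite_measureI) (use outer_le[of UNIV] in \<open>auto simp: emeasure_repr_measure top_unique\<close>)

lemma measure_repr_UNIV: "measure repr_measure UNIV = I (\<lambda>_. 1)"
proof -
  have "content UNIV = ennreal (I (\<lambda>_. 1))"
    by (rule antisym[OF content_le content_upper]) (auto simp: below_def)
  then show ?thesis using nonneg[of "\<lambda>_. 1"] by (simp add: measure_def emeasure_repr_measure outer_open)
qed

lemma integrable_repr_measure:
  assumes "continuous_on UNIV f"
  shows "integrable repr_measure (f :: 'x \<Rightarrow> real)"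
proof -
  interpret finite_measure repr_measure by (rule finite_repr_measure)
  have "bounded (range f)" using compact_continuous_image[OF assms compact] by (rule compact_imp_bounded)
  then obtain B where "\<And>x. norm (f x) \<le> B" by (auto simp: bounded_iff)
  moreover have "f \<in> borel_measurable repr_measure"
    using borel_measurable_continuous_onI[OF assms] measurable_cong_sets[OF sets_repr_measure refl] by auto
  ultimately show ?thesis by (intro integrable_const_bound[of _ B]) auto
qed

text \<open>Layer cake: \<open>h k\<close> is the slice of \<open>N * f\<close> between the heights
  \<open>k\<close> and \<open>k + 1\<close>. It lies under the indicator of \<open>U k\<close>, so
  the measure of \<open>U k\<close> bounds \<open>I (h k)\<close>, while the indicators together
  exceed \<open>N * f\<close> by at most 1. The error is the total mass divided by
  \<open>N\<close>.\<close>

lemma le_integral_unit: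
  assumes f: "continuous_on UNIV f" and f01: "\<And>x. 0 \<le> f x" "\<And>x. f x \<le> 1"
  shows "I f \<le> integral\<^sup>L repr_measure f"
proof (rule field_le_epsilon)
  interpret finite_measure repr_measure by (rule finite_repr_measure)
  fix e :: real assume e: "0 < e"
  define N where "N = Suc (nat \<lceil>I (\<lambda>_. 1) / e\<rceil>)"
  have N: "0 < real N" "I (\<lambda>_. 1) / N \<le> e"
  proof -
    have "I (\<lambda>_. 1) / e \<le> N" unfolding N_def by linarith
    then show "I (\<lambda>_. 1) / N \<le> e" using e by (simp add: N_def field_simps)
  qed (simp add: N_def)
  define h where "h k x = min 1 (max 0 (N * f x - real k))" for k x
  define U where "U k = {x. real k / N < f x}" for k
  have hc: "continuous_on UNIV (h k)" for k unfolding h_def by (intro continuous_intros f)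
  have Uo: "open (U k)" for k unfolding U_def by (intro open_Collect_less continuous_intros f)
  have hb: "h k \<in> below (U k)" for k
    using hc[of k] N(1) by (auto simp: below_def h_def U_def indicator_def field_simps)
  have layers: "(\<Sum>k<n. h k x) = min (real n) (N * f x)" for n x
    by (induction n) (use f01[of x] in \<open>auto simp: h_def min_def max_def\<close>)
  \<comment> \<open>The sum counts integers \<open>k\<close> with \<open>k < N * f x\<close>;
    counting from 0 costs the extra 1.\<close>
  have ind: "(\<Sum>k<n. indicat_real (U k) x) \<le> N * f x + 1" for n x
  proof -
    have "(\<Sum>k<n. indicat_real (U k) x) = card {k. k < n \<and> x \<in> U k}"
      by (simp add: indicator_def sum.If_cases Int_def lessThan_def)
    also have "\<dots> \<le> card {..nat \<lfloor>N * f x\<rfloor>}"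
    proof -
      have "k \<le> nat \<lfloor>N * f x\<rfloor>" if "x \<in> U k" for k
        using that N(1) by (simp add: U_def field_simps) linarith
      then show ?thesis by (intro of_nat_mono card_mono) auto
    qed
    also have "\<dots> \<le> N * f x + 1" using f01[of x] by simp
    finally show ?thesis .
  qed
  have "I f = I (\<lambda>x. (1/N) * (\<Sum>k<N. h k x))"
  proof (rule arg_cong[of _ _ I], rule ext)
    fix x
    have "N * f x \<le> N" using f01[of x] by (simp add: mult_left_le)
    then show "f x = (1/N) * (\<Sum>k<N. h k x)" using N by (simp add: layers)
  qed
  also have "\<dots> = (1/N) * (\<Sum>k<N. I (h k))"
    by (subst scale) (auto intro!: continuous_intros hc sum)
  also have "\<dots> \<le> (1/N) * (\<Sum>k<N. measure repr_measure (U k))"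
  proof (intro mult_left_mono sum_mono)
    fix k
    have "ennreal (I (h k)) \<le> emeasure repr_measure (U k)"
      using content_upper[OF hb[of k]] Uo[of k] by (simp add: emeasure_repr_measure outer_open)
    then show "I (h k) \<le> measure repr_measure (U k)"
      by (simp add: emeasure_eq_measure ennreal_le_iff)
  qed simp
  also have "\<dots> = (\<integral>x. (1/N) * (\<Sum>k<N. indicat_real (U k) x) \<partial>repr_measure)"
    using Uo by (simp add: Bochner_Integration.integral_sum emeasure_eq_measure)
  also have "\<dots> \<le> (\<integral>x. f x + 1/N \<partial>repr_measure)"
  proof (rule integral_mono)
    show "integrable repr_measure (\<lambda>x. f x + 1/N)" by (rule integrable_repr_measure) (intro continuous_intros f)
    show "(1/N) * (\<Sum>k<N. indicat_real (U k) x) \<le> f x + 1/N" for x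
      using ind[of x N] N by (simp add: field_simps)
  qed (use Uo in \<open>auto simp: emeasure_eq_measure\<close>)
  also have "\<dots> = integral\<^sup>L repr_measure f + I (\<lambda>_. 1) / N"
    using integrable_repr_measure[OF f] measure_repr_UNIV by simp
  finally show "I f \<le> integral\<^sup>L repr_measure f + e" using N by linarith
qed

text \<open>An affine change moves \<open>f\<close> into the unit interval. Constants are integrated
  exactly, because the measure has total mass \<open>I (\<lambda>_. 1)\<close>, so the inequality
  survives the change.\<close>

lemma le_integral:
  assumes f: "continuous_on UNIV f"
  shows "I f \<le> integral\<^sup>L repr_measure f"
proof -
  interpret finite_measure repr_measure by (rule finite_repr_measure)
  have "bounded (range f)" using compact_continuous_image[OF f compact] by (rule compact_imp_bounded)
  then obtain B where B: "0 < B" "\<And>x. \<bar>f x\<bar> \<le> B" by (auto simp: bounded_pos)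
  define g where "g x = 1/2 + (1/(2*B)) * f x" for x
  have gc: "continuous_on UNIV g" unfolding g_def by (intro continuous_intros f)
  have "0 \<le> g x \<and> g x \<le> 1" for x using B(1) B(2)[of x] by (auto simp: g_def field_simps)
  then have "I g \<le> integral\<^sup>L repr_measure g" by (intro le_integral_unit gc) auto
  moreover have "I g = (1/2) * I (\<lambda>_. 1) + (1/(2*B)) * I f"
  proof -
    have "I g = I (\<lambda>_. 1/2) + I (\<lambda>x. (1/(2*B)) * f x)"
      unfolding g_def by (rule add) (intro continuous_intros f)+
    then show ?thesis using scale[OF f, of "1/(2*B)"] scale[of "\<lambda>_. 1" "1/2"] by simp
  qed
  moreover have "integral\<^sup>L repr_measure g = (1/2) * I (\<lambda>_. 1) + (1/(2*B)) * integral\<^sup>L repr_measure f"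
    unfolding g_def using integrable_repr_measure[OF f] measure_repr_UNIV by simp
  ultimately show ?thesis using B(1) by (simp add: field_simps)
qed

text \<open>The one-sided bound, applied to \<open>f\<close> and to its negative, becomes an
  equality.\<close>

theorem integral_repr_measure:
  assumes f: "continuous_on UNIV f"
  shows "integral\<^sup>L repr_measure f = I f"
  using le_integral[OF f] le_integral[of "\<lambda>x. (-1) * f x"] scale[OF f, of "-1"] f
  by (simp add: continuous_intros)

end

text \<open>Open sets are stable under intersection and generate the Borel sets, and the indicator
  of an open set is a pointwise limit of capped multiples of \<open>open_dist\<close>. This later
  turns invariance of integrals into invariance of a measure.\<close>

lemma measure_eq_if_integrals_eq:
  fixes M N :: "'x::metric_space measure"
  assumes "finite_measure M" "finite_measure N" "sets M = sets borel" "sets N = sets borel"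
    and eq: "\<And>f. continuous_on UNIV f \<Longrightarrow> bounded (range f) \<Longrightarrow> integral\<^sup>L M f = (integral\<^sup>L N f :: real)"
  shows "M = N"
proof (rule measure_eqI_generator_eq[where E = "{S. open S}" and \<Omega> = UNIV and A = "\<lambda>_. UNIV"])
  interpret M: finite_measure M by fact
  interpret N: finite_measure N by fact
  note [measurable_cong] = assms(3,4)
  have [simp]: "space M = UNIV" "space N = UNIV"
    using sets_eq_imp_space_eq[OF assms(3)] sets_eq_imp_space_eq[OF assms(4)] by auto
  fix U :: "'x set" assume "U \<in> {S. open S}"
  then have U: "open U" by simp
  define h where "h n x = min 1 (real n * open_dist U x)" for n x
  have hc: "continuous_on UNIV (h n)" for n unfolding h_def by (intro continuous_intros)
  have hb: "norm (h n x) \<le> 1" for n x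
    using mult_nonneg_nonneg[of "real n" "open_dist U x"] by (simp add: h_def min_def)
  have lim: "(\<lambda>n. h n x) \<longlonglongrightarrow> indicat_real U x" for x
  proof (cases "x \<in> U")
    case False then show ?thesis using U by (simp add: h_def open_dist_eq_0)
  next
    case True
    then have p: "0 < open_dist U x" using U open_dist_pos_iff by blast
    obtain n0 where n0: "1 / open_dist U x < real n0" using reals_Archimedean2 by blast
    have "h n x = 1" if "n0 \<le> n" for n
    proof -
      have "1 / open_dist U x \<le> real n" using n0 that by linarith
      then show ?thesis using p by (simp add: h_def field_simps)
    qed
    then have "eventually (\<lambda>n. h n x = indicat_real U x) sequentially"
      using True by (auto simp: eventually_sequentially)
    then show ?thesis by (rule tendsto_eventually)
  qed
  have [measurable]: "U \<in> sets borel" using U by simp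
  have hm: "h n \<in> borel_measurable borel" for n using hc by (rule borel_measurable_continuous_onI)
  have "(\<lambda>n. integral\<^sup>L K (h n)) \<longlonglongrightarrow> measure K U"
    if "finite_measure K" and s: "sets K = sets borel" for K
  proof -
    interpret finite_measure K by fact
    note [measurable_cong] = s
    have [measurable]: "h n \<in> borel_measurable K" for n
      using hm measurable_cong_sets[OF s refl] by blast
    have [simp]: "space K = UNIV" using sets_eq_imp_space_eq[OF s] by simp
    have "(\<lambda>n. integral\<^sup>L K (h n)) \<longlonglongrightarrow> integral\<^sup>L K (indicat_real U)"
      by (rule integral_dominated_convergence[where w = "\<lambda>_. 1"]) (use lim hb in auto)
    then show ?thesis by simp
  qed
  note lim1 = this[OF assms(1,3)] and lim2 = this[OF assms(2,4)]
  have "measure M U = measure N U"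
  proof (rule LIMSEQ_unique)
    have "integral\<^sup>L M (h n) = integral\<^sup>L N (h n)" for n
      by (rule eq[OF hc]) (use hb in \<open>auto simp: bounded_iff\<close>)
    then show "(\<lambda>n. integral\<^sup>L N (h n)) \<longlonglongrightarrow> measure M U"
      using lim1 by simp
  qed (rule lim2)
  then show "emeasure M U = emeasure N U" by (simp add: M.emeasure_eq_measure N.emeasure_eq_measure)
next
  interpret M: finite_measure M by fact
  show "emeasure M UNIV \<noteq> \<infinity>" by simp
qed (auto simp: assms(3,4) borel_def Int_stable_def)

section \<open>The Ornstein--Weiss lemma\<close>

lemma sum_card_swap:
  assumes "finite A" "finite B"
  shows "(\<Sum>a\<in>A. card {b\<in>B. R a b}) = (\<Sum>b\<in>B. card {a\<in>A. R a b})"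
proof -
  have 1: "card {b\<in>B. Q b} = (\<Sum>b\<in>B. if Q b then 1 else 0)" if "finite B" for Q and B :: "'z set"
    using that by (simp add: sum.If_cases Int_def)
  have "(\<Sum>a\<in>A. card {b\<in>B. R a b}) = (\<Sum>a\<in>A. \<Sum>b\<in>B. if R a b then 1 else 0)"
    using 1[OF assms(2)] by simp
  also have "\<dots> = (\<Sum>b\<in>B. \<Sum>a\<in>A. if R a b then 1 else 0)" by (rule sum.swap)
  also have "\<dots> = (\<Sum>b\<in>B. card {a\<in>A. R a b})" using 1[OF assms(1)] by simp
  finally show ?thesis .
qed

text \<open>Tiles are right translates, while the Folner condition concerns left multiplication:
  \<open>l \<otimes> (k \<otimes> p) = (l \<otimes> k) \<otimes> p\<close> lets the almost
  invariance of \<open>K\<close> pass to its translates. For covers, a right translate of the index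
  set corresponds to a preimage under \<open>act p\<close>.\<close>

definition (in monoid) rtrans :: "'a set \<Rightarrow> 'a \<Rightarrow> 'a set" where
  "rtrans K p = (\<lambda>k. k \<otimes> p) ` K"

text \<open>The inner boundary of \<open>A\<close> with respect to \<open>K\<close>: a centre in
  \<open>A\<close> outside it has its whole translate of \<open>K\<close> inside
  \<open>A\<close>.\<close>

definition (in monoid) defect :: "'a set \<Rightarrow> 'a set \<Rightarrow> 'a set" where
  "defect K A = {x \<in> A. \<exists>k\<in>K. k \<otimes> x \<notin> A}"

definition (in monoid) almost_inv :: "'a set \<Rightarrow> real \<Rightarrow> 'a set \<Rightarrow> bool" where
  "almost_inv K \<delta> A \<longleftrightarrow> real (card (defect K A)) \<le> \<delta> * real (card A)"

section \<open>Almost disjoint translates and their defects\<close>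

context monoid_cancel
begin

lemma inj_on_rmult: "p \<in> carrier G \<Longrightarrow> K \<subseteq> carrier G \<Longrightarrow> inj_on (\<lambda>k. k \<otimes> p) K"
  by (auto intro!: inj_onI dest: r_cancel)

lemma inj_on_lmult: "p \<in> carrier G \<Longrightarrow> K \<subseteq> carrier G \<Longrightarrow> inj_on (\<lambda>k. p \<otimes> k) K"
  by (auto intro!: inj_onI dest: l_cancel)

lemma card_rtrans: "p \<in> carrier G \<Longrightarrow> K \<subseteq> carrier G \<Longrightarrow> card (rtrans K p) = card K"
  by (simp add: rtrans_def card_image inj_on_rmult)

text \<open>Double counting of the pairs with \<open>k \<otimes> p \<in> A\<close>: right
  cancellation identifies the pairs over \<open>p\<close> with the points of the overlap, and left
  cancellation allows at most \<open>card A\<close> pairs over each \<open>k\<close>.\<close>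

lemma sum_card_rtrans_Int_le:
  assumes K: "finite K" "K \<subseteq> carrier G" and C: "finite C" "C \<subseteq> carrier G" and A: "finite A"
  shows "(\<Sum>p\<in>C. card (rtrans K p \<inter> A)) \<le> card K * card A"
proof -
  have "card (rtrans K p \<inter> A) = card {k\<in>K. k \<otimes> p \<in> A}" if "p \<in> C" for p
  proof -
    have "rtrans K p \<inter> A = (\<lambda>k. k \<otimes> p) ` {k\<in>K. k \<otimes> p \<in> A}" by (auto simp: rtrans_def)
    moreover have "inj_on (\<lambda>k. k \<otimes> p) {k\<in>K. k \<otimes> p \<in> A}"
      by (rule inj_on_rmult) (use that C K in auto)
    ultimately show ?thesis by (simp add: card_image)
  qed
  then have "(\<Sum>p\<in>C. card (rtrans K p \<inter> A)) = (\<Sum>p\<in>C. card {k\<in>K. k \<otimes> p \<in> A})" by simp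
  also have "\<dots> = (\<Sum>k\<in>K. card {p\<in>C. k \<otimes> p \<in> A})" by (rule sum_card_swap[OF C(1) K(1)])
  also have "\<dots> \<le> (\<Sum>k\<in>K. card A)"
  proof (rule sum_mono)
    fix k assume "k \<in> K"
    then have "inj_on (\<lambda>p. k \<otimes> p) {p\<in>C. k \<otimes> p \<in> A}"
      using C K by (intro inj_on_lmult) auto
    then show "card {p\<in>C. k \<otimes> p \<in> A} \<le> card A"
      by (rule card_inj_on_le) (use A in auto)
  qed
  finally show ?thesis by simp
qed

text \<open>Take a maximal family whose union has nearly the size of the disjoint case. By
  maximality the translate at any remaining centre meets the union in at least the proportion
  \<epsilon>. Summing the overlaps over all of \<open>C\<close> and comparing with the double count
  makes the union at least \<epsilon> times as large as \<open>C\<close>.\<close>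

lemma ex_almost_disjoint_translates:
  assumes K: "finite K" "K \<noteq> {}" "K \<subseteq> carrier G" and C: "finite C" "C \<subseteq> carrier G"
    and e: "0 < \<epsilon>" "\<epsilon> < (1::real)"
  obtains P where "P \<subseteq> C"
    "(1 - \<epsilon>) * real (card K) * real (card P) \<le> real (card (\<Union>p\<in>P. rtrans K p))"
    "\<epsilon> * real (card C) \<le> real (card (\<Union>p\<in>P. rtrans K p))"
proof -
  let ?U = "\<lambda>P. \<Union>p\<in>P. rtrans K p"
  define S where "S = {P. P \<subseteq> C \<and> (1 - \<epsilon>) * real (card K) * real (card P) \<le> real (card (?U P))}"
  have fin: "finite (rtrans K p)" for p using K by (simp add: rtrans_def)
  have "S \<subseteq> Pow C" by (auto simp: S_def)
  then have "finite S" using C(1) finite_subset by blast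
  moreover have "{} \<in> S" by (simp add: S_def)
  ultimately obtain P where P: "P \<in> S" and max: "\<And>Q. Q \<in> S \<Longrightarrow> P \<subseteq> Q \<Longrightarrow> P = Q"
    using finite_has_maximal[of S] by blast
  then have PC: "P \<subseteq> C" and Pe: "(1 - \<epsilon>) * real (card K) * real (card P) \<le> real (card (?U P))" by (auto simp: S_def)
  have finP: "finite P" using PC C finite_subset by blast
  have finU: "finite (?U P)" using finP fin by auto
  have overlap: "\<epsilon> * real (card K) \<le> real (card (rtrans K p \<inter> ?U P))" if p: "p \<in> C" for p
  proof (cases "p \<in> P")
    case True
    then have "rtrans K p \<inter> ?U P = rtrans K p" by auto
    moreover have "card (rtrans K p) = card K" using card_rtrans p C(2) K(3) by blast
    ultimately show ?thesis using e by (simp add: mult_left_le_one_le)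
  next
    case False
    then have "insert p P \<notin> S" using max[of "insert p P"] by auto
    then have "real (card (?U (insert p P))) < (1 - \<epsilon>) * real (card K) * (real (card P) + 1)"
      using p PC False finP by (simp add: S_def add.commute)
    moreover have "real (card (?U (insert p P))) + real (card (rtrans K p \<inter> ?U P)) = real (card K) + real (card (?U P))"
      using card_Un_Int[OF fin[of p] finU] card_rtrans[of p K] p C K by (auto simp flip: of_nat_add)
    ultimately show ?thesis using Pe by (simp add: algebra_simps)
  qed
  have "real (card C) * (\<epsilon> * real (card K)) = (\<Sum>p\<in>C. \<epsilon> * real (card K))" by simp
  also have "\<dots> \<le> (\<Sum>p\<in>C. real (card (rtrans K p \<inter> ?U P)))" by (rule sum_mono) (rule overlap)
  also have "\<dots> \<le> real (card K) * real (card (?U P))"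
    using sum_card_rtrans_Int_le[OF K(1,3) C finU] by (simp flip: of_nat_sum of_nat_mult)
  finally have "real (card K) * (\<epsilon> * real (card C)) \<le> real (card K) * real (card (?U P))"
    by (simp add: mult_ac)
  moreover have "0 < real (card K)" using K by (simp add: card_gt_0_iff)
  ultimately have "\<epsilon> * real (card C) \<le> real (card (?U P))" by (simp only: mult_le_cancel_left_pos)
  then show ?thesis using that PC Pe by blast
qed

text \<open>New defects are points outside a translate of \<open>K\<close> that some
  \<open>l\<close> moves into it. They are counted by injectivity: \<open>l\<close> also moves the
  translate of \<open>K - defect L K\<close> into the same translate of \<open>K\<close>, so only
  \<open>card (defect L K)\<close> places remain for them.\<close>

lemma card_defect_Diff_translates:
  assumes L: "finite L" "L \<subseteq> carrier G" and K: "finite K" "K \<subseteq> carrier G"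
    and P: "finite P" "P \<subseteq> carrier G" and A: "finite A" "A \<subseteq> carrier G"
  shows "card (defect L (A - (\<Union>p\<in>P. rtrans K p))) \<le> card (defect L A) + card P * card L * card (defect L K)"
proof -
  define S where "S p l = {x\<in>A. x \<notin> rtrans K p \<and> l \<otimes> x \<in> rtrans K p}" for p l
  have fin: "finite (S p l)" for p l using A by (simp add: S_def)
  have sub: "defect L (A - (\<Union>p\<in>P. rtrans K p)) \<subseteq> defect L A \<union> (\<Union>p\<in>P. \<Union>l\<in>L. S p l)"
    by (auto simp: defect_def S_def)
  have S: "card (S p l) \<le> card (defect L K)" if p: "p \<in> P" and l: "l \<in> L" for p l
  proof -
    have pl: "p \<in> carrier G" "l \<in> carrier G" using p l P L by auto
    define T where "T = rtrans (K - defect L K) p"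
    have T1: "l \<otimes> x \<in> rtrans K p" if "x \<in> T" for x
    proof -
      obtain k where k: "k \<in> K" "k \<notin> defect L K" "x = k \<otimes> p" using \<open>x \<in> T\<close> by (auto simp: T_def rtrans_def)
      then have "l \<otimes> k \<in> K" using l by (auto simp: defect_def)
      moreover have "l \<otimes> x = (l \<otimes> k) \<otimes> p" using k K pl by (auto simp: m_assoc)
      ultimately show ?thesis by (auto simp: rtrans_def)
    qed
    have T2: "T \<subseteq> carrier G" using pl K by (auto simp: T_def rtrans_def)
    have finT: "finite T" using K by (simp add: T_def rtrans_def)
    have disj: "S p l \<inter> T = {}" by (auto simp: S_def T_def rtrans_def)
    have "inj_on (\<lambda>x. l \<otimes> x) (S p l \<union> T)"
      by (rule inj_on_lmult) (use pl T2 A in \<open>auto simp: S_def\<close>)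
    moreover have "(\<lambda>x. l \<otimes> x) ` (S p l \<union> T) \<subseteq> rtrans K p" using T1 by (auto simp: S_def)
    moreover have "finite (rtrans K p)" using K by (simp add: rtrans_def)
    ultimately have "card (S p l \<union> T) \<le> card (rtrans K p)" by (rule card_inj_on_le)
    then have "card (S p l) + card T \<le> card K"
      using card_Un_disjoint[OF fin finT disj] card_rtrans[of p K] pl K by simp
    moreover have "card T = card K - card (defect L K)"
    proof -
      have "card T = card (K - defect L K)" unfolding T_def by (rule card_rtrans) (use pl K in auto)
      also have "\<dots> = card K - card (defect L K)"
        by (rule card_Diff_subset) (use K in \<open>auto simp: defect_def intro: finite_subset\<close>)
      finally show ?thesis .
    qed
    ultimately show ?thesis by linarith
  qed
  have "card (defect L (A - (\<Union>p\<in>P. rtrans K p))) \<le> card (defect L A \<union> (\<Union>p\<in>P. \<Union>l\<in>L. S p l))"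
    by (rule card_mono[OF _ sub]) (use P L A fin in \<open>auto simp: defect_def\<close>)
  also have "\<dots> \<le> card (defect L A) + card (\<Union>p\<in>P. \<Union>l\<in>L. S p l)" by (rule card_Un_le)
  also have "card (\<Union>p\<in>P. \<Union>l\<in>L. S p l) \<le> (\<Sum>p\<in>P. \<Sum>l\<in>L. card (S p l))"
    by (rule order_trans[OF card_UN_le[OF P(1)]], rule sum_mono, rule card_UN_le[OF L(1)])
  also have "\<dots> \<le> (\<Sum>p\<in>P. \<Sum>l\<in>L. card (defect L K))" by (intro sum_mono S)
  finally show ?thesis by simp
qed

text \<open>Multiplication by \<open>g\<close> carries the points of \<open>F n\<close> that it
  moves out of \<open>F n\<close> injectively into the symmetric difference. Finitely many such
  \<open>g\<close> are summed.\<close>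

lemma folner_eventually_almost_inv:
  assumes F: "folner_seq G F" and L: "finite L" "L \<subseteq> carrier G" and d: "0 < \<delta>"
  shows "eventually (\<lambda>n. almost_inv L \<delta> (F n)) sequentially"
proof -
  have Fn: "finite (F n)" "F n \<noteq> {}" "F n \<subseteq> carrier G" for n using F by (auto simp: folner_seq_def)
  let ?s = "\<lambda>g n. real (card (sym_diff (g <# F n) (F n)))"
  have "(\<lambda>n. \<Sum>g\<in>L. ?s g n / real (card (F n))) \<longlonglongrightarrow> (\<Sum>g\<in>L. 0)"
    by (rule tendsto_sum) (use F L in \<open>auto simp: folner_seq_def\<close>)
  then have "eventually (\<lambda>n. (\<Sum>g\<in>L. ?s g n / real (card (F n))) < \<delta>) sequentially"
    using d by (intro order_tendstoD) auto
  then show ?thesis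
  proof (eventually_elim)
    case (elim n)
    have pos: "0 < real (card (F n))" using Fn[of n] by (simp add: card_gt_0_iff)
    have c: "card {x\<in>F n. g \<otimes> x \<notin> F n} \<le> card (sym_diff (g <# F n) (F n))" if "g \<in> L" for g
    proof (rule card_inj_on_le)
      show "inj_on (\<lambda>x. g \<otimes> x) {x\<in>F n. g \<otimes> x \<notin> F n}"
        by (rule inj_on_lmult) (use that L Fn[of n] in auto)
    qed (use Fn in \<open>auto simp: l_coset_def\<close>)
    have "card (defect L (F n)) \<le> card (\<Union>g\<in>L. {x\<in>F n. g \<otimes> x \<notin> F n})"
      by (rule card_mono) (use Fn L in \<open>auto simp: defect_def\<close>)
    also have "\<dots> \<le> (\<Sum>g\<in>L. card (sym_diff (g <# F n) (F n)))"
      by (rule order_trans[OF card_UN_le[OF L(1)]]) (rule sum_mono, rule c)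
    finally have "real (card (defect L (F n))) \<le> (\<Sum>g\<in>L. ?s g n)" by (simp flip: of_nat_sum)
    also have "\<dots> = (\<Sum>g\<in>L. ?s g n / real (card (F n))) * real (card (F n))"
      using pos by (simp add: sum_divide_distrib[symmetric])
    also have "\<dots> \<le> \<delta> * real (card (F n))" using elim by (intro mult_right_mono) auto
    finally show ?case by (simp add: almost_inv_def)
  qed
qed

end

text \<open>Translation by \<open>p\<close> need not be invertible, so \<open>h_rtrans\<close> is an
  inequality. It points the useful way: a small value on one tile bounds the values on all its
  translates. The constant \<open>M\<close> yields the crude linear bound from which the iteration
  starts.\<close>

locale subadditive_set_function = monoid_cancel G for G (structure) +
  fixes h :: "'a set \<Rightarrow> real" and M :: real
  assumes h_nonneg: "\<lbrakk>finite A; A \<subseteq> carrier G\<rbrakk> \<Longrightarrow> 0 \<le> h A"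
    and h_empty: "h {} = 0"
    and h_Un: "\<lbrakk>finite A; A \<subseteq> carrier G; finite B; B \<subseteq> carrier G\<rbrakk> \<Longrightarrow> h (A \<union> B) \<le> h A + h B"
    and h_rtrans: "\<lbrakk>finite A; A \<subseteq> carrier G; p \<in> carrier G\<rbrakk> \<Longrightarrow> h (rtrans A p) \<le> h A"
    and h_single: "g \<in> carrier G \<Longrightarrow> h {g} \<le> M"
    and M_pos: "0 < M"
begin

lemma h_UN:
  assumes "finite P" "\<And>p. p \<in> P \<Longrightarrow> finite (B p) \<and> B p \<subseteq> carrier G"
  shows "h (\<Union>p\<in>P. B p) \<le> (\<Sum>p\<in>P. h (B p))"
  using assms
proof (induction P rule: finite_induct)
  case empty then show ?case by (simp add: h_empty)
next
  case (insert p P)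
  have "h (B p \<union> (\<Union>p\<in>P. B p)) \<le> h (B p) + h (\<Union>p\<in>P. B p)" using insert by (intro h_Un) auto
  then show ?case using insert by auto
qed

lemma h_le_card:
  assumes "finite A" "A \<subseteq> carrier G"
  shows "h A \<le> M * card A"
proof -
  have "h (\<Union>g\<in>A. {g}) \<le> (\<Sum>g\<in>A. h {g})" using assms by (intro h_UN) auto
  also have "\<dots> \<le> (\<Sum>g\<in>A. M)" using assms by (intro sum_mono h_single) auto
  finally show ?thesis by (simp add: mult.commute)
qed

text \<open>Expresses that the upper limit of \<open>h A / card A\<close> is at most
  \<open>t\<close>, uniformly over all sufficiently invariant sets. This uniformity lets a bound
  found along one Folner sequence pass to another.\<close>

definition eventual_bound :: "real \<Rightarrow> bool" where
  "eventual_bound t \<longleftrightarrow> (\<exists>L \<delta>. finite L \<and> L \<subseteq> carrier G \<and> 0 < \<delta> \<and>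
     (\<forall>A. finite A \<longrightarrow> A \<subseteq> carrier G \<longrightarrow> almost_inv L \<delta> A \<longrightarrow> h A \<le> t * card A))"

text \<open>Almost disjoint translates of one nearly invariant set with small mean cover a proportion of
  at least \<open>\<epsilon> / 2\<close> of any sufficiently invariant set. What they leave uncovered is again nearly
  invariant, so the bound applies to it, unless it is negligible.\<close>

lemma eventual_bound_improve:
  fixes \<theta> \<epsilon> t :: real
  assumes lam: "0 \<le> \<theta>"
    and approx: "\<And>L \<delta>. finite L \<Longrightarrow> L \<subseteq> carrier G \<Longrightarrow> 0 < \<delta> \<Longrightarrow>
      \<exists>K. finite K \<and> K \<noteq> {} \<and> K \<subseteq> carrier G \<and> almost_inv L \<delta> K \<and> h K \<le> \<theta> * card K"
    and e: "0 < \<epsilon>" "\<epsilon> < 1" and t: "0 < t" and bound: "eventual_bound (\<theta> / (1 - \<epsilon>) + t)"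
  shows "eventual_bound (\<theta> / (1 - \<epsilon>) + (1 - \<epsilon> / 2) * t)"
proof -
  define c where "c = 1 - \<epsilon> / 2"
  define \<mu> where "\<mu> = \<theta> / (1 - \<epsilon>)"
  have mu: "0 \<le> \<mu>" using lam e by (simp add: \<mu>_def)
  have c: "0 < c" "c < 1" using e by (auto simp: c_def)
  \<comment> \<open>Below the proportion \<open>r\<close> the remainder is negligible: at the crude
    rate \<open>M\<close> it contributes at most \<open>c * t * card A\<close>.\<close>
  define r where "r = c * t / M"
  have r: "0 < r" "M * r = c * t" using c t M_pos by (auto simp: r_def)
  obtain L \<delta> where L: "finite L" "L \<subseteq> carrier G" and d: "0 < \<delta>"
    and b: "\<And>A. finite A \<Longrightarrow> A \<subseteq> carrier G \<Longrightarrow> almost_inv L \<delta> A \<Longrightarrow> h A \<le> (\<mu> + t) * card A"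
    using bound unfolding eventual_bound_def \<mu>_def by blast
  \<comment> \<open>There are at most \<open>card A / ((1 - \<epsilon>) * card K)\<close>
    translates, each adding at most \<open>card L * card (defect L K)\<close> defects. With this
    \<beta> they use at most half of the defects \<open>\<delta> * r * card A\<close> that a
    remainder of proportion \<open>r\<close> tolerates. The added 1 keeps the denominator
    positive.\<close>
  define \<beta> where "\<beta> = \<delta> * r / 2 * (1 - \<epsilon>) / (real (card L) + 1)"
  have beta: "0 < \<beta>" "real (card L) * \<beta> / (1 - \<epsilon>) \<le> \<delta> * r / 2"
  proof -
    show "0 < \<beta>" using d r e by (simp add: \<beta>_def)
    have "real (card L) * \<beta> / (1 - \<epsilon>) = \<delta> * r / 2 * (real (card L) / (real (card L) + 1))"
      using e by (simp add: \<beta>_def)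
    also have "\<dots> \<le> \<delta> * r / 2 * 1" using d r by (intro mult_left_mono) auto
    finally show "real (card L) * \<beta> / (1 - \<epsilon>) \<le> \<delta> * r / 2" by simp
  qed
  obtain K where K: "finite K" "K \<noteq> {}" "K \<subseteq> carrier G" "almost_inv L \<beta> K" "h K \<le> \<theta> * card K"
    using approx[OF L beta(1)] by blast
  \<comment> \<open>The bound 1/2 leaves at least half of \<open>A\<close> as admissible centres.
    The other bound keeps the defects of \<open>A\<close> itself within the second half of what the
    remainder tolerates.\<close>
  define \<delta>' where "\<delta>' = min (1/2) (\<delta> * r / 2)"
  have "h A \<le> (\<mu> + c * t) * card A" if A: "finite A" "A \<subseteq> carrier G" "almost_inv (L \<union> K) \<delta>' A" for A
  proof -
    define D where "D = A - defect K A"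
    have defs: "card (defect L A) \<le> card (defect (L \<union> K) A)" "card (defect K A) \<le> card (defect (L \<union> K) A)"
      using A by (auto simp: defect_def intro!: card_mono)
    have inv: "real (card (defect (L \<union> K) A)) \<le> \<delta>' * card A" using A by (simp add: almost_inv_def)
    have "\<delta>' * card A \<le> 1/2 * card A" "\<delta>' * card A \<le> \<delta> * r / 2 * card A"
      by (intro mult_right_mono; simp add: \<delta>'_def)+
    then have dK: "real (card (defect K A)) \<le> 1/2 * card A" and dL: "real (card (defect L A)) \<le> \<delta> * r / 2 * card A"
      using defs inv by linarith+
    have "card D = card A - card (defect K A)"
      unfolding D_def by (rule card_Diff_subset) (use A in \<open>auto simp: defect_def\<close>)
    then have cD: "1/2 * card A \<le> real (card D)" using dK by linarith
    have D: "finite D" "D \<subseteq> carrier G" using A by (auto simp: D_def)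
    obtain P where P: "P \<subseteq> D"
      "(1 - \<epsilon>) * real (card K) * real (card P) \<le> real (card (\<Union>p\<in>P. rtrans K p))"
      "\<epsilon> * real (card D) \<le> real (card (\<Union>p\<in>P. rtrans K p))"
      using ex_almost_disjoint_translates[OF K(1-3) D e] .
    define U where "U = (\<Union>p\<in>P. rtrans K p)"
    have UA: "U \<subseteq> A"
    proof
      fix x assume "x \<in> U"
      then obtain p k where "p \<in> P" "k \<in> K" "x = k \<otimes> p" by (auto simp: U_def rtrans_def)
      then show "x \<in> A" using P(1) by (auto simp: D_def defect_def)
    qed
    have finP: "finite P" using P(1) D finite_subset by blast
    have Pc: "P \<subseteq> carrier G" using P(1) D by auto
    have finU: "finite U" using UA A finite_subset by blast
    have KP: "real (card K) * real (card P) \<le> real (card U) / (1 - \<epsilon>)"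
      using P(2) e by (simp add: U_def field_simps)
    have "h U \<le> (\<Sum>p\<in>P. h (rtrans K p))"
      unfolding U_def by (rule h_UN[OF finP]) (use K Pc in \<open>auto simp: rtrans_def\<close>)
    also have "\<dots> \<le> (\<Sum>p\<in>P. h K)" using K Pc by (intro sum_mono h_rtrans) auto
    also have "\<dots> \<le> real (card P) * (\<theta> * card K)" using K by (simp add: mult_left_mono)
    also have "\<dots> = \<theta> * (real (card K) * real (card P))" by simp
    also have "\<dots> \<le> \<theta> * (real (card U) / (1 - \<epsilon>))" by (rule mult_left_mono[OF KP lam])
    finally have hU: "h U \<le> \<mu> * card U" by (simp add: \<mu>_def)
    define R where "R = A - U"
    have R: "finite R" "R \<subseteq> carrier G" using A by (auto simp: R_def)
    have "card R = card A - card U" unfolding R_def by (rule card_Diff_subset[OF finU UA])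
    then have cR: "real (card R) = real (card A) - real (card U)"
      using card_mono[OF A(1) UA] by simp
    have "\<epsilon> * (1/2 * card A) \<le> \<epsilon> * real (card D)" using cD e by (intro mult_left_mono) auto
    then have "\<epsilon> / 2 * card A \<le> real (card U)" using P(3) by (simp add: U_def)
    then have cR2: "real (card R) \<le> c * card A" using cR by (simp add: c_def algebra_simps)
    have "h (U \<union> R) \<le> h U + h R" by (rule h_Un) (use finU UA A R in auto)
    moreover have "U \<union> R = A" using UA by (auto simp: R_def)
    ultimately have hA: "h A \<le> \<mu> * card U + h R" using hU by simp
    show ?thesis
    proof (cases "real (card R) < r * card A")
      case True
      have "h R \<le> M * card R" by (rule h_le_card[OF R])
      also have "\<dots> \<le> M * (r * card A)" using True M_pos by (intro mult_left_mono) auto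
      finally have "h R \<le> c * t * card A" using r by (simp add: mult.assoc[symmetric])
      moreover have "\<mu> * card U \<le> \<mu> * card A" using mu card_mono[OF A(1) UA] by (intro mult_left_mono) auto
      ultimately show ?thesis using hA by (simp add: algebra_simps)
    next
      case False
      have "real (card (defect L R)) \<le> real (card (defect L A) + card P * card L * card (defect L K))"
        unfolding R_def U_def
        by (intro of_nat_mono card_defect_Diff_translates L K finP Pc A)
      also have "\<dots> = real (card (defect L A)) + real (card P) * real (card L) * real (card (defect L K))" by simp
      also have "\<dots> \<le> \<delta> * r / 2 * card A + real (card P) * real (card L) * (\<beta> * card K)"
        using K(4) by (intro add_mono dL mult_left_mono) (auto simp: almost_inv_def)
      also have "real (card P) * real (card L) * (\<beta> * card K) = real (card L) * \<beta> * (real (card K) * real (card P))"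
        by simp
      also have "\<dots> \<le> real (card L) * \<beta> * (real (card U) / (1 - \<epsilon>))"
        using beta by (intro mult_left_mono KP) auto
      also have "\<dots> = real (card L) * \<beta> / (1 - \<epsilon>) * real (card U)" by simp
      also have "\<dots> \<le> \<delta> * r / 2 * card A"
        using card_mono[OF A(1) UA] beta d r by (intro mult_mono) auto
      finally have "real (card (defect L R)) \<le> \<delta> * (r * card A)" by simp
      also have "\<dots> \<le> \<delta> * card R" using False d by (intro mult_left_mono) auto
      finally have "h R \<le> (\<mu> + t) * card R" by (intro b R) (simp add: almost_inv_def)
      also have "\<dots> = \<mu> * card R + t * card R" by (simp add: algebra_simps)
      also have "\<dots> \<le> \<mu> * card R + t * (c * card A)" using cR2 t by simp
      finally show ?thesis using hA cR by (simp add: algebra_simps)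
    qed
  qed
  moreover have "0 < \<delta>'" using d r by (simp add: \<delta>'_def)
  ultimately show ?thesis
    unfolding eventual_bound_def c_def[symmetric] \<mu>_def[symmetric] using L K by (intro exI[of _ "L \<union> K"] exI[of _ \<delta>']) auto
qed

text \<open>Each improvement multiplies the excess over \<open>\<theta> / (1 - \<epsilon>)\<close>
  by \<open>1 - \<epsilon> / 2\<close>. The excess starts at \<open>M\<close>, which is valid for
  every finite set, and drops below any positive gap.\<close>

lemma eventual_bound:
  fixes \<theta> \<kappa> :: real
  assumes lam: "0 \<le> \<theta>"
    and approx: "\<And>L \<delta>. finite L \<Longrightarrow> L \<subseteq> carrier G \<Longrightarrow> 0 < \<delta> \<Longrightarrow>
      \<exists>K. finite K \<and> K \<noteq> {} \<and> K \<subseteq> carrier G \<and> almost_inv L \<delta> K \<and> h K \<le> \<theta> * card K"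
    and less: "\<theta> < \<kappa>"
  shows "eventual_bound \<kappa>"
proof -
  define m where "m = (\<theta> + \<kappa>) / 2"
  have m: "\<theta> < m" "m < \<kappa>" "0 < m" using less lam by (auto simp: m_def)
  \<comment> \<open>For positive \<theta> this makes \<open>\<theta> / (1 - \<epsilon>)\<close>
    equal to \<open>m\<close>, half way to \<kappa>; for \<open>\<theta> = 0\<close> that quotient
    is 0 in any case.\<close>
  define \<epsilon> where "\<epsilon> = (if \<theta> = 0 then 1/2 else 1 - \<theta> / m)"
  have e: "0 < \<epsilon>" "\<epsilon> < 1" "\<theta> / (1 - \<epsilon>) \<le> m" using m lam by (auto simp: \<epsilon>_def field_simps)
  have "eventual_bound (\<theta> / (1 - \<epsilon>) + (1 - \<epsilon> / 2) ^ n * M)" for n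
  proof (induction n)
    case 0
    have "h A \<le> (\<theta> / (1 - \<epsilon>) + M) * card A" if "finite A" "A \<subseteq> carrier G" for A
    proof -
      have "0 \<le> \<theta> / (1 - \<epsilon>) * card A" using e lam by simp
      then show ?thesis using h_le_card[OF that] by (simp add: distrib_right)
    qed
    then show ?case unfolding eventual_bound_def by (intro exI[of _ "{}"] exI[of _ 1]) auto
  next
    case (Suc n)
    from eventual_bound_improve[OF lam approx e(1,2) _ Suc] show ?case using e M_pos by (simp add: mult.assoc)
  qed
  moreover have "(\<lambda>n. (1 - \<epsilon> / 2) ^ n * M) \<longlonglongrightarrow> 0 * M"
    using e by (intro tendsto_mult_right LIMSEQ_realpow_zero) auto
  then have "eventually (\<lambda>n. (1 - \<epsilon> / 2) ^ n * M < \<kappa> - m) sequentially"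
    using m by (intro order_tendstoD) auto
  then obtain n where "(1 - \<epsilon> / 2) ^ n * M < \<kappa> - m" by (auto simp: eventually_sequentially)
  ultimately obtain s where s: "eventual_bound s" "s \<le> \<kappa>" using e(3) by (metis add.commute add_mono diff_add_cancel less_imp_le)
  then show ?thesis unfolding eventual_bound_def by (meson mult_right_mono of_nat_0_le_iff order_trans)
qed

text \<open>\<open>Inf (S F)\<close> is the lower limit along \<open>F\<close>. Bounds just above it
  are met by arbitrarily invariant members of \<open>F\<close>, hence become eventual bounds along
  every Folner sequence: along \<open>F\<close> itself this gives convergence, and between two
  sequences it compares the limits in both directions.\<close>

theorem ornstein_weiss:
  "\<exists>l. \<forall>F. folner_seq G F \<longrightarrow> (\<lambda>n. h (F n) / card (F n)) \<longlonglongrightarrow> l"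
proof -
  define S where "S F = {\<theta>::real. 0 \<le> \<theta> \<and> (\<exists>\<^sub>F n in sequentially. h (F n) / card (F n) \<le> \<theta>)}" for F
  have Fn: "finite (F n)" "F n \<noteq> {}" "F n \<subseteq> carrier G" if "folner_seq G F" for F n
    using that by (auto simp: folner_seq_def)
  have pos: "0 < real (card (F n))" if "folner_seq G F" for F n
    using Fn[OF that, of n] by (simp add: card_gt_0_iff)
  have cross: "eventually (\<lambda>n. h (F' n) / card (F' n) \<le> \<kappa>) sequentially"
    if F: "folner_seq G F" and F': "folner_seq G F'" and k: "Inf (S F) < \<kappa>" for F F' \<kappa>
  proof -
    \<comment> \<open>Non-emptiness of \<open>S F\<close>, without which its infimum would carry no
      information.\<close>
    have "M \<in> S F" using M_pos h_le_card[OF Fn(1,3)[OF F]] pos[OF F]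
      by (auto simp: S_def field_simps intro!: eventually_frequently always_eventually)
    then obtain \<theta> where lam: "\<theta> \<in> S F" "\<theta> < \<kappa>"
      using k cInf_lessD[of "S F" \<kappa>] by auto
    have "eventual_bound \<kappa>"
    proof (rule eventual_bound[OF _ _ lam(2)])
      fix L and \<delta> :: real assume L: "finite L" "L \<subseteq> carrier G" "0 < \<delta>"
      have "\<exists>\<^sub>F n in sequentially. almost_inv L \<delta> (F n) \<and> h (F n) / card (F n) \<le> \<theta>"
        using frequently_eventually_frequently[OF _ folner_eventually_almost_inv[OF F L],
            where P = "\<lambda>n. h (F n) / card (F n) \<le> \<theta>"] lam
        by (simp add: S_def conj_commute)
      then obtain n where n: "almost_inv L \<delta> (F n)" "h (F n) / card (F n) \<le> \<theta>" by (blast dest: frequently_ex)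
      then have "h (F n) \<le> \<theta> * card (F n)" using pos[OF F, of n] by (simp add: field_simps)
      then show "\<exists>K. finite K \<and> K \<noteq> {} \<and> K \<subseteq> carrier G \<and> almost_inv L \<delta> K \<and> h K \<le> \<theta> * card K"
        using n Fn[OF F, of n] by blast
    qed (use lam in \<open>auto simp: S_def\<close>)
    then obtain L \<delta> where L: "finite L" "L \<subseteq> carrier G" "0 < \<delta>"
      and b: "\<And>A. finite A \<Longrightarrow> A \<subseteq> carrier G \<Longrightarrow> almost_inv L \<delta> A \<Longrightarrow> h A \<le> \<kappa> * card A"
      unfolding eventual_bound_def by blast
    from folner_eventually_almost_inv[OF F' L] show ?thesis
    proof eventually_elim
      case (elim n)
      then show ?case using b[OF Fn(1,3)[OF F'] elim] pos[OF F', of n] by (simp add: field_simps)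
    qed
  qed
  have Inf_le: "Inf (S F') \<le> Inf (S F)" if F: "folner_seq G F" and F': "folner_seq G F'" for F F'
  proof (rule dense_ge)
    fix \<kappa> assume k: "Inf (S F) < \<kappa>"
    have "\<exists>\<^sub>F n in sequentially. h (F' n) / card (F' n) \<le> \<kappa>"
      by (rule eventually_frequently[OF _ cross[OF F F' k]]) simp
    moreover have "0 \<le> \<kappa>"
    proof -
      obtain n where "h (F' n) / card (F' n) \<le> \<kappa>"
        using cross[OF F F' k] by (auto simp: eventually_sequentially)
      moreover have "0 \<le> h (F' n) / card (F' n)" using h_nonneg[OF Fn(1,3)[OF F']] by simp
      ultimately show ?thesis by linarith
    qed
    ultimately have "\<kappa> \<in> S F'" by (simp add: S_def)
    then show "Inf (S F') \<le> \<kappa>" by (rule cInf_lower) (auto simp: S_def intro: bdd_belowI)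
  qed
  have lim: "(\<lambda>n. h (F n) / card (F n)) \<longlonglongrightarrow> Inf (S F)" if F: "folner_seq G F" for F
  proof (rule order_tendstoI)
    fix a assume a: "Inf (S F) < a"
    then obtain b where "Inf (S F) < b" "b < a" using dense by blast
    then show "eventually (\<lambda>n. h (F n) / card (F n) < a) sequentially"
      using cross[OF F F, of b] by (auto elim: eventually_mono)
  next
    fix a assume a: "a < Inf (S F)"
    show "eventually (\<lambda>n. a < h (F n) / card (F n)) sequentially"
    proof (rule ccontr)
      assume "\<not> ?thesis"
      then have fr: "\<exists>\<^sub>F n in sequentially. h (F n) / card (F n) \<le> a"
        by (simp add: frequently_def not_le)
      then obtain n where "h (F n) / card (F n) \<le> a" by (blast dest: frequently_ex)
      moreover have "0 \<le> h (F n) / card (F n)" using h_nonneg[OF Fn(1,3)[OF F]] by simp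
      ultimately have "0 \<le> a" by linarith
      then have "a \<in> S F" using fr by (simp add: S_def)
      then have "Inf (S F) \<le> a" by (rule cInf_lower) (auto simp: S_def intro: bdd_belowI)
      then show False using a by simp
    qed
  qed
  show ?thesis
  proof (cases "\<exists>F. folner_seq G F")
    case True
    then obtain F0 where F0: "folner_seq G F0" by blast
    have "Inf (S F) = Inf (S F0)" if "folner_seq G F" for F
      using Inf_le[OF F0 that] Inf_le[OF that F0] by simp
    then show ?thesis using lim by metis
  qed auto
qed

end

section \<open>Order of open covers\<close>

lemma ord_at_eq_card:
  assumes "finite \<V>"
  shows "ord_at \<V> x = int (card {V\<in>\<V>. x \<in> V}) - 1"
  using assms by (simp add: ord_at_def indicator_def sum.If_cases Int_def)

text \<open>\<open>Max\<close> is meaningful only on finite sets. The space may be infinite, but the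
  local order takes values only between -1 and \<open>card \<V> - 1\<close>.\<close>

lemma cover_ord_le_iff:
  assumes "finite \<V>"
  shows "cover_ord \<V> \<le> m \<longleftrightarrow> (\<forall>x. ord_at \<V> x \<le> m)"
proof -
  have "range (ord_at \<V>) \<subseteq> {-1..int (card \<V>) - 1}"
  proof
    fix m assume "m \<in> range (ord_at \<V>)"
    then obtain x where m: "m = int (card {V\<in>\<V>. x \<in> V}) - 1" using assms by (auto simp: ord_at_eq_card)
    have "card {V\<in>\<V>. x \<in> V} \<le> card \<V>" using assms by (intro card_mono) auto
    then show "m \<in> {-1..int (card \<V>) - 1}" using m by simp
  qed
  then have "finite (range (ord_at \<V>))" by (rule finite_subset) simp
  then show ?thesis unfolding cover_ord_def by (subst Max_le_iff) auto
qed

lemma ord_at_le_cover_ord: "finite \<V> \<Longrightarrow> ord_at \<V> x \<le> cover_ord \<V>"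
  using cover_ord_le_iff[of \<V> "cover_ord \<V>"] by simp

lemma open_coversD:
  assumes "\<V> \<in> open_covers"
  shows "finite \<V>" "\<And>V. V \<in> \<V> \<Longrightarrow> open V" "\<exists>V\<in>\<V>. x \<in> V"
  using assms by (auto simp: open_covers_def)

lemma ord_at_nonneg:
  assumes "\<V> \<in> open_covers"
  shows "0 \<le> ord_at \<V> x"
proof -
  have "{V\<in>\<V>. x \<in> V} \<noteq> {}" "finite {V\<in>\<V>. x \<in> V}" using open_coversD[OF assms] by auto
  then have "0 < card {V\<in>\<V>. x \<in> V}" by (simp add: card_gt_0_iff)
  then show ?thesis using open_coversD(1)[OF assms] by (simp add: ord_at_eq_card)
qed

lemma cover_ord_nonneg: "\<V> \<in> open_covers \<Longrightarrow> 0 \<le> cover_ord \<V>"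
  using ord_at_nonneg[of \<V> undefined] ord_at_le_cover_ord[of \<V> undefined] open_coversD(1)[of \<V>] by linarith

text \<open>A least integer need not exist in general; orders of open covers are non-negative, which
  moves the minimum to the natural numbers.\<close>

lemma cover_D_attained:
  assumes "\<V> \<in> open_covers" "refines \<V> \<U>"
  shows "\<exists>\<W>\<in>open_covers. refines \<W> \<U> \<and> cover_ord \<W> = cover_D \<U>"
    and "cover_D \<U> \<le> cover_ord \<V>"
proof -
  let ?P = "\<lambda>m. \<exists>\<V>\<in>open_covers. refines \<V> \<U> \<and> m = cover_ord \<V>"
  define k where "k = (LEAST k::nat. ?P (int k))"
  have nat: "\<exists>k::nat. m = int k" if "?P m" for m
    using that cover_ord_nonneg nonneg_int_cases by (metis)
  have "?P (cover_ord \<V>)" using assms by blast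
  with nat have "\<exists>k::nat. ?P (int k)" by metis
  then have k: "?P (int k)" unfolding k_def by (rule LeastI_ex)
  have least: "int k \<le> m" if P: "?P m" for m
  proof -
    obtain j :: nat where j: "m = int j" using nat[OF P] by blast
    then have "k \<le> j" unfolding k_def using P by (intro Least_le) simp
    then show ?thesis using j by simp
  qed
  have D: "cover_D \<U> = int k"
    unfolding cover_D_def using k least by (rule Least_equality)
  show "\<exists>\<W>\<in>open_covers. refines \<W> \<U> \<and> cover_ord \<W> = cover_D \<U>"
    using k D by metis
  show "cover_D \<U> \<le> cover_ord \<V>"
    unfolding D using assms by (intro least) blast
qed

lemma refines_refl: "refines \<U> \<U>"
  by (auto simp: refines_def)

lemma ex_optimal:
  assumes "\<U> \<in> open_covers"
  obtains \<V> where "\<V> \<in> open_covers" "refines \<V> \<U>" "cover_ord \<V> = cover_D \<U>"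
  using cover_D_attained(1)[OF assms refines_refl] by blast

lemma cover_D_nonneg: "\<U> \<in> open_covers \<Longrightarrow> 0 \<le> cover_D \<U>"
  by (metis ex_optimal cover_ord_nonneg)

text \<open>Preimages of the members of an optimal refinement form the new cover. Distinct members
  may have the same preimage, so the order can only drop. The target \<open>\<W>\<close> only has to
  be coarser than the preimage of \<open>\<U>\<close>, which fits translates and single elements
  alike.\<close>

lemma cover_D_vimage_le:
  assumes U: "\<U> \<in> open_covers" and f: "continuous_on UNIV f"
    and sub: "\<And>A. A \<in> \<U> \<Longrightarrow> \<exists>B\<in>\<W>. f -` A \<subseteq> B"
  shows "cover_D \<W> \<le> cover_D \<U>"
proof -
  obtain \<V> where V: "\<V> \<in> open_covers" "refines \<V> \<U>" "cover_ord \<V> = cover_D \<U>"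
    using ex_optimal[OF U] .
  define \<V>' where "\<V>' = (\<lambda>A. f -` A) ` \<V>"
  note fin = open_coversD(1)[OF V(1)]
  have "\<V>' \<in> open_covers"
    using fin open_coversD(2)[OF V(1)] open_coversD(3)[OF V(1)] f
    by (auto simp: open_covers_def \<V>'_def intro: open_vimage)
  moreover have "refines \<V>' \<W>"
    unfolding refines_def
  proof
    fix B assume "B \<in> \<V>'"
    then obtain A where A: "A \<in> \<V>" "B = f -` A" by (auto simp: \<V>'_def)
    then obtain A' where A': "A' \<in> \<U>" "A \<subseteq> A'" using V(2) by (auto simp: refines_def)
    then have "B \<subseteq> f -` A'" using A(2) by blast
    then show "\<exists>W\<in>\<W>. B \<subseteq> W" using sub[OF A'(1)] by blast
  qed
  moreover have "cover_ord \<V>' \<le> cover_ord \<V>"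
  proof (subst cover_ord_le_iff, simp add: \<V>'_def fin, rule allI)
    fix x
    have "{A\<in>\<V>'. x \<in> A} \<subseteq> (\<lambda>A. f -` A) ` {A\<in>\<V>. f x \<in> A}" by (auto simp: \<V>'_def)
    then have "card {A\<in>\<V>'. x \<in> A} \<le> card {A\<in>\<V>. f x \<in> A}"
      using fin by (intro order_trans[OF card_mono card_image_le]) auto
    then have "ord_at \<V>' x \<le> ord_at \<V> (f x)"
      using fin by (simp add: ord_at_eq_card \<V>'_def)
    then show "ord_at \<V>' x \<le> cover_ord \<V>" using ord_at_le_cover_ord[OF fin] order_trans by blast
  qed
  ultimately show ?thesis using cover_D_attained(2)[of \<V>' \<W>] V(3) by linarith
qed

text \<open>For refinements of orders \<open>m\<close> and \<open>n\<close>, the sets \<open>W R\<close> around a point come from a chain of index sets \<open>R\<close>; the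
  members of the chain lie between two and \<open>(m + 1) + (n + 1)\<close> in cardinality, since each of
  them uses both covers.\<close>

lemma cover_D_join_le:
  fixes \<U> \<V> \<W> :: "'x::metric_space set set"
  assumes U: "\<U> \<in> open_covers" and V: "\<V> \<in> open_covers"
    and sub: "\<And>A B. A \<in> \<U> \<Longrightarrow> B \<in> \<V> \<Longrightarrow> \<exists>C\<in>\<W>. A \<inter> B \<subseteq> C"
  shows "cover_D \<W> \<le> cover_D \<U> + cover_D \<V>"
proof -
  obtain \<A> where A: "\<A> \<in> open_covers" "refines \<A> \<U>" "cover_ord \<A> = cover_D \<U>"
    using ex_optimal[OF U] .
  obtain \<B> where B: "\<B> \<in> open_covers" "refines \<B> \<V>" "cover_ord \<B> = cover_D \<V>"
    using ex_optimal[OF V] .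
  define I where "I = Inl ` \<A> \<union> Inr ` \<B>"
  define h where "h = (\<lambda>r::'x set + 'x set. open_dist (case_sum id id r))"
  \<comment> \<open>Read the functions \<open>h\<close>, up to normalisation, as coordinates in the
    join of the two nerves: these sets are the open stars of the vertices of its barycentric
    subdivision. Overlapping stars belong to nested simplices.\<close>
  define W where "W R = {x. \<forall>r\<in>R. 0 < h r x \<and> (\<forall>s\<in>I - R. h s x < h r x)}" for R
  \<comment> \<open>Simplices with vertices from both covers only, so that each set lies in a member
    of either cover. Dropping the others is what saves 1 in the order.\<close>
  define \<R> where "\<R> = {R. R \<subseteq> I \<and> (\<exists>A. Inl A \<in> R) \<and> (\<exists>B. Inr B \<in> R)}"
  have finAB: "finite \<A>" "finite \<B>" using open_coversD(1) A B by auto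
  have finI: "finite I" using finAB by (simp add: I_def)
  have finR: "finite \<R>" by (rule finite_subset[of _ "Pow I"]) (auto simp: \<R>_def finI)
  have pos: "0 < h (Inl A) x \<longleftrightarrow> x \<in> A" "0 < h (Inr B) x \<longleftrightarrow> x \<in> B" if "A \<in> \<A>" "B \<in> \<B>" for A B x
    using open_coversD(2)[OF A(1) that(1)] open_coversD(2)[OF B(1) that(2)]
    by (simp_all add: h_def open_dist_pos_iff)
  have openW: "open (W R)" if "R \<in> \<R>" for R
  proof -
    have R: "finite R" using that finI by (auto simp: \<R>_def intro: finite_subset)
    have "W R = (\<Inter>r\<in>R. {x. 0 < h r x} \<inter> (\<Inter>s\<in>I - R. {x. h s x < h r x}))" by (auto simp: W_def)
    moreover have "open (\<Inter>r\<in>R. {x. 0 < h r x} \<inter> (\<Inter>s\<in>I - R. {x. h s x < h r x}))"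
      using R finI
      by (intro open_INT open_Int ballI open_Collect_less) (auto simp: h_def intro!: continuous_intros)
    ultimately show ?thesis by simp
  qed
  have cov: "\<exists>R\<in>\<R>. x \<in> W R" for x
  proof -
    obtain A B where AB: "A \<in> \<A>" "x \<in> A" "B \<in> \<B>" "x \<in> B"
      using open_coversD(3)[OF A(1), of x] open_coversD(3)[OF B(1), of x] by blast
    \<comment> \<open>The set of all positive coordinates qualifies, since the remaining ones vanish
      at \<open>x\<close>.\<close>
    define R where "R = {r\<in>I. 0 < h r x}"
    have "Inl A \<in> R" "Inr B \<in> R" using AB pos[OF AB(1,3), of x] by (auto simp: R_def I_def)
    then have "R \<in> \<R>" by (auto simp: \<R>_def R_def)
    moreover have "x \<in> W R"
      by (auto simp: W_def R_def)
    ultimately show ?thesis by blast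
  qed
  have chain: "R \<subseteq> R' \<or> R' \<subseteq> R" if "R \<in> \<R>" "R' \<in> \<R>" "x \<in> W R" "x \<in> W R'" for R R' x
  proof (rule ccontr)
    assume "\<not> ?thesis"
    then obtain r r' where "r \<in> R" "r \<notin> R'" "r' \<in> R'" "r' \<notin> R" by blast
    then have "h r' x < h r x" "h r x < h r' x" using that by (auto simp: W_def \<R>_def)
    then show False by simp
  qed
  define \<C> where "\<C> = W ` \<R>"
  have "\<C> \<in> open_covers" using finR openW cov by (auto simp: open_covers_def \<C>_def)
  moreover have "refines \<C> \<W>"
    unfolding refines_def
  proof
    fix C assume "C \<in> \<C>"
    then obtain R where R: "R \<in> \<R>" "C = W R" by (auto simp: \<C>_def)
    then obtain A B where AB: "Inl A \<in> R" "Inr B \<in> R" by (auto simp: \<R>_def)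
    then have AB': "A \<in> \<A>" "B \<in> \<B>" using R by (auto simp: \<R>_def I_def)
    have "C \<subseteq> A \<inter> B"
    proof
      fix x assume "x \<in> C"
      then have "0 < h (Inl A) x" "0 < h (Inr B) x" using AB R(2) by (auto simp: W_def)
      then show "x \<in> A \<inter> B" using pos[OF AB'] by simp
    qed
    moreover obtain A' B' where "A' \<in> \<U>" "A \<subseteq> A'" "B' \<in> \<V>" "B \<subseteq> B'"
      using A(2) B(2) AB' unfolding refines_def by blast
    moreover obtain C' where "C' \<in> \<W>" "A' \<inter> B' \<subseteq> C'" using sub calculation by blast
    ultimately show "\<exists>C'\<in>\<W>. C \<subseteq> C'" by blast
  qed
  moreover have "cover_ord \<C> \<le> cover_ord \<A> + cover_ord \<B>"
  proof (subst cover_ord_le_iff, simp add: \<C>_def finR, rule allI)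
    fix x
    let ?S = "{R\<in>\<R>. x \<in> W R}"
    let ?a = "card {A\<in>\<A>. x \<in> A}" and ?b = "card {B\<in>\<B>. x \<in> B}"
    have "{C\<in>\<C>. x \<in> C} \<subseteq> W ` ?S" by (auto simp: \<C>_def)
    moreover have finS: "finite ?S" using finR by simp
    ultimately have 1: "card {C\<in>\<C>. x \<in> C} \<le> card ?S"
      by (meson card_image_le card_mono finite_imageI order_trans)
    \<comment> \<open>Different finite members of a chain have different cardinalities, so it
      suffices to count cardinalities.\<close>
    have "inj_on card ?S"
    proof (rule inj_onI)
      fix R R' assume R: "R \<in> ?S" "R' \<in> ?S" "card R = card R'"
      then have "finite R" "finite R'" using finI by (auto simp: \<R>_def intro: finite_subset)
      then show "R = R'" using chain[of R R' x] R card_subset_eq by (metis mem_Collect_eq)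
    qed
    moreover have "card ` ?S \<subseteq> {2..?a + ?b}"
    proof
      fix n assume "n \<in> card ` ?S"
      then obtain R where R: "R \<in> \<R>" "x \<in> W R" "n = card R" by auto
      have finRR: "finite R" using R finI by (auto simp: \<R>_def intro: finite_subset)
      obtain A B where "Inl A \<in> R" "Inr B \<in> R" using R by (auto simp: \<R>_def)
      then have "card {Inl A, Inr B} \<le> card R" using finRR by (intro card_mono) auto
      then have "2 \<le> n" using R by simp
      have RI: "R \<subseteq> I" using R by (simp add: \<R>_def)
      have "R \<subseteq> Inl ` {A\<in>\<A>. x \<in> A} \<union> Inr ` {B\<in>\<B>. x \<in> B}"
      proof
        fix r assume r: "r \<in> R"
        then have hr: "0 < h r x" using R by (simp add: W_def)
        show "r \<in> Inl ` {A\<in>\<A>. x \<in> A} \<union> Inr ` {B\<in>\<B>. x \<in> B}"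
        proof (cases r)
          case (Inl A)
          then have "A \<in> \<A>" using r RI by (auto simp: I_def)
          then have "x \<in> A" using open_coversD(2)[OF A(1)] hr Inl by (simp add: h_def open_dist_pos_iff)
          then show ?thesis using Inl \<open>A \<in> \<A>\<close> by blast
        next
          case (Inr B)
          then have "B \<in> \<B>" using r RI by (auto simp: I_def)
          then have "x \<in> B" using open_coversD(2)[OF \<open>\<B> \<in> open_covers\<close>] hr Inr by (simp add: h_def open_dist_pos_iff)
          then show ?thesis using Inr \<open>B \<in> \<B>\<close> by blast
        qed
      qed
      then have "card R \<le> card (Inl ` {A\<in>\<A>. x \<in> A} \<union> Inr ` {B\<in>\<B>. x \<in> B} :: ('x set + 'x set) set)"
        using finAB by (intro card_mono) auto
      also have "\<dots> = ?a + ?b" using finAB by (subst card_Un_disjoint) (auto simp: card_image)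
      finally show "n \<in> {2..?a + ?b}" using \<open>2 \<le> n\<close> R by simp
    qed
    \<comment> \<open>At most \<open>?a + ?b - 1\<close> sets, hence a local order of at most
      \<open>?a + ?b - 2\<close>, which is the sum of the two local orders.\<close>
    ultimately have 2: "card ?S \<le> card {2..?a + ?b}" by (rule card_inj_on_le) simp
    have ge: "1 \<le> ?a" "1 \<le> ?b"
      using ord_at_nonneg[OF A(1), of x] ord_at_nonneg[OF B(1), of x] finAB by (simp_all add: ord_at_eq_card)
    have "int (card {C\<in>\<C>. x \<in> C}) - 1 \<le> (int ?a - 1) + (int ?b - 1)" using 1 2 ge by simp
    then have "ord_at \<C> x \<le> ord_at \<A> x + ord_at \<B> x"
      using finAB finR by (simp add: ord_at_eq_card \<C>_def)
    then show "ord_at \<C> x \<le> cover_ord \<A> + cover_ord \<B>"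
      using ord_at_le_cover_ord[OF finAB(1), of x] ord_at_le_cover_ord[OF finAB(2), of x] by linarith
  qed
  ultimately show ?thesis using cover_D_attained(2)[of \<C> \<W>] A(3) B(3) by linarith
qed

text \<open>Choice functions in \<open>F \<rightarrow> \<U>\<close> are unconstrained outside
  \<open>F\<close>. The extensional ones yield the same sets, and they are finitely many.\<close>

lemma join_cover_eq_PiE: "join_cover act F \<U> = (\<lambda>u. \<Inter>g\<in>F. act g -` u g) ` (F \<rightarrow>\<^sub>E \<U>)"
proof
  show "join_cover act F \<U> \<subseteq> (\<lambda>u. \<Inter>g\<in>F. act g -` u g) ` (F \<rightarrow>\<^sub>E \<U>)"
  proof
    fix A assume "A \<in> join_cover act F \<U>"
    then obtain u where u: "u \<in> F \<rightarrow> \<U>" "A = (\<Inter>g\<in>F. act g -` u g)" by (auto simp: join_cover_def)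
    then have "A = (\<Inter>g\<in>F. act g -` restrict u F g)" "restrict u F \<in> F \<rightarrow>\<^sub>E \<U>" by auto
    then show "A \<in> (\<lambda>u. \<Inter>g\<in>F. act g -` u g) ` (F \<rightarrow>\<^sub>E \<U>)" by blast
  qed
qed (auto simp: join_cover_def)

lemma join_cover_open_covers:
  fixes act :: "'g \<Rightarrow> 'x::metric_space \<Rightarrow> 'x"
  assumes F: "finite F" and act: "\<forall>g\<in>F. continuous_on UNIV (act g)" and U: "\<U> \<in> open_covers"
  shows "join_cover act F \<U> \<in> open_covers"
proof -
  have "finite (join_cover act F \<U>)"
    unfolding join_cover_eq_PiE using F open_coversD(1)[OF U] by (intro finite_imageI finite_PiE) auto
  moreover have "open A" if A: "A \<in> join_cover act F \<U>" for A
  proof -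
    obtain u where u: "u \<in> F \<rightarrow> \<U>" "A = (\<Inter>g\<in>F. act g -` u g)" using A by (auto simp: join_cover_def)
    have "open (act g -` u g)" if "g \<in> F" for g
      using open_coversD(2)[OF U] u(1) act that by (intro open_vimage) auto
    then show ?thesis unfolding u(2) using F by (intro open_INT) auto
  qed
  moreover have "x \<in> \<Union> (join_cover act F \<U>)" for x
  proof -
    have "\<forall>g. \<exists>V\<in>\<U>. act g x \<in> V" using open_coversD(3)[OF U] by blast
    then obtain u where "\<And>g. u g \<in> \<U>" "\<And>g. act g x \<in> u g" by metis
    then have "x \<in> (\<Inter>g\<in>F. act g -` u g)" "u \<in> F \<rightarrow> \<U>" by auto
    then show ?thesis unfolding join_cover_def by blast
  qed
  ultimately show ?thesis by (auto simp: open_covers_def)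
qed

lemma subadditive_cover_D:
  fixes G :: "('g, 'm) monoid_scheme" and act :: "'g \<Rightarrow> 'x::metric_space \<Rightarrow> 'x"
  assumes G: "monoid_cancel G" and sys: "G_system G act" and U: "\<U> \<in> open_covers"
  shows "subadditive_set_function G (\<lambda>F. real_of_int (cover_D (join_cover act F \<U>))) (cover_D \<U> + 1)"
proof -
  interpret monoid_cancel G by fact
  have cont: "continuous_on UNIV (act g)" if "g \<in> carrier G" for g
    using sys that by (auto simp: G_system_def)
  have comp: "act (g \<otimes>\<^bsub>G\<^esub> p) x = act g (act p x)" if "g \<in> carrier G" "p \<in> carrier G" for g p x
    using sys that by (auto simp: G_system_def)
  have cov: "join_cover act F \<U> \<in> open_covers" if "finite F" "F \<subseteq> carrier G" for F
    by (rule join_cover_open_covers[OF that(1) _ U]) (use that cont in auto)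
  show ?thesis
  proof (unfold_locales)
    show "0 \<le> real_of_int (cover_D (join_cover act A \<U>))" if "finite A" "A \<subseteq> carrier G" for A
      using cover_D_nonneg[OF cov[OF that]] by simp
    show "real_of_int (cover_D (join_cover act {} \<U>)) = 0"
    proof -
      \<comment> \<open>The empty intersection is the whole space, which forms a cover of order
        0.\<close>
      have e: "join_cover act {} \<U> = {UNIV}" by (auto simp: join_cover_def)
      have c: "{UNIV :: 'x set} \<in> open_covers" by (simp add: open_covers_def)
      have "cover_ord {UNIV :: 'x set} \<le> 0" by (subst cover_ord_le_iff) (auto simp: ord_at_def)
      then show ?thesis unfolding e using cover_D_attained(2)[OF c refines_refl] cover_D_nonneg[OF c] by simp
    qed
    show "real_of_int (cover_D (join_cover act (A \<union> B) \<U>))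
        \<le> real_of_int (cover_D (join_cover act A \<U>)) + real_of_int (cover_D (join_cover act B \<U>))"
      if "finite A" "A \<subseteq> carrier G" "finite B" "B \<subseteq> carrier G" for A B
    proof -
      have "cover_D (join_cover act (A \<union> B) \<U>) \<le> cover_D (join_cover act A \<U>) + cover_D (join_cover act B \<U>)"
      proof (rule cover_D_join_le[OF cov[OF that(1,2)] cov[OF that(3,4)]])
        fix C D assume "C \<in> join_cover act A \<U>" "D \<in> join_cover act B \<U>"
        then obtain u v where u: "u \<in> A \<rightarrow> \<U>" "C = (\<Inter>g\<in>A. act g -` u g)"
          and v: "v \<in> B \<rightarrow> \<U>" "D = (\<Inter>g\<in>B. act g -` v g)" unfolding join_cover_def by blast
        \<comment> \<open>On the overlap of \<open>A\<close> and \<open>B\<close> the choice made by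
          \<open>u\<close> is enough; forgetting the one made by \<open>v\<close> only enlarges the
          set.\<close>
        define w where "w g = (if g \<in> A then u g else v g)" for g
        have "w \<in> A \<union> B \<rightarrow> \<U>" using u v by (auto simp: w_def)
        moreover have "C \<inter> D \<subseteq> (\<Inter>g\<in>A \<union> B. act g -` w g)" using u v by (auto simp: w_def)
        ultimately show "\<exists>E\<in>join_cover act (A \<union> B) \<U>. C \<inter> D \<subseteq> E" unfolding join_cover_def by blast
      qed
      then show ?thesis by linarith
    qed
    show "real_of_int (cover_D (join_cover act (rtrans A p) \<U>)) \<le> real_of_int (cover_D (join_cover act A \<U>))"
      if A: "finite A" "A \<subseteq> carrier G" and p: "p \<in> carrier G" for A p
    proof -
      have inj: "inj_on (\<lambda>k. k \<otimes>\<^bsub>G\<^esub> p) A" using A p by (intro inj_on_rmult)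
      have "cover_D (join_cover act (rtrans A p) \<U>) \<le> cover_D (join_cover act A \<U>)"
      proof (rule cover_D_vimage_le[OF cov[OF A] cont[OF p]])
        fix C assume "C \<in> join_cover act A \<U>"
        then obtain u where u: "u \<in> A \<rightarrow> \<U>" "C = (\<Inter>g\<in>A. act g -` u g)" unfolding join_cover_def by blast
        \<comment> \<open>By right cancellation each element of the translate comes from a single
          element of \<open>A\<close>, whose choice it inherits.\<close>
        define w where "w = u \<circ> inv_into A (\<lambda>k. k \<otimes>\<^bsub>G\<^esub> p)"
        have w: "w (a \<otimes>\<^bsub>G\<^esub> p) = u a" if "a \<in> A" for a
          using inv_into_f_f[OF inj that] by (simp add: w_def)
        have "w \<in> rtrans A p \<rightarrow> \<U>" using w u by (auto simp: rtrans_def)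
        moreover have "act p -` C \<subseteq> (\<Inter>g\<in>rtrans A p. act g -` w g)"
          using u w comp p A by (auto simp: rtrans_def subset_iff)
        ultimately show "\<exists>B\<in>join_cover act (rtrans A p) \<U>. act p -` C \<subseteq> B" unfolding join_cover_def by blast
      qed
      then show ?thesis by linarith
    qed
    show "real_of_int (cover_D (join_cover act {g} \<U>)) \<le> real_of_int (cover_D \<U> + 1)" if "g \<in> carrier G" for g
    proof -
      have "cover_D (join_cover act {g} \<U>) \<le> cover_D \<U>"
      proof (rule cover_D_vimage_le[OF U cont[OF that]])
        fix A assume "A \<in> \<U>"
        then have "act g -` A \<in> join_cover act {g} \<U>" by (auto simp: join_cover_def intro!: exI[of _ "\<lambda>_. A"])
        then show "\<exists>B\<in>join_cover act {g} \<U>. act g -` A \<subseteq> B" by blast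
      qed
      then show ?thesis by linarith
    qed
    \<comment> \<open>The added 1 keeps the bound positive when
      \<open>cover_D \<U> = 0\<close>.\<close>
    show "0 < real_of_int (cover_D \<U> + 1)" using cover_D_nonneg[OF U] by linarith
  qed
qed

text \<open>The definite description needs uniqueness as well as existence: the given Folner
  sequence forces any two candidates to agree.\<close>

lemma mdim_cover_limit:
  fixes act :: "'g \<Rightarrow> 'x::metric_space \<Rightarrow> 'x"
  assumes G: "monoid_cancel G" and sys: "G_system G act" and U: "\<U> \<in> open_covers" and F: "folner_seq G F"
  shows "(\<lambda>n. real_of_int (cover_D (join_cover act (F n) \<U>)) / real (card (F n))) \<longlonglongrightarrow> mdim_cover G act \<U>"
proof -
  interpret subadditive_set_function G "\<lambda>F. real_of_int (cover_D (join_cover act F \<U>))" "cover_D \<U> + 1"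
    by (rule subadditive_cover_D[OF G sys U])
  let ?L = "\<lambda>l. \<forall>F. folner_seq G F \<longrightarrow>
     (\<lambda>n. real_of_int (cover_D (join_cover act (F n) \<U>)) / real (card (F n))) \<longlonglongrightarrow> l"
  obtain l where l: "?L l" using ornstein_weiss by blast
  have "?L (mdim_cover G act \<U>)"
    unfolding mdim_cover_def
  proof (rule theI[of ?L, OF l])
    fix l' assume "?L l'"
    then show "l' = l" using l F LIMSEQ_unique by blast
  qed
  then show ?thesis using F by blast
qed

section \<open>Supporting measures of convex potentials\<close>

text \<open>The index \<open>i\<close> is a finite open cover, filtered by the principal filter, for mean dimension,
  and the scale \<open>\<epsilon> \<rightarrow> 0\<close> for metric mean dimension.\<close>

locale limsup_potential =
  fixes G :: "('g, 'm) monoid_scheme" (structure)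
    and act :: "'g \<Rightarrow> 'x::metric_space \<Rightarrow> 'x" and F :: "nat \<Rightarrow> 'g set"
    and \<Phi> :: "'i filter" and b :: "'i \<Rightarrow> nat \<Rightarrow> ('x \<Rightarrow> real) \<Rightarrow> real"
  assumes cancel: "monoid_cancel G" and sys: "G_system G act"
    and compact_UNIV: "compact (UNIV :: 'x set)" and folner: "folner_seq G F"
    and nontrivial: "\<Phi> \<noteq> bot"
    and b_le: "\<forall>\<^sub>F i in \<Phi>. \<forall>n f g K. continuous_on UNIV f \<longrightarrow> continuous_on UNIV g \<longrightarrow>
      (\<forall>x. birkhoff_sum act (F n) f x \<le> birkhoff_sum act (F n) g x + K) \<longrightarrow>
      b i n f \<le> b i n g + K / real (card (F n))"
    and b_convex: "\<forall>\<^sub>F i in \<Phi>. \<forall>n f g t. continuous_on UNIV f \<longrightarrow> continuous_on UNIV g \<longrightarrow>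
      0 \<le> t \<longrightarrow> t \<le> 1 \<longrightarrow> b i n (\<lambda>x. t * f x + (1 - t) * g x) \<le> t * b i n f + (1 - t) * b i n g"
    and b_zero: "\<forall>\<^sub>F i in \<Phi>. \<forall>n. 0 \<le> b i n (\<lambda>_. 0)"
begin

definition \<Gamma> :: "('x \<Rightarrow> real) \<Rightarrow> ereal" where
  "\<Gamma> f = Limsup \<Phi> (\<lambda>i. limsup (\<lambda>n. ereal (b i n f)))"

lemma card_F_pos: "0 < real (card (F n))"
  using folner by (simp add: folner_seq_def card_gt_0_iff)

text \<open>Together with \<open>\<Gamma>_le_real\<close> this replaces iterated upper limits of
  extended reals by eventual inequalities between reals, which can be combined for several functions
  at once.\<close>

lemma \<Gamma>_less_eventually:
  assumes "\<Gamma> f < ereal r"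
  shows "\<forall>\<^sub>F i in \<Phi>. \<forall>\<^sub>F n in sequentially. b i n f < r"
proof -
  have "\<forall>\<^sub>F i in \<Phi>. limsup (\<lambda>n. ereal (b i n f)) < ereal r"
    using assms unfolding \<Gamma>_def by (rule Limsup_lessD)
  then show ?thesis
  proof eventually_elim
    case (elim i)
    then have "\<forall>\<^sub>F n in sequentially. ereal (b i n f) < ereal r" by (rule Limsup_lessD)
    then show ?case by simp
  qed
qed

lemma \<Gamma>_le_real:
  assumes "\<forall>\<^sub>F i in \<Phi>. \<forall>\<^sub>F n in sequentially. b i n f \<le> r"
  shows "\<Gamma> f \<le> ereal r"
  unfolding \<Gamma>_def
proof (rule Limsup_bounded)
  show "\<forall>\<^sub>F i in \<Phi>. limsup (\<lambda>n. ereal (b i n f)) \<le> ereal r"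
    using assms by eventually_elim (rule Limsup_bounded, simp)
qed

text \<open>Made for two uses: \<open>\<delta> = 0\<close> gives a pointwise bound with constant
  \<open>c\<close>, and \<open>c = 0\<close> treats coboundaries, whose Birkhoff sums are
  \<open>o(card (F n))\<close>.\<close>

lemma \<Gamma>_mono_asymp:
  assumes f: "continuous_on UNIV f" and g: "continuous_on UNIV g" and \<delta>: "\<delta> \<longlonglongrightarrow> 0"
    and le: "\<And>n x. birkhoff_sum act (F n) f x \<le> birkhoff_sum act (F n) g x + (c + \<delta> n) * real (card (F n))"
  shows "\<Gamma> f \<le> \<Gamma> g + ereal c"
proof (rule dense_ge)
  fix z assume z: "\<Gamma> g + ereal c < z"
  show "\<Gamma> f \<le> z"
  proof (cases z)
    case (real r)
    then have "\<Gamma> g < ereal (r - c)" using z by (cases "\<Gamma> g") auto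
    \<comment> \<open>The strict gap \<open>r - c - a\<close> absorbs \<open>\<delta> n\<close> for
      large \<open>n\<close>.\<close>
    then obtain a where a: "\<Gamma> g < ereal a" "a < r - c" using ereal_dense2 by force
    from \<Gamma>_less_eventually[OF a(1)] b_le
    have "\<forall>\<^sub>F i in \<Phi>. \<forall>\<^sub>F n in sequentially. b i n f \<le> r"
    proof eventually_elim
      case (elim i)
      have "\<forall>\<^sub>F n in sequentially. \<delta> n < r - c - a" using \<delta> a by (intro order_tendstoD) auto
      with elim(1) show ?case
      proof eventually_elim
        case (elim n)
        have "b i n f \<le> b i n g + (c + \<delta> n) * real (card (F n)) / real (card (F n))"
          using \<open>\<forall>n f g K. _ n f g K\<close> f g le by blast
        then show ?case using elim card_F_pos[of n] by simp
      qed
    qed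
    then show ?thesis using \<Gamma>_le_real real by simp
  qed (use z in auto)
qed

lemma \<Gamma>_le_add_const:
  assumes "continuous_on UNIV f" "continuous_on UNIV g" "\<And>x. f x \<le> g x + c"
  shows "\<Gamma> f \<le> \<Gamma> g + ereal c"
proof (rule \<Gamma>_mono_asymp[OF assms(1,2) tendsto_const])
  fix n x
  have "birkhoff_sum act (F n) f x \<le> (\<Sum>h\<in>F n. g (act h x) + c)"
    unfolding birkhoff_sum_def by (intro sum_mono assms)
  then show "birkhoff_sum act (F n) f x \<le> birkhoff_sum act (F n) g x + (c + 0) * real (card (F n))"
    by (simp add: birkhoff_sum_def sum.distrib mult.commute)
qed

text \<open>By left cancellation \<open>h \<mapsto> g \<otimes> h\<close> runs through
  \<open>g <# F n\<close> without repetition, so the Birkhoff sum is a difference of sums over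
  \<open>g <# F n\<close> and \<open>F n\<close>. Their common part cancels, and each remaining term
  costs at most \<open>B\<close>.\<close>

lemma \<Gamma>_coboundary_le:
  assumes f: "continuous_on UNIV f" and g: "g \<in> carrier G"
  shows "\<Gamma> (\<lambda>x. f (act g x) - f x) \<le> \<Gamma> (\<lambda>_. 0)"
proof -
  interpret monoid_cancel G by (rule cancel)
  have actg: "continuous_on UNIV (act g)" using sys g by (auto simp: G_system_def)
  have "bounded (range f)" using compact_continuous_image[OF f compact_UNIV] by (rule compact_imp_bounded)
  then obtain B where B: "0 < B" "\<And>x. \<bar>f x\<bar> \<le> B" by (auto simp: bounded_pos)
  have Fn: "finite (F n)" "F n \<subseteq> carrier G" for n using folner by (auto simp: folner_seq_def)
  define \<delta> where "\<delta> n = B * (real (card (sym_diff (g <# F n) (F n))) / real (card (F n)))" for n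
  have "\<delta> \<longlonglongrightarrow> B * 0"
    unfolding \<delta>_def by (intro tendsto_mult_left) (use folner g in \<open>auto simp: folner_seq_def\<close>)
  moreover have "continuous_on UNIV (\<lambda>x. f (act g x) - f x)"
    by (intro continuous_intros f actg continuous_on_compose2[OF f actg]) auto
  moreover have "birkhoff_sum act (F n) (\<lambda>x. f (act g x) - f x) x
      \<le> birkhoff_sum act (F n) (\<lambda>_. 0) x + (0 + \<delta> n) * real (card (F n))" for n x
  proof -
    let ?gF = "g <# F n"
    let ?s = "\<lambda>A. \<Sum>y\<in>A. f (act y x)"
    have gF: "?gF = (\<lambda>h. g \<otimes> h) ` F n" by (auto simp: l_coset_def)
    have fin: "finite ?gF" using Fn by (simp add: gF)
    have "?s ?gF = (\<Sum>h\<in>F n. f (act (g \<otimes> h) x))"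
      unfolding gF using inj_on_lmult[OF g Fn(2)] by (simp add: sum.reindex)
    also have "\<dots> = (\<Sum>h\<in>F n. f (act g (act h x)))"
      using sys g Fn(2)[of n] by (intro sum.cong) (auto simp: G_system_def)
    finally have "birkhoff_sum act (F n) (\<lambda>x. f (act g x) - f x) x = ?s ?gF - ?s (F n)"
      by (simp add: birkhoff_sum_def sum_subtractf)
    also have "\<dots> = ?s (?gF - F n) - ?s (F n - ?gF)"
      using sum.Int_Diff[OF fin, of "\<lambda>y. f (act y x)" "F n"] sum.Int_Diff[OF Fn(1), of "\<lambda>y. f (act y x)" n ?gF]
      by (simp add: Int_commute)
    also have "\<dots> \<le> (\<Sum>y\<in>?gF - F n. B) - (\<Sum>y\<in>F n - ?gF. - B)"
      by (intro diff_mono sum_mono) (use B(2) in \<open>auto simp: abs_le_iff minus_le_iff\<close>)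
    also have "\<dots> = B * real (card (?gF - F n) + card (F n - ?gF))" by (simp add: algebra_simps)
    also have "card (?gF - F n) + card (F n - ?gF) = card (sym_diff ?gF (F n))"
      using fin Fn(1) by (subst card_Un_disjoint) auto
    also have "B * real \<dots> = \<delta> n * real (card (F n))" using card_F_pos[of n] by (simp add: \<delta>_def)
    finally show ?thesis by (simp add: birkhoff_sum_def)
  qed
  ultimately have "\<Gamma> (\<lambda>x. f (act g x) - f x) \<le> \<Gamma> (\<lambda>_. 0) + ereal 0"
    by (intro \<Gamma>_mono_asymp) auto
  then show ?thesis by (simp add: zero_ereal_def[symmetric])
qed

lemma \<Gamma>_zero_nonneg: "0 \<le> \<Gamma> (\<lambda>_. 0)"
  unfolding \<Gamma>_def
proof (rule le_Limsup[OF nontrivial])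
  show "\<forall>\<^sub>F i in \<Phi>. 0 \<le> limsup (\<lambda>n. ereal (b i n (\<lambda>_. 0)))"
    using b_zero by eventually_elim (rule le_Limsup, auto)
qed

text \<open>By compactness \<open>f\<close> stays within a constant of 0, and \<Gamma> then moves by
  at most that constant.\<close>

lemma \<Gamma>_finite:
  assumes fin: "\<Gamma> (\<lambda>_. 0) < \<infinity>" and f: "continuous_on UNIV f"
  shows "\<bar>\<Gamma> f\<bar> \<noteq> \<infinity>"
proof -
  have "bounded (range f)" using compact_continuous_image[OF f compact_UNIV] by (rule compact_imp_bounded)
  then obtain B where B: "\<And>x. \<bar>f x\<bar> \<le> B" by (auto simp: bounded_iff)
  have "f x \<le> 0 + B" "0 \<le> f x + B" for x using B[of x] by auto
  then have "\<Gamma> f \<le> \<Gamma> (\<lambda>_. 0) + ereal B" "\<Gamma> (\<lambda>_. 0) \<le> \<Gamma> f + ereal B"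
    using f by (intro \<Gamma>_le_add_const; simp)+
  then show ?thesis using fin \<Gamma>_zero_nonneg by (cases "\<Gamma> f"; cases "\<Gamma> (\<lambda>_. 0)") auto
qed

text \<open>Reals strictly above \<open>\<Gamma> f\<close> and \<open>\<Gamma> g\<close> are
  eventually bounds for both terms at once, in the inner and in the outer limit, so convexity at the
  finite stage survives.\<close>

lemma \<Gamma>_convex:
  assumes fin: "\<Gamma> (\<lambda>_. 0) < \<infinity>" and f: "continuous_on UNIV f" and g: "continuous_on UNIV g"
    and t: "0 \<le> t" "t \<le> 1"
  shows "real_of_ereal (\<Gamma> (\<lambda>x. t * f x + (1 - t) * g x))
    \<le> t * real_of_ereal (\<Gamma> f) + (1 - t) * real_of_ereal (\<Gamma> g)"
proof (rule field_le_epsilon)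
  fix e :: real assume e: "0 < e"
  define A where "A = real_of_ereal (\<Gamma> f) + e"
  define B where "B = real_of_ereal (\<Gamma> g) + e"
  have AB: "\<Gamma> f < ereal A" "\<Gamma> g < ereal B"
    using \<Gamma>_finite[OF fin f] \<Gamma>_finite[OF fin g] e
    by (cases "\<Gamma> f"; cases "\<Gamma> g"; simp add: A_def B_def)+
  from \<Gamma>_less_eventually[OF AB(1)] \<Gamma>_less_eventually[OF AB(2)] b_convex
  have "\<forall>\<^sub>F i in \<Phi>. \<forall>\<^sub>F n in sequentially. b i n (\<lambda>x. t * f x + (1 - t) * g x) \<le> t * A + (1 - t) * B"
  proof eventually_elim
    case (elim i)
    from elim(1,2) show ?case
    proof eventually_elim
      case (elim n)
      have "b i n (\<lambda>x. t * f x + (1 - t) * g x) \<le> t * b i n f + (1 - t) * b i n g"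
        using \<open>\<forall>n f g t. _ n f g t\<close> f g t by blast
      also have "\<dots> \<le> t * A + (1 - t) * B" using elim t by (intro add_mono mult_left_mono) auto
      finally show ?case .
    qed
  qed
  then have "\<Gamma> (\<lambda>x. t * f x + (1 - t) * g x) \<le> ereal (t * A + (1 - t) * B)" by (rule \<Gamma>_le_real)
  moreover have "\<bar>\<Gamma> (\<lambda>x. t * f x + (1 - t) * g x)\<bar> \<noteq> \<infinity>"
    by (rule \<Gamma>_finite[OF fin]) (intro continuous_intros f g)
  ultimately have "real_of_ereal (\<Gamma> (\<lambda>x. t * f x + (1 - t) * g x)) \<le> t * A + (1 - t) * B"
    by (cases "\<Gamma> (\<lambda>x. t * f x + (1 - t) * g x)") auto
  then show "real_of_ereal (\<Gamma> (\<lambda>x. t * f x + (1 - t) * g x))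
    \<le> t * real_of_ereal (\<Gamma> f) + (1 - t) * real_of_ereal (\<Gamma> g) + e"
    by (simp add: A_def B_def algebra_simps)
qed

lemma Bcontfun_inverse_continuous:
  "continuous_on UNIV f \<Longrightarrow> apply_bcontfun (Bcontfun f) = (f :: 'x \<Rightarrow> real)"
  using compact_imp_bounded[OF compact_continuous_image[OF _ compact_UNIV]]
  by (intro Bcontfun_inverse) (auto simp: bcontfun_def)

text \<open>The vector space is that of bounded continuous functions, which by compactness are all
  the continuous ones. Positivity comes from monotonicity: for \<open>f\<close> non-negative,
  \<Gamma> at the negative of \<open>f\<close> is at most \<open>\<Gamma> 0\<close>, so the
  functional is at most 0 there.\<close>

lemma ex_supporting_functional:
  assumes fin: "\<Gamma> (\<lambda>_. 0) < \<infinity>"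
  obtains I where "positive_functional I"
    "\<And>f. continuous_on UNIV f \<Longrightarrow> I f \<le> real_of_ereal (\<Gamma> f) - real_of_ereal (\<Gamma> (\<lambda>_. 0))"
proof -
  define P where "P \<phi> = real_of_ereal (\<Gamma> (apply_bcontfun \<phi>)) - real_of_ereal (\<Gamma> (\<lambda>_. 0))" for \<phi> :: "'x \<Rightarrow>\<^sub>C real"
  have "\<exists>L. linear L \<and> (\<forall>\<phi>. L \<phi> \<le> P \<phi>)"
  proof (rule ex_linear_le_convex)
    fix u v :: "'x \<Rightarrow>\<^sub>C real" and t :: real assume t: "0 \<le> t" "t \<le> 1"
    have "apply_bcontfun (t *\<^sub>R u + (1 - t) *\<^sub>R v) = (\<lambda>x. t * apply_bcontfun u x + (1 - t) * apply_bcontfun v x)"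
      by auto
    then show "P (t *\<^sub>R u + (1 - t) *\<^sub>R v) \<le> t * P u + (1 - t) * P v"
      using \<Gamma>_convex[OF fin continuous_on_apply_bcontfun[of UNIV u] continuous_on_apply_bcontfun[of UNIV v] t]
      by (simp add: P_def algebra_simps)
  next
    have "apply_bcontfun (0 :: 'x \<Rightarrow>\<^sub>C real) = (\<lambda>_. 0)" by auto
    then show "P 0 = 0" by (simp add: P_def)
  qed
  then obtain L where L: "linear L" and LP: "\<And>\<phi>. L \<phi> \<le> P \<phi>" by blast
  define I where "I f = L (Bcontfun f)" for f
  note inv = Bcontfun_inverse_continuous
  have le: "I f \<le> real_of_ereal (\<Gamma> f) - real_of_ereal (\<Gamma> (\<lambda>_. 0))" if "continuous_on UNIV f" for f
    using LP[of "Bcontfun f"] inv[OF that] by (simp add: I_def P_def)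
  have scale: "I (\<lambda>x. c * f x) = c * I f" if f: "continuous_on UNIV f" for c f
  proof -
    have "Bcontfun (\<lambda>x. c * f x) = c *\<^sub>R Bcontfun f"
      by (rule bcontfun_eqI) (use f in \<open>simp add: inv continuous_intros\<close>)
    then show ?thesis using linear_scale[OF L] by (simp add: I_def)
  qed
  have "positive_functional I"
  proof
    show "compact (UNIV :: 'x set)" by (rule compact_UNIV)
    show "I (\<lambda>x. c * f x) = c * I f" if "continuous_on UNIV f" for c f by (rule scale[OF that])
    show "I (\<lambda>x. f x + g x) = I f + I g" if f: "continuous_on UNIV f" "continuous_on UNIV g" for f g
    proof -
      have "Bcontfun (\<lambda>x. f x + g x) = Bcontfun f + Bcontfun g"
        by (rule bcontfun_eqI) (use f in \<open>simp add: inv continuous_intros\<close>)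
      then show ?thesis using linear_add[OF L] by (simp add: I_def)
    qed
    show "0 \<le> I f" if f: "continuous_on UNIV f" and nn: "\<And>x. 0 \<le> f x" for f
    proof -
      let ?f = "\<lambda>x. (-1) * f x"
      have f': "continuous_on UNIV ?f" by (intro continuous_intros f)
      have "\<Gamma> ?f \<le> \<Gamma> (\<lambda>_. 0) + ereal 0" by (rule \<Gamma>_le_add_const[OF f']) (use nn in auto)
      then have "real_of_ereal (\<Gamma> ?f) \<le> real_of_ereal (\<Gamma> (\<lambda>_. 0))"
        using \<Gamma>_finite[OF fin f'] \<Gamma>_finite[OF fin, of "\<lambda>_. 0"]
        by (cases "\<Gamma> ?f"; cases "\<Gamma> (\<lambda>_. 0)") auto
      then show ?thesis using le[OF f'] scale[OF f, of "-1"] by simp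
    qed
  qed
  then show ?thesis using that le by blast
qed

theorem ex_invariant_measure:
  assumes fin: "\<Gamma> (\<lambda>_. 0) < \<infinity>"
  shows "\<exists>\<mu>\<in>invariant_measures G act. \<forall>f\<in>C_space. \<Gamma> (\<lambda>_. 0) \<le> \<Gamma> f - ereal (integral\<^sup>L \<mu> f)"
proof -
  obtain I where "positive_functional I"
    and le: "\<And>f. continuous_on UNIV f \<Longrightarrow> I f \<le> real_of_ereal (\<Gamma> f) - real_of_ereal (\<Gamma> (\<lambda>_. 0))"
    using ex_supporting_functional[OF fin] by blast
  then interpret I: positive_functional I by simp
  let ?\<mu> = I.repr_measure
  interpret finite_measure ?\<mu> by (rule I.finite_repr_measure)
  have const: "real_of_ereal (\<Gamma> (\<lambda>_. c)) - real_of_ereal (\<Gamma> (\<lambda>_. 0)) \<le> c" for c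
  proof -
    have "\<Gamma> (\<lambda>_. c) \<le> \<Gamma> (\<lambda>_. 0) + ereal c" by (rule \<Gamma>_le_add_const) auto
    then show ?thesis
      using \<Gamma>_finite[OF fin, of "\<lambda>_. c"] \<Gamma>_finite[OF fin, of "\<lambda>_. 0"]
      by (cases "\<Gamma> (\<lambda>_. c)"; cases "\<Gamma> (\<lambda>_. 0)") auto
  qed
  \<comment> \<open>Domination at the constants 1 and -1 bounds the mass from both sides.\<close>
  have "I (\<lambda>_. 1) = 1"
    using le[of "\<lambda>_. 1"] const[of 1] le[of "\<lambda>_. -1"] const[of "-1"] I.scale[of "\<lambda>_. 1" "-1"] by simp
  then have prob: "prob_space ?\<mu>"
    using I.measure_repr_UNIV by (intro prob_spaceI) (simp add: emeasure_eq_measure)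
  have inv: "distr ?\<mu> borel (act g) = ?\<mu>" if g: "g \<in> carrier G" for g
  proof (rule measure_eq_if_integrals_eq)
    have actg: "continuous_on UNIV (act g)" using sys g by (auto simp: G_system_def)
    then have meas: "act g \<in> borel_measurable ?\<mu>"
      using borel_measurable_continuous_onI measurable_cong_sets[OF I.sets_repr_measure refl] by blast
    then show "finite_measure (distr ?\<mu> borel (act g))" by (rule finite_measure_distr)
    have comp: "continuous_on UNIV (\<lambda>x. f (act g x))" if "continuous_on UNIV f" for f :: "'x \<Rightarrow> real"
      by (rule continuous_on_compose2[OF that actg]) simp
    have le0: "I (\<lambda>x. f (act g x)) \<le> I f" if f: "continuous_on UNIV f" for f
    proof -
      have c: "continuous_on UNIV (\<lambda>x. f (act g x) - f x)" by (intro continuous_intros f comp[OF f])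
      have "real_of_ereal (\<Gamma> (\<lambda>x. f (act g x) - f x)) \<le> real_of_ereal (\<Gamma> (\<lambda>_. 0))"
        using \<Gamma>_coboundary_le[OF f g] \<Gamma>_finite[OF fin c] \<Gamma>_finite[OF fin, of "\<lambda>_. 0"]
        by (cases "\<Gamma> (\<lambda>x. f (act g x) - f x)"; cases "\<Gamma> (\<lambda>_. 0)") auto
      then show ?thesis using le[OF c] I.diff[OF comp[OF f] f] by simp
    qed
    fix f :: "'x \<Rightarrow> real" assume f: "continuous_on UNIV f"
    \<comment> \<open>The coboundary bound is one-sided; for \<open>f\<close> and its negative
      together it is an equality.\<close>
    have "I (\<lambda>x. f (act g x)) = I f"
      using le0[OF f] le0[of "\<lambda>x. (-1) * f x"] I.scale[OF f, of "-1"] I.scale[OF comp[OF f], of "-1"] f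
      by (simp add: continuous_intros)
    moreover have "integral\<^sup>L (distr ?\<mu> borel (act g)) f = integral\<^sup>L ?\<mu> (\<lambda>x. f (act g x))"
      by (rule integral_distr[OF meas]) (rule borel_measurable_continuous_onI[OF f])
    ultimately show "integral\<^sup>L (distr ?\<mu> borel (act g)) f = integral\<^sup>L ?\<mu> f"
      using I.integral_repr_measure[OF f] I.integral_repr_measure[OF comp[OF f]] by simp
  qed (auto intro: I.finite_repr_measure)
  have "?\<mu> \<in> invariant_measures G act" using prob inv by (simp add: invariant_measures_def)
  moreover have "\<Gamma> (\<lambda>_. 0) \<le> \<Gamma> f - ereal (integral\<^sup>L ?\<mu> f)" if "f \<in> C_space" for f
  proof -
    have f: "continuous_on UNIV f" using that by (simp add: C_space_def)
    show ?thesis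
      using le[OF f] I.integral_repr_measure[OF f] \<Gamma>_finite[OF fin f] \<Gamma>_finite[OF fin, of "\<lambda>_. 0"]
      by (cases "\<Gamma> f"; cases "\<Gamma> (\<lambda>_. 0)") auto
  qed
  ultimately show ?thesis by blast
qed

end

section \<open>Mean dimension and metric mean dimension with potential\<close>

lemma bounded_continuous_compact:
  fixes f :: "'x::metric_space \<Rightarrow> real"
  assumes "compact (UNIV :: 'x set)" "continuous_on UNIV f"
  obtains B where "0 < B" "\<And>x. \<bar>f x\<bar> \<le> B"
  using compact_imp_bounded[OF compact_continuous_image[OF assms(2,1)]] by (auto simp: bounded_pos)

lemma birkhoff_sum_bounded:
  assumes "\<And>x. \<bar>f x\<bar> \<le> B"
  shows "birkhoff_sum act F f x \<le> real (card F) * B"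
  unfolding birkhoff_sum_def by (rule sum_bounded_above) (use assms abs_le_D1 in blast)

lemma birkhoff_sum_convex:
  "birkhoff_sum act F (\<lambda>x. t * f x + s * g x) x = t * birkhoff_sum act F f x + s * birkhoff_sum act F g x"
  by (simp add: birkhoff_sum_def sum.distrib sum_distrib_left)

text \<open>The suprema over optimal refinements and over points are merged into one real supremum
  over pairs. The index set is the same for every \<open>f\<close>, so monotonicity and convexity
  can be checked pair by pair.\<close>

definition cover_potential ::
  "('g \<Rightarrow> 'x::metric_space \<Rightarrow> 'x) \<Rightarrow> 'g set \<Rightarrow> 'x set set \<Rightarrow> ('x \<Rightarrow> real) \<Rightarrow> real" where
  "cover_potential act F \<U> f =
     (SUP p\<in>optimal_refinements act F \<U> \<times> UNIV. real_of_int (ord_at (fst p) (snd p)) + birkhoff_sum act F f (snd p))"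

definition normalised_cover_potential ::
  "('g \<Rightarrow> 'x::metric_space \<Rightarrow> 'x) \<Rightarrow> (nat \<Rightarrow> 'g set) \<Rightarrow> 'x set set \<Rightarrow> nat \<Rightarrow> ('x \<Rightarrow> real) \<Rightarrow> real" where
  "normalised_cover_potential act F \<U> n f = cover_potential act (F n) \<U> f / real (card (F n))"

section \<open>Mean dimension with potential over a fixed finite set\<close>

context
  fixes act :: "'g \<Rightarrow> 'x::metric_space \<Rightarrow> 'x" and F :: "'g set" and \<U> :: "'x set set"
  assumes X: "compact (UNIV :: 'x set)" and F: "finite F"
    and cont: "\<forall>g\<in>F. continuous_on UNIV (act g)" and U: "\<U> \<in> open_covers"
begin

lemma optimal_refinements_nonempty: "optimal_refinements act F \<U> \<noteq> {}"
  using ex_optimal[OF join_cover_open_covers[OF F cont U]]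
  by (auto simp: optimal_refinements_def)

lemma cover_potential_bdd:
  assumes "continuous_on UNIV f"
  shows "bdd_above ((\<lambda>p. real_of_int (ord_at (fst p) (snd p)) + birkhoff_sum act F f (snd p)) `
    (optimal_refinements act F \<U> \<times> UNIV))"
proof -
  obtain B where B: "\<And>x. \<bar>f x\<bar> \<le> B" using bounded_continuous_compact[OF X assms] by blast
  show ?thesis
  proof (rule bdd_aboveI2)
    fix p assume p: "p \<in> optimal_refinements act F \<U> \<times> (UNIV :: 'x set)"
    then have "ord_at (fst p) (snd p) \<le> cover_D (join_cover act F \<U>)"
      using ord_at_le_cover_ord[of "fst p" "snd p"] open_coversD(1)[of "fst p"]
      by (auto simp: optimal_refinements_def)
    then show "real_of_int (ord_at (fst p) (snd p)) + birkhoff_sum act F f (snd p)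
        \<le> real_of_int (cover_D (join_cover act F \<U>)) + real (card F) * B"
      by (intro add_mono birkhoff_sum_bounded B) simp
  qed
qed

lemma cover_potential_upper:
  assumes "continuous_on UNIV f" "\<V> \<in> optimal_refinements act F \<U>"
  shows "real_of_int (ord_at \<V> x) + birkhoff_sum act F f x \<le> cover_potential act F \<U> f"
  using cSUP_upper[OF _ cover_potential_bdd[OF assms(1)], of "(\<V>, x)"] assms(2)
  by (simp add: cover_potential_def)

lemma cover_potential_least:
  assumes "\<And>\<V> x. \<V> \<in> optimal_refinements act F \<U> \<Longrightarrow> real_of_int (ord_at \<V> x) + birkhoff_sum act F f x \<le> c"
  shows "cover_potential act F \<U> f \<le> c"
  unfolding cover_potential_def
  by (rule cSUP_least) (use optimal_refinements_nonempty assms in auto)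

lemma cover_potential_mono:
  assumes "continuous_on UNIV g" and le: "\<And>x. birkhoff_sum act F f x \<le> birkhoff_sum act F g x + K"
  shows "cover_potential act F \<U> f \<le> cover_potential act F \<U> g + K"
proof (rule cover_potential_least)
  fix \<V> x assume "\<V> \<in> optimal_refinements act F \<U>"
  from cover_potential_upper[OF assms(1) this, of x] le[of x]
  show "real_of_int (ord_at \<V> x) + birkhoff_sum act F f x \<le> cover_potential act F \<U> g + K" by linarith
qed

text \<open>A supremum of functions affine in \<open>f\<close> is convex: the local order enters the
  two terms with total weight 1.\<close>

lemma cover_potential_convex:
  assumes "continuous_on UNIV f" "continuous_on UNIV g" and t: "0 \<le> t" "t \<le> 1"
  shows "cover_potential act F \<U> (\<lambda>x. t * f x + (1 - t) * g x)
    \<le> t * cover_potential act F \<U> f + (1 - t) * cover_potential act F \<U> g"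
proof (rule cover_potential_least)
  fix \<V> x assume V: "\<V> \<in> optimal_refinements act F \<U>"
  let ?o = "real_of_int (ord_at \<V> x)"
  have "?o + birkhoff_sum act F (\<lambda>x. t * f x + (1 - t) * g x) x
      = t * (?o + birkhoff_sum act F f x) + (1 - t) * (?o + birkhoff_sum act F g x)"
    unfolding birkhoff_sum_convex by (simp add: algebra_simps)
  also have "\<dots> \<le> t * cover_potential act F \<U> f + (1 - t) * cover_potential act F \<U> g"
    using t by (intro add_mono mult_left_mono cover_potential_upper assms V) auto
  finally show "?o + birkhoff_sum act F (\<lambda>x. t * f x + (1 - t) * g x) x
    \<le> t * cover_potential act F \<U> f + (1 - t) * cover_potential act F \<U> g" .
qed

lemma cover_potential_zero: "cover_potential act F \<U> (\<lambda>_. 0) = real_of_int (cover_D (join_cover act F \<U>))"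
proof (rule antisym)
  show "cover_potential act F \<U> (\<lambda>_. 0) \<le> real_of_int (cover_D (join_cover act F \<U>))"
  proof (rule cover_potential_least)
    fix \<V> x assume "\<V> \<in> optimal_refinements act F \<U>"
    then show "real_of_int (ord_at \<V> x) + birkhoff_sum act F (\<lambda>_. 0) x \<le> real_of_int (cover_D (join_cover act F \<U>))"
      using ord_at_le_cover_ord[of \<V> x] open_coversD(1)[of \<V>]
      by (auto simp: optimal_refinements_def birkhoff_sum_def)
  qed
  obtain \<V> where V: "\<V> \<in> optimal_refinements act F \<U>" using optimal_refinements_nonempty by blast
  then have fin: "finite \<V>" and ord: "cover_ord \<V> = cover_D (join_cover act F \<U>)"
    using open_coversD(1)[of \<V>] by (auto simp: optimal_refinements_def)
  \<comment> \<open>Orders are integers, so taking the floor allows \<open>cover_ord_le_iff\<close>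
    to be used against a real supremum.\<close>
  have "ord_at \<V> x \<le> \<lfloor>cover_potential act F \<U> (\<lambda>_. 0)\<rfloor>" for x
    using cover_potential_upper[OF _ V, of "\<lambda>_. 0" x] by (simp add: birkhoff_sum_def le_floor_iff)
  then have "cover_ord \<V> \<le> \<lfloor>cover_potential act F \<U> (\<lambda>_. 0)\<rfloor>"
    by (simp add: cover_ord_le_iff[OF fin])
  then show "real_of_int (cover_D (join_cover act F \<U>)) \<le> cover_potential act F \<U> (\<lambda>_. 0)"
    unfolding ord le_floor_iff .
qed

text \<open>Boundedness makes the nested extended suprema finite from above, and non-emptiness of
  the optimal refinements excludes \<open>- \<infinity>\<close>, so both agree with the real
  supremum.\<close>

lemma SUP_cover_D_pot:
  assumes "continuous_on UNIV f"
  shows "(SUP \<V>\<in>optimal_refinements act F \<U>. cover_D_pot (birkhoff_sum act F f) \<V>) = ereal (cover_potential act F \<U> f)"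
proof (rule antisym)
  show "(SUP \<V>\<in>optimal_refinements act F \<U>. cover_D_pot (birkhoff_sum act F f) \<V>) \<le> ereal (cover_potential act F \<U> f)"
    unfolding cover_D_pot_def using cover_potential_upper[OF assms] by (intro SUP_least) auto
  let ?S = "SUP \<V>\<in>optimal_refinements act F \<U>. cover_D_pot (birkhoff_sum act F f) \<V>"
  have up: "ereal (real_of_int (ord_at \<V> x) + birkhoff_sum act F f x) \<le> ?S"
    if "\<V> \<in> optimal_refinements act F \<U>" for \<V> x
    unfolding cover_D_pot_def by (rule SUP_upper2[OF that]) (rule SUP_upper, simp)
  show "ereal (cover_potential act F \<U> f) \<le> ?S"
  proof (cases ?S)
    case (real r)
    have "cover_potential act F \<U> f \<le> r"
      by (rule cover_potential_least) (use up real in auto)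
    then show ?thesis using real by simp
  next
    case MInf
    then show ?thesis using optimal_refinements_nonempty up by fastforce
  qed simp
qed

end

lemma folner_seqD:
  assumes "folner_seq G F"
  shows "finite (F n)" "F n \<noteq> {}" "F n \<subseteq> carrier G" "0 < real (card (F n))"
  using assms by (auto simp: folner_seq_def card_gt_0_iff)

lemma Limsup_principal_eq_SUP: "Limsup (principal A) f = (SUP x\<in>A. f x)"
  unfolding Limsup_def eventually_principal
  by (rule antisym) (auto intro!: INF_lower2[of "\<lambda>x. x \<in> A"] INF_greatest SUP_subset_mono)

lemma limsup_potential_cover:
  fixes act :: "'g \<Rightarrow> 'x::metric_space \<Rightarrow> 'x"
  assumes G: "monoid_cancel G" and X: "compact (UNIV :: 'x set)" and sys: "G_system G act"
    and F: "folner_seq G F"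
  shows "limsup_potential G act F (principal open_covers) (normalised_cover_potential act F)"
proof -
  note Fn = folner_seqD[OF F]
  have cont: "\<forall>g\<in>F n. continuous_on UNIV (act g)" for n
    using sys Fn(3)[of n] by (auto simp: G_system_def)
  note c = X Fn(1) cont
  have "{UNIV :: 'x set} \<in> open_covers" by (simp add: open_covers_def)
  then have nb: "principal (open_covers :: 'x set set set) \<noteq> bot" by (auto simp: principal_eq_bot_iff)
  show ?thesis
  proof (intro limsup_potential.intro G sys X F nb; unfold eventually_principal; intro ballI allI impI)
    fix \<U> :: "'x set set" and n and f g :: "'x \<Rightarrow> real" and K
    assume U: "\<U> \<in> open_covers" and fg: "continuous_on UNIV f" "continuous_on UNIV g"
      and le: "\<forall>x. birkhoff_sum act (F n) f x \<le> birkhoff_sum act (F n) g x + K"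
    have "cover_potential act (F n) \<U> f \<le> cover_potential act (F n) \<U> g + K"
      using cover_potential_mono[OF c U fg(2)] le by blast
    then show "normalised_cover_potential act F \<U> n f \<le> normalised_cover_potential act F \<U> n g + K / real (card (F n))"
      unfolding normalised_cover_potential_def add_divide_distrib[symmetric]
      by (rule divide_right_mono) simp
  next
    fix \<U> :: "'x set set" and n and f g :: "'x \<Rightarrow> real" and t :: real
    assume U: "\<U> \<in> open_covers" and fg: "continuous_on UNIV f" "continuous_on UNIV g" and t: "0 \<le> t" "t \<le> 1"
    show "normalised_cover_potential act F \<U> n (\<lambda>x. t * f x + (1 - t) * g x)
        \<le> t * normalised_cover_potential act F \<U> n f + (1 - t) * normalised_cover_potential act F \<U> n g"
      unfolding normalised_cover_potential_def times_divide_eq_right add_divide_distrib[symmetric]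
      by (intro divide_right_mono cover_potential_convex[OF c U fg t]) simp
  next
    fix \<U> :: "'x set set" and n
    assume U: "\<U> \<in> open_covers"
    show "0 \<le> normalised_cover_potential act F \<U> n (\<lambda>_. 0)"
      unfolding normalised_cover_potential_def cover_potential_zero[OF c U]
      using cover_D_nonneg[OF join_cover_open_covers[OF Fn(1) cont U]] by simp
  qed
qed

lemma mdim_pot_eq_Limsup:
  fixes act :: "'g \<Rightarrow> 'x::metric_space \<Rightarrow> 'x"
  assumes X: "compact (UNIV :: 'x set)" and sys: "G_system G act"
    and F: "folner_seq G F" and f: "continuous_on UNIV f"
  shows "mdim_pot act F f =
    Limsup (principal open_covers) (\<lambda>\<U>. limsup (\<lambda>n. ereal (normalised_cover_potential act F \<U> n f)))"
  unfolding mdim_pot_def Limsup_principal_eq_SUP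
proof (rule SUP_cong[OF refl])
  note Fn = folner_seqD[OF F]
  have cont: "\<forall>g\<in>F n. continuous_on UNIV (act g)" for n
    using sys Fn(3)[of n] by (auto simp: G_system_def)
  fix \<U> :: "'x set set" assume U: "\<U> \<in> open_covers"
  show "mdim_pot_cover act F f \<U> = limsup (\<lambda>n. ereal (normalised_cover_potential act F \<U> n f))"
    unfolding mdim_pot_cover_def SUP_cover_D_pot[OF X Fn(1) cont U f] normalised_cover_potential_def by simp
qed

text \<open>For the zero potential the upper limit is a limit with a value common to all Folner
  sequences; this is where the Ornstein-Weiss lemma enters.\<close>

lemma mdim_pot_zero:
  fixes act :: "'g \<Rightarrow> 'x::metric_space \<Rightarrow> 'x"
  assumes G: "monoid_cancel G" and X: "compact (UNIV :: 'x set)" and sys: "G_system G act"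
    and F: "folner_seq G F"
  shows "mdim_pot act F (\<lambda>_. 0) = mdim G act"
  unfolding mdim_pot_eq_Limsup[OF X sys F continuous_on_const] Limsup_principal_eq_SUP mdim_def
proof (rule SUP_cong[OF refl])
  note Fn = folner_seqD[OF F]
  have cont: "\<forall>g\<in>F n. continuous_on UNIV (act g)" for n
    using sys Fn(3)[of n] by (auto simp: G_system_def)
  fix \<U> :: "'x set set" assume U: "\<U> \<in> open_covers"
  have "(\<lambda>n. ereal (normalised_cover_potential act F \<U> n (\<lambda>_. 0))) \<longlonglongrightarrow> ereal (mdim_cover G act \<U>)"
    unfolding normalised_cover_potential_def cover_potential_zero[OF X Fn(1) cont U] lim_ereal
    by (rule mdim_cover_limit[OF G sys U F])
  then show "limsup (\<lambda>n. ereal (normalised_cover_potential act F \<U> n (\<lambda>_. 0))) = ereal (mdim_cover G act \<U>)"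
    by (intro lim_imp_Limsup) simp
qed

section \<open>Separated sets and metric mean dimension with potential\<close>

lemma separated_sets_card_bound:
  fixes act :: "'g \<Rightarrow> 'x::metric_space \<Rightarrow> 'x"
  assumes X: "compact (UNIV :: 'x set)" and F: "finite F" "F \<noteq> {}"
    and cont: "\<forall>g\<in>F. continuous_on UNIV (act g)" and e: "0 < \<epsilon>"
  obtains N where "\<And>E. E \<in> separated_sets act F \<epsilon> \<Longrightarrow> finite E \<and> card E \<le> N"
proof -
  \<comment> \<open>Open dynamical balls of radius half of \<epsilon>: finitely many cover the
    space, and each contains at most one point of a separated set.\<close>
  define V where "V x = (\<Inter>g\<in>F. act g -` ball (act g x) (\<epsilon> / 2))" for x
  have op: "open (V x)" for x
    unfolding V_def using F cont by (intro open_INT ballI open_vimage) auto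
  have "x \<in> V x" for x using e by (simp add: V_def)
  then have cov: "UNIV \<subseteq> (\<Union>x\<in>UNIV. V x)" by blast
  obtain C where C: "finite C" "UNIV \<subseteq> (\<Union>x\<in>C. V x)"
    by (rule compactE_image[OF X op cov])
  have "finite E \<and> card E \<le> card C" if E: "E \<in> separated_sets act F \<epsilon>" for E
  proof -
    have "\<forall>x. \<exists>c\<in>C. x \<in> V c" using C by auto
    then obtain c where c: "\<And>x. c x \<in> C" "\<And>x. x \<in> V (c x)" by metis
    have "inj_on c E"
    proof (rule inj_onI, rule ccontr)
      fix x y assume xy: "x \<in> E" "y \<in> E" "c x = c y" "x \<noteq> y"
      then have "\<epsilon> < dyn_dist act F x y" using E by (auto simp: separated_sets_def)
      moreover have "dyn_dist act F x y \<le> \<epsilon>"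
        unfolding dyn_dist_def
      proof (subst Max_le_iff)
        show "\<forall>a\<in>(\<lambda>g. dist (act g x) (act g y)) ` F. a \<le> \<epsilon>"
        proof
          fix a assume "a \<in> (\<lambda>g. dist (act g x) (act g y)) ` F"
          then obtain g where g: "g \<in> F" "a = dist (act g x) (act g y)" by auto
          have "dist (act g (c x)) (act g x) < \<epsilon> / 2" "dist (act g (c x)) (act g y) < \<epsilon> / 2"
            using c(2)[of x] c(2)[of y] g(1) xy(3) by (auto simp: V_def)
          then show "a \<le> \<epsilon>" using dist_triangle_half_r[of "act g (c x)" "act g x" \<epsilon> "act g y"] g by simp
        qed
      qed (use F in auto)
      ultimately show False by simp
    qed
    moreover have "c ` E \<subseteq> C" using c by auto
    ultimately show ?thesis using C by (meson card_inj_on_le finite_imageD finite_subset)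
  qed
  then show ?thesis using that by blast
qed

context
  fixes act :: "'g \<Rightarrow> 'x::metric_space \<Rightarrow> 'x" and F :: "'g set" and \<epsilon> :: real
  assumes X: "compact (UNIV :: 'x set)" and F: "finite F" "F \<noteq> {}"
    and cont: "\<forall>g\<in>F. continuous_on UNIV (act g)" and e: "0 < \<epsilon>"
begin

lemma sep_pressure_upper:
  assumes f: "continuous_on UNIV f" and E: "E \<in> separated_sets act F \<epsilon>"
  shows "(\<Sum>x\<in>E. exp (birkhoff_sum act F f x)) \<le> sep_pressure act F f \<epsilon>"
  unfolding sep_pressure_def
proof (rule cSUP_upper[OF E])
  obtain B where B: "\<And>x. \<bar>f x\<bar> \<le> B" using bounded_continuous_compact[OF X f] by blast
  obtain N where N: "\<And>E. E \<in> separated_sets act F \<epsilon> \<Longrightarrow> finite E \<and> card E \<le> N"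
    using separated_sets_card_bound[OF X F cont e] by blast
  show "bdd_above ((\<lambda>E. \<Sum>x\<in>E. exp (birkhoff_sum act F f x)) ` separated_sets act F \<epsilon>)"
  proof (rule bdd_aboveI2)
    fix E assume "E \<in> separated_sets act F \<epsilon>"
    from N[OF this] have "real (card E) \<le> real N" by simp
    have "(\<Sum>x\<in>E. exp (birkhoff_sum act F f x)) \<le> real (card E) * exp (real (card F) * B)"
      by (rule sum_bounded_above) (simp add: birkhoff_sum_bounded[OF B])
    also have "\<dots> \<le> real N * exp (real (card F) * B)"
      using \<open>real (card E) \<le> real N\<close> by (rule mult_right_mono) simp
    finally show "(\<Sum>x\<in>E. exp (birkhoff_sum act F f x)) \<le> real N * exp (real (card F) * B)" .
  qed
qed

lemma sep_pressure_least:
  assumes "\<And>E. E \<in> separated_sets act F \<epsilon> \<Longrightarrow> (\<Sum>x\<in>E. exp (birkhoff_sum act F f x)) \<le> c"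
  shows "sep_pressure act F f \<epsilon> \<le> c"
proof -
  have "{} \<in> separated_sets act F \<epsilon>" by (simp add: separated_sets_def)
  then show ?thesis unfolding sep_pressure_def using assms by (intro cSUP_least) auto
qed

text \<open>A singleton is vacuously separated, which keeps the supremum positive and its logarithm
  meaningful.\<close>

lemma exp_le_sep_pressure:
  assumes "continuous_on UNIV f"
  shows "exp (birkhoff_sum act F f x) \<le> sep_pressure act F f \<epsilon>"
  using sep_pressure_upper[OF assms, of "{x}"] by (simp add: separated_sets_def)

lemma sep_pressure_pos: "continuous_on UNIV f \<Longrightarrow> 0 < sep_pressure act F f \<epsilon>"
  by (rule less_le_trans[OF exp_gt_zero exp_le_sep_pressure])

lemma ln_sep_pressure_mono:
  assumes f: "continuous_on UNIV f" and g: "continuous_on UNIV g"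
    and le: "\<And>x. birkhoff_sum act F f x \<le> birkhoff_sum act F g x + K"
  shows "ln (sep_pressure act F f \<epsilon>) \<le> ln (sep_pressure act F g \<epsilon>) + K"
proof -
  have "sep_pressure act F f \<epsilon> \<le> sep_pressure act F g \<epsilon> * exp K"
  proof (rule sep_pressure_least)
    fix E assume E: "E \<in> separated_sets act F \<epsilon>"
    have "(\<Sum>x\<in>E. exp (birkhoff_sum act F f x)) \<le> (\<Sum>x\<in>E. exp (birkhoff_sum act F g x)) * exp K"
      unfolding sum_distrib_right exp_add[symmetric] by (intro sum_mono) (simp add: le)
    also have "\<dots> \<le> sep_pressure act F g \<epsilon> * exp K"
      by (intro mult_right_mono sep_pressure_upper g E) simp
    finally show "(\<Sum>x\<in>E. exp (birkhoff_sum act F f x)) \<le> sep_pressure act F g \<epsilon> * exp K" .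
  qed
  then have "ln (sep_pressure act F f \<epsilon>) \<le> ln (sep_pressure act F g \<epsilon> * exp K)"
    using sep_pressure_pos[OF f] by simp
  also have "\<dots> = ln (sep_pressure act F g \<epsilon>) + K"
    using sep_pressure_pos[OF g] by (simp add: ln_mult)
  finally show ?thesis .
qed

text \<open>Normalising both partition functions to one turns the convexity of \<open>exp\<close> into the
  Hoelder inequality.\<close>

lemma ln_sep_pressure_convex:
  assumes f: "continuous_on UNIV f" and g: "continuous_on UNIV g" and t: "0 \<le> t" "t \<le> 1"
  shows "ln (sep_pressure act F (\<lambda>x. t * f x + (1 - t) * g x) \<epsilon>)
    \<le> t * ln (sep_pressure act F f \<epsilon>) + (1 - t) * ln (sep_pressure act F g \<epsilon>)"
proof -
  let ?h = "\<lambda>x. t * f x + (1 - t) * g x"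
  define a where "a = ln (sep_pressure act F f \<epsilon>)"
  define b where "b = ln (sep_pressure act F g \<epsilon>)"
  define c where "c = t * a + (1 - t) * b"
  have norm: "(\<Sum>x\<in>E. exp (birkhoff_sum act F f x - a)) \<le> 1" "(\<Sum>x\<in>E. exp (birkhoff_sum act F g x - b)) \<le> 1"
    if E: "E \<in> separated_sets act F \<epsilon>" for E
    using sep_pressure_upper[OF f E] sep_pressure_upper[OF g E] sep_pressure_pos[OF f] sep_pressure_pos[OF g]
    by (simp_all add: a_def b_def exp_diff sum_divide_distrib[symmetric])
  have "sep_pressure act F ?h \<epsilon> \<le> exp c"
  proof (rule sep_pressure_least)
    fix E assume E: "E \<in> separated_sets act F \<epsilon>"
    \<comment> \<open>The choice of \<open>c\<close> makes the shifted exponent the same convex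
      combination of the two shifted exponents.\<close>
    have conv: "exp (birkhoff_sum act F ?h x - c)
        \<le> t * exp (birkhoff_sum act F f x - a) + (1 - t) * exp (birkhoff_sum act F g x - b)" for x
    proof -
      have "birkhoff_sum act F ?h x - c = (1 - t) * (birkhoff_sum act F g x - b) + t * (birkhoff_sum act F f x - a)"
        unfolding birkhoff_sum_convex c_def by (simp add: algebra_simps)
      then show ?thesis
        using convex_onD[OF exp_convex, of t "birkhoff_sum act F g x - b" "birkhoff_sum act F f x - a"] t by simp
    qed
    have "(\<Sum>x\<in>E. exp (birkhoff_sum act F ?h x)) = exp c * (\<Sum>x\<in>E. exp (birkhoff_sum act F ?h x - c))"
      by (simp add: sum_distrib_left exp_diff)
    also have "\<dots> \<le> exp c * (\<Sum>x\<in>E. t * exp (birkhoff_sum act F f x - a) + (1 - t) * exp (birkhoff_sum act F g x - b))"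
      by (intro mult_left_mono sum_mono conv) simp
    also have "\<dots> = exp c * (t * (\<Sum>x\<in>E. exp (birkhoff_sum act F f x - a)) + (1 - t) * (\<Sum>x\<in>E. exp (birkhoff_sum act F g x - b)))"
      by (simp add: sum.distrib sum_distrib_left)
    also have "\<dots> \<le> exp c * (t * 1 + (1 - t) * 1)"
      using t norm[OF E] by (intro mult_left_mono add_mono) auto
    finally show "(\<Sum>x\<in>E. exp (birkhoff_sum act F ?h x)) \<le> exp c" by simp
  qed
  moreover have "0 < sep_pressure act F ?h \<epsilon>"
    by (rule sep_pressure_pos) (intro continuous_intros f g)
  ultimately have "ln (sep_pressure act F ?h \<epsilon>) \<le> c" using ln_le_cancel_iff[of _ "exp c"] by fastforce
  then show ?thesis by (simp add: a_def b_def c_def)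
qed

end

text \<open>The potential carries the factor \<open>ln (1 / \<epsilon>)\<close> and the logarithm is
  divided by it, so a constant \<open>K\<close> in the Birkhoff sum contributes
  \<open>K / card (F n)\<close> at every scale, as \<open>limsup_potential\<close> demands.\<close>

definition normalised_sep_pressure ::
  "('g \<Rightarrow> 'x::metric_space \<Rightarrow> 'x) \<Rightarrow> (nat \<Rightarrow> 'g set) \<Rightarrow> real \<Rightarrow> nat \<Rightarrow> ('x \<Rightarrow> real) \<Rightarrow> real" where
  "normalised_sep_pressure act F \<epsilon> n f =
     (1 / ln (1 / \<epsilon>)) * (1 / real (card (F n)) * ln (sep_pressure act (F n) (\<lambda>x. f x * ln (1 / \<epsilon>)) \<epsilon>))"

text \<open>For such \<epsilon> the factor \<open>ln (1 / \<epsilon>)\<close> is positive and can be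
  moved through inequalities and upper limits.\<close>

lemma eventually_at_right_0_unit: "\<forall>\<^sub>F \<epsilon> in at_right (0::real). 0 < \<epsilon> \<and> \<epsilon> < 1"
  by (auto simp: eventually_at_right[of 0 1] intro!: exI[of _ 1])

lemma mmdim_pot_eq_Limsup:
  "mmdim_pot act F f = Limsup (at_right 0) (\<lambda>\<epsilon>. limsup (\<lambda>n. ereal (normalised_sep_pressure act F \<epsilon> n f)))"
  unfolding mmdim_pot_def
proof (rule Limsup_eq, rule eventually_mono[OF eventually_at_right_0_unit])
  fix \<epsilon> :: real assume e: "0 < \<epsilon> \<and> \<epsilon> < 1"
  then show "ereal (1 / ln (1 / \<epsilon>)) *
       limsup (\<lambda>n. ereal (1 / real (card (F n)) * ln (sep_pressure act (F n) (\<lambda>x. f x * ln (1 / \<epsilon>)) \<epsilon>)))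
    = limsup (\<lambda>n. ereal (normalised_sep_pressure act F \<epsilon> n f))"
    unfolding normalised_sep_pressure_def times_ereal.simps(1)[symmetric, of "1 / ln (1 / \<epsilon>)"]
    by (subst Limsup_ereal_mult_left) auto
qed

lemma limsup_potential_sep_pressure:
  fixes act :: "'g \<Rightarrow> 'x::metric_space \<Rightarrow> 'x"
  assumes G: "monoid_cancel G" and X: "compact (UNIV :: 'x set)" and sys: "G_system G act"
    and F: "folner_seq G F"
  shows "limsup_potential G act F (at_right 0) (normalised_sep_pressure act F)"
proof -
  note Fn = folner_seqD[OF F]
  have cont: "\<forall>g\<in>F n. continuous_on UNIV (act g)" for n
    using sys Fn(3)[of n] by (auto simp: G_system_def)
  note c = X Fn(1,2) cont
  have lin: "birkhoff_sum act (F n) (\<lambda>x. f x * l) x = birkhoff_sum act (F n) f x * l" for n f l x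
    by (simp add: birkhoff_sum_def sum_distrib_right)
  show ?thesis
  proof (intro limsup_potential.intro G sys X F trivial_limit_at_right_real;
      rule eventually_mono[OF eventually_at_right_0_unit]; intro allI impI)
    fix \<epsilon> :: real and n and f g :: "'x \<Rightarrow> real" and K :: real
    assume e: "0 < \<epsilon> \<and> \<epsilon> < 1" and fg: "continuous_on UNIV f" "continuous_on UNIV g"
      and le: "\<forall>x. birkhoff_sum act (F n) f x \<le> birkhoff_sum act (F n) g x + K"
    define l where "l = ln (1 / \<epsilon>)"
    have l: "0 < l" using e by (simp add: l_def)
    have "ln (sep_pressure act (F n) (\<lambda>x. f x * l) \<epsilon>) \<le> ln (sep_pressure act (F n) (\<lambda>x. g x * l) \<epsilon>) + K * l"
    proof (rule ln_sep_pressure_mono[OF c])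
      show "birkhoff_sum act (F n) (\<lambda>x. f x * l) x \<le> birkhoff_sum act (F n) (\<lambda>x. g x * l) x + K * l" for x
        unfolding lin distrib_right[symmetric] using le l by (intro mult_right_mono) auto
    qed (use e fg in \<open>auto intro!: continuous_intros\<close>)
    then have "(1 / l) * (1 / real (card (F n)) * ln (sep_pressure act (F n) (\<lambda>x. f x * l) \<epsilon>))
        \<le> (1 / l) * (1 / real (card (F n)) * (ln (sep_pressure act (F n) (\<lambda>x. g x * l) \<epsilon>) + K * l))"
      using l by (intro mult_left_mono) auto
    also have "\<dots> = (1 / l) * (1 / real (card (F n)) * ln (sep_pressure act (F n) (\<lambda>x. g x * l) \<epsilon>)) + K / real (card (F n))"
      unfolding distrib_left using l by simp
    finally show "normalised_sep_pressure act F \<epsilon> n f \<le> normalised_sep_pressure act F \<epsilon> n g + K / real (card (F n))"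
      unfolding normalised_sep_pressure_def l_def .
  next
    fix \<epsilon> :: real and n and f g :: "'x \<Rightarrow> real" and t :: real
    assume e: "0 < \<epsilon> \<and> \<epsilon> < 1" and fg: "continuous_on UNIV f" "continuous_on UNIV g" and t: "0 \<le> t" "t \<le> 1"
    define l where "l = ln (1 / \<epsilon>)"
    have l: "0 < l" using e by (simp add: l_def)
    let ?p = "\<lambda>f. ln (sep_pressure act (F n) (\<lambda>x. f x * l) \<epsilon>)"
    have "?p (\<lambda>x. t * f x + (1 - t) * g x) \<le> t * ?p f + (1 - t) * ?p g"
      using ln_sep_pressure_convex[OF c, of \<epsilon> "\<lambda>x. f x * l" "\<lambda>x. g x * l" t] e fg t
      by (simp add: continuous_intros algebra_simps)
    then have "(1 / l) * (1 / real (card (F n)) * ?p (\<lambda>x. t * f x + (1 - t) * g x))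
        \<le> (1 / l) * (1 / real (card (F n)) * (t * ?p f + (1 - t) * ?p g))"
      using l by (intro mult_left_mono) auto
    also have "\<dots> = t * ((1 / l) * (1 / real (card (F n)) * ?p f)) + (1 - t) * ((1 / l) * (1 / real (card (F n)) * ?p g))"
      by (simp only: distrib_left mult.left_commute)
    finally show "normalised_sep_pressure act F \<epsilon> n (\<lambda>x. t * f x + (1 - t) * g x)
        \<le> t * normalised_sep_pressure act F \<epsilon> n f + (1 - t) * normalised_sep_pressure act F \<epsilon> n g"
      unfolding normalised_sep_pressure_def l_def .
  next
    fix \<epsilon> :: real and n
    assume e: "0 < \<epsilon> \<and> \<epsilon> < 1"
    have "exp (birkhoff_sum act (F n) (\<lambda>_. 0) undefined) \<le> sep_pressure act (F n) (\<lambda>_. 0) \<epsilon>"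
      by (rule exp_le_sep_pressure[OF c]) (use e in auto)
    then have "1 \<le> sep_pressure act (F n) (\<lambda>_. 0) \<epsilon>" by (simp add: birkhoff_sum_def)
    then show "0 \<le> normalised_sep_pressure act F \<epsilon> n (\<lambda>_. 0)"
      using e by (simp add: normalised_sep_pressure_def)
  qed
qed

section \<open>Cancellation in the acting semigroups and the variational principle\<close>

lemma monoid_cancel_of_iso_Zplus:
  assumes G: "monoid G" and iso: "G \<cong> Zplus k"
  shows "monoid_cancel G"
proof -
  obtain h where h: "h \<in> hom G (Zplus k)" and inj: "inj_on h (carrier G)"
    using iso by (auto simp: is_iso_def iso_def bij_betw_def)
  \<comment> \<open>Both cancellation laws are inherited from the integers, coordinate by
    coordinate, through the injective map \<open>h\<close>.\<close>
  have hm: "h (a \<otimes>\<^bsub>G\<^esub> b) = (\<lambda>i. h a i + h b i)" if "a \<in> carrier G" "b \<in> carrier G" for a b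
    using hom_mult[OF h that] by (simp add: Zplus_def)
  show ?thesis
  proof (intro monoid_cancel.intro monoid_cancel_axioms.intro G)
    fix a b c assume c: "c \<in> carrier G" and a: "a \<in> carrier G" and b: "b \<in> carrier G"
    show "a = b" if "c \<otimes>\<^bsub>G\<^esub> a = c \<otimes>\<^bsub>G\<^esub> b"
      using arg_cong[OF that, of h] hm[OF c a] hm[OF c b] inj_onD[OF inj _ a b] by (simp add: fun_eq_iff)
    show "a = b" if "a \<otimes>\<^bsub>G\<^esub> c = b \<otimes>\<^bsub>G\<^esub> c"
      using arg_cong[OF that, of h] hm[OF a c] hm[OF b c] inj_onD[OF inj _ a b] by (simp add: fun_eq_iff)
  qed
qed

lemma monoid_cancel_of_group:
  assumes "group G"
  shows "monoid_cancel G"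
proof -
  interpret group G by fact
  show ?thesis by unfold_locales auto
qed

text \<open>The zero potential is a competitor; this is the easy half of the variational principle,
  valid for every measure.\<close>

lemma INF_potential_le:
  fixes P :: "('x::metric_space \<Rightarrow> real) \<Rightarrow> ereal"
  shows "(INF f\<in>C_space. P f - ereal (integral\<^sup>L \<mu> f)) \<le> P (\<lambda>_. 0)"
  by (rule INF_lower2[of "\<lambda>_. 0"]) (auto simp: C_space_def zero_ereal_def[symmetric])

text \<open>A maximum is rendered as attainment together with the upper bound. Since
  \<open>mmdim\<close> takes a Folner sequence as an argument, the second part is asserted along
  each one, with finiteness along that same sequence.\<close>

theorem theoremB:
  fixes G :: "('g, 'm) monoid_scheme"
    and act :: "'g \<Rightarrow> 'x::metric_space \<Rightarrow> 'x"
  assumes G: "(monoid G \<and> (\<exists>k\<ge>1. G \<cong> Zplus k)) \<or>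
              (countable_amenable_group G \<and> infinite (carrier G))"
    and X: "compact (UNIV :: 'x set)"
    and sys: "G_system G act"
  shows "(mdim G act < \<infinity> \<longrightarrow>
           (\<forall>F. folner_seq G F \<longrightarrow>
             (\<exists>\<mu>\<in>invariant_measures G act. mdim_meas act F \<mu> = mdim G act) \<and>
             (\<forall>\<mu>\<in>invariant_measures G act. mdim_meas act F \<mu> \<le> mdim G act))) \<and>
         (\<forall>F. folner_seq G F \<longrightarrow> mmdim act F < \<infinity> \<longrightarrow>
             (\<exists>\<mu>\<in>invariant_measures G act. mmdim_meas act F \<mu> = mmdim act F) \<and>
             (\<forall>\<mu>\<in>invariant_measures G act. mmdim_meas act F \<mu> \<le> mmdim act F))"
proof -
  have cancel: "monoid_cancel G"
    using G monoid_cancel_of_iso_Zplus monoid_cancel_of_group by (auto simp: countable_amenable_group_def)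
  show ?thesis
  proof (intro conjI impI allI)
    fix F assume fin: "mdim G act < \<infinity>" and F: "folner_seq G F"
    interpret limsup_potential G act F "principal open_covers" "normalised_cover_potential act F"
      by (rule limsup_potential_cover[OF cancel X sys F])
    have eq: "mdim_pot act F f = \<Gamma> f" if "f \<in> C_space" for f
      using mdim_pot_eq_Limsup[OF X sys F] that by (simp add: \<Gamma>_def C_space_def)
    have zero: "\<Gamma> (\<lambda>_. 0) = mdim G act"
      using mdim_pot_zero[OF cancel X sys F] eq[of "\<lambda>_. 0"] by (simp add: C_space_def)
    have le: "mdim_meas act F \<mu> \<le> mdim G act" for \<mu>
      using INF_potential_le[of "mdim_pot act F" \<mu>] mdim_pot_zero[OF cancel X sys F] by (simp add: mdim_meas_def)
    then show "\<forall>\<mu>\<in>invariant_measures G act. mdim_meas act F \<mu> \<le> mdim G act" by blast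
    obtain \<mu> where \<mu>: "\<mu> \<in> invariant_measures G act"
      "\<And>f. f \<in> C_space \<Longrightarrow> mdim G act \<le> mdim_pot act F f - ereal (integral\<^sup>L \<mu> f)"
      using ex_invariant_measure fin eq unfolding zero by auto
    then have "mdim G act \<le> mdim_meas act F \<mu>" unfolding mdim_meas_def by (intro INF_greatest)
    then show "\<exists>\<mu>\<in>invariant_measures G act. mdim_meas act F \<mu> = mdim G act"
      using \<mu>(1) le antisym by blast
  next
    fix F assume F: "folner_seq G F" and fin: "mmdim act F < \<infinity>"
    interpret limsup_potential G act F "at_right 0" "normalised_sep_pressure act F"
      by (rule limsup_potential_sep_pressure[OF cancel X sys F])
    have eq: "mmdim_pot act F f = \<Gamma> f" for f
      by (simp add: mmdim_pot_eq_Limsup \<Gamma>_def)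
    have zero: "\<Gamma> (\<lambda>_. 0) = mmdim act F" by (simp add: mmdim_def eq)
    have le: "mmdim_meas act F \<mu> \<le> mmdim act F" for \<mu>
      using INF_potential_le[of "mmdim_pot act F" \<mu>] by (simp add: mmdim_meas_def mmdim_def)
    then show "\<forall>\<mu>\<in>invariant_measures G act. mmdim_meas act F \<mu> \<le> mmdim act F" by blast
    obtain \<mu> where \<mu>: "\<mu> \<in> invariant_measures G act"
      "\<And>f. f \<in> C_space \<Longrightarrow> mmdim act F \<le> mmdim_pot act F f - ereal (integral\<^sup>L \<mu> f)"
      using ex_invariant_measure fin eq unfolding zero by auto
    then have "mmdim act F \<le> mmdim_meas act F \<mu>" unfolding mmdim_meas_def by (intro INF_greatest)
    then show "\<exists>\<mu>\<in>invariant_measures G act. mmdim_meas act F \<mu> = mmdim act F"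
      using \<mu>(1) le antisym by blast
  qed
qed

end
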